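(* Let $\rho>1$ and $\lambda\in\mathbb{C}$ with $\lambda\ne0,1$. Then $$\mathcal{M}_0(\lambda,E_{1/\rho})=S(\rho)\setminus\left\{z:\arg z=\pm\tfrac{\pi}{2\rho}\right\}.$$
   Context: For $\rho>1$, $E_{1/\rho}(z)=\sum_{j=0}^\infty \frac{z^j}{\Gamma(1+j/\rho)}$ is the Mittag--Leffler function of order $\rho$. Its sections and tails are $s_n(z)=\sum_{k=0}^n\frac{z^k}{\Gamma(1+k/\rho)}$ and $t_n(z)=\sum_{k=n}^\infty\frac{z^k}{\Gamma(1+k/\rho)}$. For $n\ge1$, $R_n=\frac{\Gamma(1+n/\rho)}{\Gamma(1+(n-1)/\rho)}$. For $\lambda\in\mathbb{C}$, $\mathcal{M}_n(\lambda,E_{1/\rho})$ is the set of all roots $z\in\mathbb{C}$ of $(1-\lambda)s_n(R_nz)-\lambda t_{n+1}(R_nz)=0$; $\mathcal{M}(\lambda,E_{1/\rho})$ is the set of all accumulation points (in $\mathbb{C}$) of the set $\bigcup_{n=1}^\infty\mathcal{M}_n(\lambda,E_{1/\rho})$; and $\mathcal{M}_0(\lambda,E_{1/\rho})=\mathcal{M}(\lambda,E_{1/\rho})\setminus\{z:\arg z=\pm\frac{\pi}{2\rho}\}$, the two rays being understood to include their endpoint $0$. The generalized Szegő curve $S(\rho)$ is the set of all points $\sigma e^{i\phi}$, $\sigma>0$, $-\frac{\pi}{2\rho}\le\phi<2\pi-\frac{\pi}{2\rho}$, such that: (i) if $-\frac{\pi}{2\rho}\le\phi\le\frac{\pi}{2\rho}$,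 then $\sigma^\rho\cos(\phi\rho)-1-\rho\log\sigma=0$ (all positive solutions $\sigma$ are included); (ii) if $\frac{\pi}{2\rho}<\phi<2\pi-\frac{\pi}{2\rho}$, then $\sigma=e^{-1/\rho}$. *)

theory Defs
  imports "HOL-Analysis.Analysis"
begin

text \<open>Sections and tails of the Mittag-Leffler function of order \<open>\<rho>\<close>, i.e. of the power series
  with the following (positive real) coefficients, which is entire for \<open>\<rho> > 0\<close>.\<close>

definition ml_coeff :: "real \<Rightarrow> nat \<Rightarrow> real" where
  "ml_coeff \<rho> k = 1 / Gamma (1 + real k / \<rho>)"

definition ml_section :: "real \<Rightarrow> nat \<Rightarrow> complex \<Rightarrow> complex" where
  "ml_section \<rho> n z = (\<Sum>k\<le>n. of_real (ml_coeff \<rho> k) * z ^ k)"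

definition ml_tail :: "real \<Rightarrow> nat \<Rightarrow> complex \<Rightarrow> complex" where
  "ml_tail \<rho> n z = (\<Sum>k. of_real (ml_coeff \<rho> (n + k)) * z ^ (n + k))"

text \<open>Only used for \<open>n \<ge> 1\<close>.\<close>

definition ml_radius :: "real \<Rightarrow> nat \<Rightarrow> real" where
  "ml_radius \<rho> n = Gamma (1 + real n / \<rho>) / Gamma (1 + (real n - 1) / \<rho>)"

definition ml_roots :: "real \<Rightarrow> complex \<Rightarrow> nat \<Rightarrow> complex set" where
  "ml_roots \<rho> lam n =
     {z. (1 - lam) * ml_section \<rho> n (of_real (ml_radius \<rho> n) * z)
         - lam * ml_tail \<rho> (n + 1) (of_real (ml_radius \<rho> n) * z) = 0}"

definition ml_root_limits :: "real \<Rightarrow> complex \<Rightarrow> complex set" where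
  "ml_root_limits \<rho> lam = {z. z islimpt (\<Union>n\<in>{1..}. ml_roots \<rho> lam n)}"

text \<open>The two rays \<open>arg z = \<plusminus>\<pi>/(2\<rho>)\<close>, including their endpoint 0.\<close>

definition critical_rays :: "real \<Rightarrow> complex set" where
  "critical_rays \<rho> =
     {of_real r * cis \<theta> | r \<theta>. r \<ge> 0 \<and> (\<theta> = pi / (2 * \<rho>) \<or> \<theta> = - (pi / (2 * \<rho>)))}"

definition ml_root_limits0 :: "real \<Rightarrow> complex \<Rightarrow> complex set" where
  "ml_root_limits0 \<rho> lam = ml_root_limits \<rho> lam - critical_rays \<rho>"

definition szego_curve :: "real \<Rightarrow> complex set" where
  "szego_curve \<rho> =
     {of_real \<sigma> * cis \<phi> | \<sigma> \<phi>.
        \<sigma> > 0 \<and> - (pi / (2 * \<rho>)) \<le> \<phi> \<and> \<phi> < 2 * pi - pi / (2 * \<rho>) \<and>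
        (\<phi> \<le> pi / (2 * \<rho>) \<longrightarrow> \<sigma> powr \<rho> * cos (\<phi> * \<rho>) - 1 - \<rho> * ln \<sigma> = 0) \<and>
        (pi / (2 * \<rho>) < \<phi> \<longrightarrow> \<sigma> = exp (- 1 / \<rho>))}"

end

(* With R = ml_radius n, the equation says that the tail at R z equals (1 - lam) E(R z), equivalently that
   the section at R z equals lam E(R z), where E is the Mittag-Leffler function.
   On an exponential scale the tail (for |z| <= 1) and the section (for |z| >= 1) have
   size |z|^n e^(n/rho), while E(R z) has size exp(n Re(z^rho) / rho) for |arg z| < pi/(2 rho) and only
   polynomial size for |arg z| > pi/(2 rho). Off the critical rays the curve is the locus where the two
   rates agree. Away from it the two sides cannot balance, so roots do not accumulate. Near a point of the
   curve the quotient of the two sides tends to 0 on one side of the curve and to infinity on the other;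
   if it omitted the value required for a root, it would omit two values, against Schottky's theorem.

   The asymptotics of E come from summing its series by residues against periodic kernels, with a bound
   for 1/Gamma on vertical lines. *)
theory Submission
  imports Defs "HOL-Complex_Analysis.Complex_Analysis" "HOL-Real_Asymp.Real_Asymp"
begin

section \<open>Decay of the reciprocal Gamma function on vertical lines\<close>

text \<open>Only limits of \<open>ln (norm ...) / n\<close> enter the comparison, so factors
  polynomial in n may be lost freely; log-convexity of Gamma then replaces the sharp form of
  Stirling's formula. The radius R is the quotient of the coefficients of index n - 1 and n: on the
  circle of radius R these two terms of the series have equal modulus, and by log-convexity the
  moduli decrease in both directions from there. Upper bounds are therefore easy, and the obstacle
  is cancellation, which threatens every lower bound. For the tail and the section it is overcome by
  multiplying with 1 - z or 1 - 1/z and using the monotonicity of the coefficients; this degenerates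
  at z = 1 only. For E itself the obstacle sits at the critical rays, near which the exponential and
  the algebraic part are comparable and may cancel. The use of Schottky's theorem requires one
  holomorphic quotient on a whole disc, hence a disc on one side of the unit circle; off the
  critical rays the curve meets that circle only at 1.\<close>

lemma norm_rGamma_half_Im:
  "norm (rGamma (Complex (1/2) y)) \<le> exp (pi * \<bar>y\<bar> / 2) * rGamma (1/2 :: real)"
proof -
  let ?w = "Complex (1/2) y"
  \<comment> \<open>On the line Re = 1/2 the reflection w -> 1 - w is complex conjugation, so the
    reflection formula yields the square of the norm exactly.\<close>
  have c: "1 - ?w = cnj ?w" by (simp add: complex_eq_iff)
  have "rGamma ?w * rGamma (1 - ?w) = sin (of_real pi * ?w) / of_real pi"
    by (rule rGamma_reflection_complex)
  hence "norm (rGamma ?w) * norm (cnj (rGamma ?w)) = norm (sin (of_real pi * ?w)) / pi"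
    unfolding c cnj_rGamma by (metis norm_divide norm_mult norm_of_real abs_of_pos pi_gt_zero)
  hence sq: "norm (rGamma ?w) ^ 2 = norm (sin (of_real pi * ?w)) / pi"
    by (simp add: power2_eq_square)
  have "sin (of_real pi * ?w) = sin (of_real pi / 2 - - (\<i> * of_real (pi * y)))"
    by (rule arg_cong[where f = sin]) (simp add: complex_eq_iff)
  also have "\<dots> = cosh (of_real (pi * y))"
    by (subst cos_sin_eq [symmetric]) (simp only: cos_minus cosh_conv_cos)
  also have "norm \<dots> = cosh (pi * y)"
  proof -
    have "cosh (complex_of_real (pi * y)) = of_real (cosh (pi * y))"
      unfolding cosh_field_def by (simp flip: exp_of_real of_real_minus of_real_mult)
    thus ?thesis by (simp only: norm_of_real) simp
  qed
  finally have "norm (sin (of_real pi * ?w)) = cosh (pi * y)" .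
  also have "cosh (pi * y) \<le> exp (pi * \<bar>y\<bar>)"
  proof -
    have "\<bar>pi * y\<bar> = pi * \<bar>y\<bar>" by (simp add: abs_mult)
    hence "exp (pi * y) \<le> exp (pi * \<bar>y\<bar>)" "exp (- (pi * y)) \<le> exp (pi * \<bar>y\<bar>)"
      unfolding exp_le_cancel_iff by linarith+
    from add_mono[OF this] show ?thesis unfolding cosh_field_def by simp
  qed
  finally have "norm (rGamma ?w) ^ 2 \<le> exp (pi * \<bar>y\<bar>) / pi"
    unfolding sq by (simp add: field_simps)
  also have "\<dots> = (exp (pi * \<bar>y\<bar> / 2) * rGamma (1/2 :: real))\<^sup>2"
    by (simp add: power_mult_distrib rGamma_inverse_Gamma Gamma_one_half_real power_inverse
        field_simps flip: exp_double)
  finally show ?thesis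
    by (rule power2_le_imp_le) (simp add: rGamma_inverse_Gamma Gamma_one_half_real)
qed

lemma norm_rGamma_le:
  fixes z :: complex
  assumes "Re z \<ge> 1/2"
  shows "norm (rGamma z) \<le> exp (pi * \<bar>Im z\<bar> / 2) * rGamma (Re z)"
proof -
  let ?x = "Re z" and ?y = "Im z"
  let ?w = "Complex (1/2) ?y"
  \<comment> \<open>Factor by factor in Euler's product, \<open>\<bar>\<Gamma>(x)/\<Gamma>(x + iy)\<bar>\<close> decreases in \<open>x\<close>; so the line \<open>x = 1/2\<close> is the worst case.\<close>
  have poch: "norm (pochhammer z n) * pochhammer (1/2) n \<le> norm (pochhammer ?w n) * pochhammer ?x n" for n
  proof (induction n)
    case (Suc n)
    have "norm (z + of_nat n) * (1/2 + real n) \<le> norm (?w + of_nat n) * (?x + real n)"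
    proof (rule power2_le_imp_le)
      let ?p = "?x + real n" and ?q = "1/2 + real n"
      have pq: "?q\<^sup>2 \<le> ?p\<^sup>2" using assms by (intro power_mono) auto
      have "(norm (z + of_nat n) * ?q)\<^sup>2 = (?p\<^sup>2 + ?y\<^sup>2) * ?q\<^sup>2"
        by (simp add: power_mult_distrib cmod_power2)
      also have "\<dots> = ?p\<^sup>2 * ?q\<^sup>2 + ?y\<^sup>2 * ?q\<^sup>2" by (simp add: algebra_simps)
      also have "\<dots> \<le> ?p\<^sup>2 * ?q\<^sup>2 + ?y\<^sup>2 * ?p\<^sup>2"
        using pq by (intro add_left_mono mult_left_mono) auto
      also have "\<dots> = (?q\<^sup>2 + ?y\<^sup>2) * ?p\<^sup>2" by (simp add: algebra_simps)
      also have "\<dots> = (norm (?w + of_nat n) * ?p)\<^sup>2"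
        by (simp add: power_mult_distrib cmod_power2)
      finally show "(norm (z + of_nat n) * ?q)\<^sup>2 \<le> (norm (?w + of_nat n) * ?p)\<^sup>2" .
    qed (use assms in auto)
    from mult_mono[OF Suc this] show ?case
      using assms by (simp add: pochhammer_Suc norm_mult mult_ac pochhammer_nonneg)
  qed auto
  have ser: "norm (rGamma_series z n) * rGamma_series (1/2) n \<le>
        norm (rGamma_series ?w n) * rGamma_series ?x n" for n
  proof -
    have "norm (exp (z * of_real (ln (real n)))) = exp (?x * ln (real n))"
         "norm (exp (?w * of_real (ln (real n)))) = exp (1/2 * ln (real n))"
      by (simp_all)
    thus ?thesis using poch[of "n+1"]
      by (simp add: rGamma_series_def norm_divide norm_mult divide_right_mono field_simps)
  qed
  have "norm (rGamma z) * rGamma (1/2) \<le> norm (rGamma ?w) * rGamma ?x"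
  proof (rule LIMSEQ_le)
    show "(\<lambda>n. norm (rGamma_series z n) * rGamma_series (1/2) n)
            \<longlonglongrightarrow> norm (rGamma z) * rGamma (1/2)"
      by (intro tendsto_intros)
    show "(\<lambda>n. norm (rGamma_series ?w n) * rGamma_series ?x n)
            \<longlonglongrightarrow> norm (rGamma ?w) * rGamma ?x"
      by (intro tendsto_intros)
  qed (use ser in blast)
  also have "\<dots> \<le> exp (pi * \<bar>?y\<bar> / 2) * rGamma (1/2) * rGamma ?x"
    using assms by (intro mult_right_mono norm_rGamma_half_Im) (auto simp: rGamma_inverse_Gamma)
  finally show ?thesis
    by (simp add: rGamma_inverse_Gamma Gamma_one_half_real field_simps)
qed

text \<open>One step of the functional equation carries the bound across the zero of
  \<open>rGamma\<close> at 0. The half plane is large enough for the line Re s = -3/2 used later,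
  since 1 + a s then has real part at least -1/2 for 0 < a \<le> 1.\<close>

lemma norm_rGamma_le_shift:
  fixes z :: complex
  assumes "Re z \<ge> - 1/2"
  shows "norm (rGamma z) \<le> norm z * exp (pi * \<bar>Im z\<bar> / 2) * rGamma (Re z + 1)"
proof -
  have "rGamma z = z * rGamma (z + 1)" by (simp add: rGamma_plus1)
  thus ?thesis using norm_rGamma_le[of "z + 1"] assms
    by (simp add: norm_mult mult.assoc mult_left_mono)
qed

section \<open>Summation by residues over rectangles\<close>

text \<open>The denominator has simple zeros exactly at the points k/\<beta>, with derivative 2 pi i
  \<beta> at each of them, so every enclosed point contributes G(k/\<beta>)/\<beta>. Both periods, 1
  and \<rho>, are instances of this one statement.\<close>

lemma contour_integral_rectpath_periodic_kernel:
  fixes G :: "complex \<Rightarrow> complex" and \<beta> x0 x1 T :: real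
  assumes G: "G holomorphic_on UNIV" and \<beta>: "\<beta> > 0" and le: "x0 < x1" "0 < T"
    and x0: "\<beta> * x0 \<notin> \<int>" and x1: "\<beta> * x1 \<notin> \<int>"
    and nz: "\<And>k::int. x0 < k / \<beta> \<Longrightarrow> k / \<beta> < x1 \<Longrightarrow> G (of_real (k / \<beta>)) \<noteq> 0"
  defines "f \<equiv> \<lambda>s. G s / (exp (2 * pi * \<i> * \<beta> * s) - 1)"
  defines "\<gamma> \<equiv> rectpath (Complex x0 (-T)) (Complex x1 T)"
  shows "contour_integral \<gamma> f = (\<Sum>k | x0 < of_int k / \<beta> \<and> of_int k / \<beta> < x1. G (of_real (of_int k / \<beta>))) / \<beta>"
    and "f contour_integrable_on \<gamma>"
proof -
  let ?g = "\<lambda>s. exp (2 * pi * \<i> * \<beta> * s) - 1"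
  \<comment> \<open>The open box is larger than the rectangle by 1 on each side so that it contains
    the path. The poles of K - I lie in the margin and have winding number 0.\<close>
  define S where "S = box (Complex (x0-1) (-T-1)) (Complex (x1+1) (T+1))"
  define K where "K = {k::int. x0 - 1 < of_int k / \<beta> \<and> of_int k / \<beta> < x1 + 1}"
  define I where "I = {k::int. x0 < of_int k / \<beta> \<and> of_int k / \<beta> < x1}"
  define pt :: "int \<Rightarrow> complex" where "pt = (\<lambda>k. of_real (of_int k / \<beta>))"
  have zero_iff: "?g s = 0 \<longleftrightarrow> (\<exists>k. s = pt k)" for s
  proof -
    have "?g s = 0 \<longleftrightarrow> exp (2 * pi * \<i> * \<beta> * s) = 1" by simp
    also have "\<dots> \<longleftrightarrow> Im s = 0 \<and> (\<exists>n::int. Re s = n / \<beta>)"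
      unfolding exp_eq_1 using \<beta> by (auto simp: field_simps)
    also have "\<dots> \<longleftrightarrow> (\<exists>k. s = pt k)"
      by (auto simp: pt_def complex_eq_iff)
    finally show ?thesis .
  qed
  have finK: "finite K"
  proof (rule finite_subset)
    show "K \<subseteq> {\<lfloor>\<beta> * (x0 - 1)\<rfloor>..\<lceil>\<beta> * (x1 + 1)\<rceil>}"
      using \<beta> by (auto simp: K_def field_simps floor_le_iff le_ceiling_iff)
  qed auto
  have IK: "I \<subseteq> K" by (auto simp: I_def K_def)
  have inj: "inj_on pt A" for A using \<beta> by (auto simp: inj_on_def pt_def)
  have holg: "?g holomorphic_on A" for A by (intro holomorphic_intros)
  have hol: "f holomorphic_on S - pt ` K"
  proof -
    have "?g s \<noteq> 0" if "s \<in> S - pt ` K" for s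
    proof
      assume "?g s = 0"
      then obtain k where k: "s = pt k" using zero_iff by blast
      with that have "k \<in> K" by (auto simp: S_def K_def pt_def in_box_complex_iff)
      with that k show False by auto
    qed
    thus ?thesis unfolding f_def
      by (intro holomorphic_intros holomorphic_on_subset[OF G]) auto
  qed
  have pim: "path_image \<gamma> = {z. Re z \<in> {x0, x1} \<and> Im z \<in> {-T..T}} \<union> {z. Im z \<in> {-T, T} \<and> Re z \<in> {x0..x1}}"
    unfolding \<gamma>_def using le by (subst path_image_rectpath) auto
  have nx: "of_int k / \<beta> \<noteq> x0" "of_int k / \<beta> \<noteq> x1" for k :: int
  proof -
    have "of_int k / \<beta> \<noteq> x" if "\<beta> * x \<notin> \<int>" for x
      using that \<beta> by (metis Ints_of_int less_irrefl nonzero_mult_div_cancel_left times_divide_eq_right)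
    thus "of_int k / \<beta> \<noteq> x0" "of_int k / \<beta> \<noteq> x1" using x0 x1 by auto
  qed
  have pi_sub: "path_image \<gamma> \<subseteq> S - pt ` K"
  proof
    fix z assume z: "z \<in> path_image \<gamma>"
    hence "z \<in> S" using le unfolding pim S_def by (auto simp: in_box_complex_iff)
    moreover have "z \<noteq> pt k" for k using z le nx[of k] unfolding pim pt_def by (auto simp: complex_eq_iff)
    ultimately show "z \<in> S - pt ` K" by auto
  qed
  have vp: "valid_path \<gamma>" by (simp add: \<gamma>_def)
  have oS: "open S" "connected S" by (auto simp: S_def open_box intro: convex_connected convex_box)
  show "f contour_integrable_on \<gamma>"
    by (rule contour_integrable_holomorphic_simple[OF hol _ vp pi_sub])
       (intro open_Diff oS finite_imp_closed finite_imageI finK)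
  have "contour_integral \<gamma> f = 2 * pi * \<i> * (\<Sum>p\<in>pt ` K. winding_number \<gamma> p * residue f p)"
  proof (rule Residue_theorem[OF oS _ hol vp _ pi_sub])
    show "\<forall>z. z \<notin> S \<longrightarrow> winding_number \<gamma> z = 0"
      unfolding \<gamma>_def S_def using le
      by (auto intro!: winding_number_rectpath_outside simp: in_box_complex_iff in_cbox_complex_iff)
  qed (auto simp: finK \<gamma>_def)
  also have "(\<Sum>p\<in>pt ` K. winding_number \<gamma> p * residue f p) =
      (\<Sum>k\<in>K. winding_number \<gamma> (pt k) * residue f (pt k))"
    by (simp add: sum.reindex[OF inj])
  also have "\<dots> = (\<Sum>k\<in>I. winding_number \<gamma> (pt k) * residue f (pt k))"
  proof (rule sum.mono_neutral_right[OF finK IK], rule ballI)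
    fix k assume "k \<in> K - I"
    hence "pt k \<notin> cbox (Complex x0 (-T)) (Complex x1 T)"
      using nx[of k] by (auto simp: K_def I_def pt_def in_cbox_complex_iff)
    thus "winding_number \<gamma> (pt k) * residue f (pt k) = 0"
      unfolding \<gamma>_def using le by (subst winding_number_rectpath_outside) auto
  qed
  also have "\<dots> = (\<Sum>k\<in>I. G (pt k) / (2 * pi * \<i> * \<beta>))"
  proof (rule sum.cong[OF refl])
    fix k assume k: "k \<in> I"
    have "winding_number \<gamma> (pt k) = 1" unfolding \<gamma>_def
      using k le by (intro winding_number_rectpath) (auto simp: I_def pt_def in_box_complex_iff)
    moreover have "residue f (pt k) = G (pt k) / (2 * pi * \<i> * \<beta>)"
      unfolding f_def
    proof (rule residue_simple_pole_deriv[OF G holg])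
      have ex: "exp (2 * pi * \<i> * \<beta> * pt k) = 1" using zero_iff[of "pt k"] by auto
      show "(?g has_field_derivative 2 * pi * \<i> * \<beta>) (at (pt k))"
      proof -
        have "(?g has_field_derivative exp (2 * pi * \<i> * \<beta> * pt k) * (2 * pi * \<i> * \<beta>)) (at (pt k))"
          by (auto intro!: derivative_eq_intros)
        thus ?thesis unfolding ex by simp
      qed
      show "?g (pt k) = 0" using zero_iff by blast
      show "G (pt k) \<noteq> 0" using nz[of k] k by (simp add: I_def pt_def)
    qed (use \<beta> in auto)
    ultimately show "winding_number \<gamma> (pt k) * residue f (pt k) = G (pt k) / (2 * pi * \<i> * \<beta>)"
      by simp
  qed
  also have "2 * pi * \<i> * \<dots> = (\<Sum>k\<in>I. G (pt k)) / \<beta>"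
    by (simp add: sum_divide_distrib sum_distrib_left)
  finally show "contour_integral \<gamma> f = (\<Sum>k | x0 < of_int k / \<beta> \<and> of_int k / \<beta> < x1. G (of_real (of_int k / \<beta>))) / \<beta>"
    by (simp add: I_def pt_def)
qed

text \<open>The majorant has the primitive A arctan y, so the bound does not depend on the length of
  the segment; this is what allows rectangles of growing height.\<close>

lemma norm_contour_integral_vertical_le:
  fixes f :: "complex \<Rightarrow> complex"
  assumes cont: "continuous_on (closed_segment (Complex x a) (Complex x b)) f" and "a < b"
    and A: "\<And>y. a \<le> y \<Longrightarrow> y \<le> b \<Longrightarrow> norm (f (Complex x y)) \<le> A / (1 + y\<^sup>2)" and "A \<ge> 0"
  shows "norm (contour_integral (linepath (Complex x a) (Complex x b)) f) \<le> pi * A"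
proof -
  have "(f has_contour_integral contour_integral (linepath (Complex x a) (Complex x b)) f)
          (linepath (Complex x a) (Complex x b))"
    by (intro has_contour_integral_integral contour_integrable_continuous_linepath cont)
  hence hi: "((\<lambda>t. f (Complex x t)) has_integral
           (- \<i> * contour_integral (linepath (Complex x a) (Complex x b)) f)) {a..b}"
    using \<open>a < b\<close> by (subst (asm) has_contour_integral_linepath_same_Re_iff) auto
  have hA: "((\<lambda>y. A / (1 + y\<^sup>2)) has_integral (A * arctan b - A * arctan a)) {a..b}"
    using \<open>a < b\<close> by (intro fundamental_theorem_of_calculus)
      (auto intro!: derivative_eq_intros simp: field_simps simp flip: has_real_derivative_iff_has_vector_derivative)
  have "norm (contour_integral (linepath (Complex x a) (Complex x b)) f) \<le> A * arctan b - A * arctan a"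
    using integral_norm_bound_integral[OF has_integral_integrable[OF hi] has_integral_integrable[OF hA]] A
    unfolding integral_unique[OF hi] integral_unique[OF hA] by (simp add: norm_mult)
  also have "\<dots> = A * (arctan b - arctan a)" by (simp add: algebra_simps)
  also have "\<dots> \<le> A * pi"
    using arctan_bounded[of a] arctan_bounded[of b] \<open>A \<ge> 0\<close> by (intro mult_left_mono) auto
  finally show ?thesis by (simp add: mult_ac)
qed

lemma norm_contour_integral_rectpath_le:
  fixes f :: "complex \<Rightarrow> complex"
  assumes cont: "continuous_on (path_image (rectpath (Complex x0 (-T)) (Complex x1 T))) f"
    and le: "x0 < x1" "0 < T" and "A \<ge> 0" "B \<ge> 0" "D \<ge> 0"
    and A: "\<And>y. \<bar>y\<bar> \<le> T \<Longrightarrow> norm (f (Complex x0 y)) \<le> A / (1 + y\<^sup>2)"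
    and B: "\<And>y. \<bar>y\<bar> \<le> T \<Longrightarrow> norm (f (Complex x1 y)) \<le> B / (1 + y\<^sup>2)"
    and D: "\<And>x y. x0 \<le> x \<Longrightarrow> x \<le> x1 \<Longrightarrow> \<bar>y\<bar> = T \<Longrightarrow> norm (f (Complex x y)) \<le> D"
  shows "norm (contour_integral (rectpath (Complex x0 (-T)) (Complex x1 T)) f)
           \<le> pi * A + pi * B + 2 * D * (x1 - x0)"
proof -
  let ?a1 = "Complex x0 (-T)" and ?a2 = "Complex x1 (-T)" and ?a3 = "Complex x1 T" and ?a4 = "Complex x0 T"
  have pim: "path_image (rectpath ?a1 ?a3) = closed_segment ?a1 ?a2 \<union> closed_segment ?a2 ?a3 \<union>
      closed_segment ?a3 ?a4 \<union> closed_segment ?a4 ?a1"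
    by (simp add: rectpath_def Let_def path_image_join Un_assoc)
  have co: "continuous_on (closed_segment ?a1 ?a2) f" "continuous_on (closed_segment ?a2 ?a3) f"
     "continuous_on (closed_segment ?a3 ?a4) f" "continuous_on (closed_segment ?a4 ?a1) f"
    using cont unfolding pim by (auto elim: continuous_on_subset)
  note ci = co[THEN contour_integrable_continuous_linepath]
  have hor: "norm (contour_integral (linepath p q) f) \<le> D * (x1 - x0)"
    if "f contour_integrable_on (linepath p q)" "Im p = y" "Im q = y" "\<bar>y\<bar> = T"
       "{Re p, Re q} = {x0, x1}" for p q y
  proof -
    have "norm (q - p) = x1 - x0"
      using that le by (auto simp: doubleton_eq_iff cmod_def)
    moreover have "norm (f z) \<le> D" if z: "z \<in> closed_segment p q" for z
    proof -
      have "Im z = y" "x0 \<le> Re z \<and> Re z \<le> x1"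
        using z that \<open>Im p = y\<close> \<open>Im q = y\<close> \<open>{Re p, Re q} = {x0, x1}\<close> le
        by (auto simp: closed_segment_same_Im closed_segment_eq_real_ivl doubleton_eq_iff)
      thus ?thesis using D[of "Re z" "Im z"] \<open>\<bar>y\<bar> = T\<close> by (metis complex_surj)
    qed
    ultimately show ?thesis
      using contour_integral_bound_linepath[OF that(1) \<open>D \<ge> 0\<close>] by metis
  qed
  have v1: "norm (contour_integral (linepath ?a2 ?a3) f) \<le> pi * B"
    using le B \<open>B \<ge> 0\<close> by (intro norm_contour_integral_vertical_le co) auto
  have "norm (contour_integral (linepath ?a1 ?a4) f) \<le> pi * A"
    using le A \<open>A \<ge> 0\<close> co(4) by (intro norm_contour_integral_vertical_le) (auto simp: closed_segment_commute)
  hence v2: "norm (contour_integral (linepath ?a4 ?a1) f) \<le> pi * A"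
    by (subst contour_integral_reverse_linepath) (use co in auto)
  have h1: "norm (contour_integral (linepath ?a1 ?a2) f) \<le> D * (x1 - x0)"
    by (rule hor[OF ci(1)]) (use le in auto)
  have h2: "norm (contour_integral (linepath ?a3 ?a4) f) \<le> D * (x1 - x0)"
    by (rule hor[OF ci(3)]) (use le in auto)
  have "contour_integral (rectpath ?a1 ?a3) f = contour_integral (linepath ?a1 ?a2) f +
     (contour_integral (linepath ?a2 ?a3) f + (contour_integral (linepath ?a3 ?a4) f +
      contour_integral (linepath ?a4 ?a1) f))"
    using ci by (simp add: rectpath_def Let_def)
  also have "norm \<dots> \<le> D * (x1 - x0) + (pi * B + (D * (x1 - x0) + pi * A))"
    by (intro order_trans[OF norm_triangle_ineq] add_mono h1 h2 v1 v2)
  finally show ?thesis by (simp add: algebra_simps)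
qed

section \<open>Asymptotics of the coefficients and of the scaling radii\<close>

lemma Gamma_one_plus_real: "x > 0 \<Longrightarrow> Gamma (1 + x :: real) = x * Gamma x"
proof -
  assume "x > 0"
  hence "x \<notin> \<int>\<^sub>\<le>\<^sub>0" by (auto elim!: nonpos_Ints_cases)
  from Gamma_plus1[OF this] show ?thesis by (simp add: add.commute)
qed

lemma ln_Gamma_one_plus: "x > 0 \<Longrightarrow> ln (Gamma (1 + x :: real)) = ln x + ln (Gamma x)"
  by (simp add: Gamma_one_plus_real ln_mult_pos)

text \<open>By the functional equation the chord of ln Gamma over [x, x + 1] has slope ln x, and a
  convex function lies below its chord.\<close>

lemma ln_Gamma_add_le:
  fixes x h :: real
  assumes "x > 0" "0 \<le> h" "h \<le> 1"
  shows "ln (Gamma (x + h)) - ln (Gamma x) \<le> h * ln x"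
proof -
  have "ln (Gamma ((1 - h) * x + h * (x + 1))) \<le> (1 - h) * ln (Gamma x) + h * ln (Gamma (x + 1))"
    using convex_onD[OF log_convex_Gamma_real, of h x "x + 1"] assms by simp
  moreover have "(1 - h) * x + h * (x + 1) = x + h" by (simp add: algebra_simps)
  moreover have "ln (Gamma (x + 1)) = ln x + ln (Gamma x)"
    using assms ln_Gamma_one_plus[of x] by (simp add: add.commute)
  ultimately show ?thesis by (simp add: algebra_simps)
qed

text \<open>Slopes of a convex function increase: the chord over [x, 1 + x] has slope ln x, and the
  adjacent chord over [1 + x, 1 + x + h] is at least as steep. The weight t expresses 1 + x as a
  convex combination of the outer points.\<close>

lemma ln_Gamma_add_ge:
  fixes x h :: real
  assumes "x > 0" "0 \<le> h"
  shows "h * ln x \<le> ln (Gamma (1 + x + h)) - ln (Gamma (1 + x))"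
proof -
  define t where "t = 1 / (1 + h)"
  have t: "t \<ge> 0" "t \<le> 1" "t * (1 + h) = 1" "1 - t = t * h" using assms by (auto simp: t_def field_simps)
  have "(1 - t) * x + t * (1 + x + h) = x + t * (1 + h)" by (simp add: algebra_simps)
  also have "\<dots> = 1 + x" using t by simp
  finally have eq: "(1 - t) * x + t * (1 + x + h) = 1 + x" .
  have "ln (Gamma (1 + x)) \<le> (1 - t) * ln (Gamma x) + t * ln (Gamma (1 + x + h))"
    using convex_onD[OF log_convex_Gamma_real, of t x "1 + x + h"] assms t eq by simp
  hence "(1 + h) * ln (Gamma (1 + x)) \<le> (1 + h) * ((1 - t) * ln (Gamma x) + t * ln (Gamma (1 + x + h)))"
    using assms by (intro mult_left_mono) auto
  also have "\<dots> = (t * (1 + h)) * h * ln (Gamma x) + (t * (1 + h)) * ln (Gamma (1 + x + h))"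
    unfolding t(4) by (simp add: algebra_simps)
  finally have *: "(1 + h) * ln (Gamma (1 + x)) \<le> h * ln (Gamma x) + ln (Gamma (1 + x + h))"
    unfolding t(3) by simp
  with * show ?thesis using ln_Gamma_one_plus[OF assms(1)] by (simp add: algebra_simps)
qed

text \<open>The function x ln x - x is a primitive of the logarithm, so its increments lie between h
  times the two endpoint values. It serves as the comparison function when increments of ln Gamma
  are summed.\<close>

lemma mult_ln_minus_self_diff:
  fixes x h :: real
  assumes "x > 0" "h \<ge> 0"
  shows "h * ln x \<le> ((x + h) * ln (x + h) - (x + h)) - (x * ln x - x)"
    and "((x + h) * ln (x + h) - (x + h)) - (x * ln x - x) \<le> h * ln (x + h)"
proof -
  have l: "ln (x + h) - ln x = ln ((x + h) / x)" using assms by (simp add: ln_div)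
  have "(x + h) / x - 1 = h / x" using assms by (simp add: field_simps)
  hence "ln (x + h) - ln x \<le> h / x" using ln_le_minus_one[of "(x + h) / x"] assms l by simp
  hence "x * (ln (x + h) - ln x) \<le> h" using assms by (simp add: field_simps)
  thus "((x + h) * ln (x + h) - (x + h)) - (x * ln x - x) \<le> h * ln (x + h)" by (simp add: algebra_simps)
  have "- ln ((x + h) / x) = ln (x / (x + h))" using assms by (simp add: ln_div)
  also have "\<dots> \<le> x / (x + h) - 1" using assms by (intro ln_le_minus_one) auto
  also have "\<dots> = - (h / (x + h))" using assms by (simp add: field_simps)
  finally have "(x + h) * (ln (x + h) - ln x) \<ge> h" using assms l by (simp add: field_simps)
  thus "h * ln x \<le> ((x + h) * ln (x + h) - (x + h)) - (x * ln x - x)" by (simp add: algebra_simps)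
qed

section \<open>Coefficients and radii: monotonicity, growth and the maximal term\<close>

lemma ml_coeff_pos: "\<rho> > 0 \<Longrightarrow> ml_coeff \<rho> k > 0"
  by (auto simp: ml_coeff_def intro!: divide_pos_pos Gamma_real_pos add_pos_nonneg)

lemma ml_radius_Suc: "\<rho> > 0 \<Longrightarrow> ml_radius \<rho> (Suc n) = ml_coeff \<rho> n / ml_coeff \<rho> (Suc n)"
  by (simp add: ml_radius_def ml_coeff_def)

lemma ml_radius_pos: "\<rho> > 0 \<Longrightarrow> n \<ge> 1 \<Longrightarrow> ml_radius \<rho> n > 0"
  by (cases n) (auto simp: ml_radius_Suc ml_coeff_pos)

text \<open>The convexity of \<open>ln \<circ> \<Gamma>\<close> is applied at \<open>1 + x\<close> rather than at \<open>x\<close>: the functional equation then yields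
  a strict gain, and a polynomially small gap suffices against exponentially small terms.\<close>

lemma ml_radius_growth:
  assumes "\<rho> > 0" "n \<ge> 1"
  shows "ml_radius \<rho> n \<le> (1 - 1 / (real n + \<rho>)\<^sup>2) * ml_radius \<rho> (Suc n)"
proof -
  define h where "h = 1 / \<rho>"
  define x where "x = 1 + n * h"
  have h: "h > 0" "x - h > 0" "x + h > 0" "x > 0"
  proof -
    show h: "h > 0" using assms by (simp add: h_def)
    have "real n * h \<ge> 1 * h" using assms h by (intro mult_right_mono) auto
    thus "x - h > 0" "x + h > 0" "x > 0" using h unfolding x_def by linarith+
  qed
  have "ln (Gamma (1 + x)) \<le> (ln (Gamma (1 + (x - h))) + ln (Gamma (1 + (x + h)))) / 2"
  proof -
    have mid: "(1 - 1/2) * (1 + (x - h)) + 1/2 * (1 + (x + h)) = 1 + x" by (simp add: field_simps)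
    have "(ln \<circ> Gamma) ((1 - 1/2) * (1 + (x - h)) + 1/2 * (1 + (x + h)))
        \<le> (1 - 1/2) * (ln \<circ> Gamma) (1 + (x - h)) + 1/2 * (ln \<circ> Gamma) (1 + (x + h))"
      using convex_onD[OF log_convex_Gamma_real, of "1/2" "1 + (x - h)" "1 + (x + h)"] h by simp
    thus ?thesis unfolding mid o_def by simp
  qed
  moreover have Gp: "Gamma (1 + x) > 0" "Gamma (1 + (x - h)) > 0" "Gamma (1 + (x + h)) > 0"
    using h by (auto intro!: Gamma_real_pos)
  ultimately have "ln (Gamma (1 + x) ^ 2) \<le> ln (Gamma (1 + (x - h)) * Gamma (1 + (x + h)))"
    by (simp add: ln_mult_pos ln_realpow)
  hence "Gamma (1 + x) ^ 2 \<le> Gamma (1 + (x - h)) * Gamma (1 + (x + h))"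
    using Gp by (subst (asm) ln_le_cancel_iff) auto
  hence *: "x\<^sup>2 * Gamma x ^ 2 \<le> (x\<^sup>2 - h\<^sup>2) * (Gamma (x - h) * Gamma (x + h))"
    unfolding Gamma_one_plus_real[OF h(2)] Gamma_one_plus_real[OF h(3)] Gamma_one_plus_real[OF h(4)]
    by (simp add: power_mult_distrib power2_eq_square algebra_simps)
  have G: "Gamma x > 0" "Gamma (x - h) > 0" "Gamma (x + h) > 0" using h by auto
  have R: "ml_radius \<rho> n = Gamma x / Gamma (x - h)" "ml_radius \<rho> (Suc n) = Gamma (x + h) / Gamma x"
  proof -
    have "1 + real n / \<rho> = x" "1 + (real n - 1) / \<rho> = x - h" "1 + real (Suc n) / \<rho> = x + h"
         "1 + (real (Suc n) - 1) / \<rho> = x"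
      by (simp_all add: x_def h_def add_divide_distrib diff_divide_distrib)
    thus "ml_radius \<rho> n = Gamma x / Gamma (x - h)" "ml_radius \<rho> (Suc n) = Gamma (x + h) / Gamma x"
      unfolding ml_radius_def by simp_all
  qed
  have "h / x = 1 / (real n + \<rho>)" using assms by (simp add: x_def h_def field_simps)
  hence c: "1 / (real n + \<rho>)\<^sup>2 = h\<^sup>2 / x\<^sup>2" by (metis power_divide power_one)
  have "Gamma x / Gamma (x - h) = x\<^sup>2 * Gamma x ^ 2 / (x\<^sup>2 * Gamma x * Gamma (x - h))"
  proof -
    have "Gamma (x - h) \<noteq> 0" "Gamma x \<noteq> 0" "x \<noteq> 0" using G h by linarith+
    thus ?thesis by (simp add: power2_eq_square)
  qed
  also have "\<dots> \<le> (x\<^sup>2 - h\<^sup>2) * (Gamma (x - h) * Gamma (x + h)) / (x\<^sup>2 * Gamma x * Gamma (x - h))"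
    using * G h by (intro divide_right_mono) auto
  also have "\<dots> = (1 - h\<^sup>2 / x\<^sup>2) * (Gamma (x + h) / Gamma x)"
  proof -
    have "Gamma (x - h) \<noteq> 0" "Gamma x \<noteq> 0" "x \<noteq> 0" using G h by linarith+
    thus ?thesis by (simp add: divide_simps)
  qed
  finally show ?thesis unfolding R c .
qed

lemma ml_radius_mono:
  assumes "\<rho> > 0" "1 \<le> m" "m \<le> n"
  shows "ml_radius \<rho> m \<le> ml_radius \<rho> n"
  using assms(3)
proof (induction n rule: dec_induct)
  case (step n)
  have "ml_radius \<rho> n \<le> (1 - 1 / (real n + \<rho>)\<^sup>2) * ml_radius \<rho> (Suc n)"
    using ml_radius_growth[of \<rho> n] assms step by simp
  also have "\<dots> \<le> 1 * ml_radius \<rho> (Suc n)"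
    using ml_radius_pos[OF assms(1), of "Suc n"] by (intro mult_right_mono) auto
  finally show ?case using step by simp
qed simp

lemma ln_ml_radius_bounds:
  assumes "\<rho> \<ge> 1" "n \<ge> 1"
  shows "ln (real n / \<rho>) / \<rho> \<le> ln (ml_radius \<rho> (Suc n))"
    and "ln (ml_radius \<rho> (Suc n)) \<le> ln (1 + real n / \<rho>) / \<rho>"
proof -
  have x: "real n / \<rho> > 0" "1 + real n / \<rho> > 0" using assms by (auto intro: add_pos_nonneg)
  have G: "Gamma (1 + real n / \<rho>) > 0" "Gamma (1 + real n / \<rho> + 1 / \<rho>) > 0"
    using assms x by (auto intro!: Gamma_real_pos add_pos_nonneg)
  have "ml_radius \<rho> (Suc n) = Gamma (1 + real n / \<rho> + 1 / \<rho>) / Gamma (1 + real n / \<rho>)"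
    using assms by (simp add: ml_radius_def add_divide_distrib add_ac)
  hence l: "ln (ml_radius \<rho> (Suc n)) = ln (Gamma (1 + real n / \<rho> + 1 / \<rho>)) - ln (Gamma (1 + real n / \<rho>))"
    using G by (simp add: ln_div)
  show "ln (real n / \<rho>) / \<rho> \<le> ln (ml_radius \<rho> (Suc n))"
    using ln_Gamma_add_ge[OF x(1), of "1/\<rho>"] assms unfolding l by simp
  show "ln (ml_radius \<rho> (Suc n)) \<le> ln (1 + real n / \<rho>) / \<rho>"
    using ln_Gamma_add_le[OF x(2), of "1/\<rho>"] assms unfolding l by simp
qed

text \<open>A crude Stirling formula, obtained by telescoping increments of ln Gamma against those
  of x ln x - x. The upper and lower bounds differ by O(ln n), which disappears after division by
  n.\<close>

lemma ln_ml_coeff_bounds: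
  assumes "\<rho> \<ge> 1"
  obtains C where "\<And>n. n \<ge> 1 \<Longrightarrow> - ln (ml_coeff \<rho> (Suc n)) \<ge> n / \<rho> * ln (n / \<rho>) - n / \<rho> - C"
    "\<And>n. n \<ge> 1 \<Longrightarrow> - ln (ml_coeff \<rho> n) \<le> (1 + n / \<rho>) * ln (1 + n / \<rho>) - (1 + n / \<rho>) + C"
proof -
  define h where "h = 1 / \<rho>"
  have h: "h > 0" "h \<le> 1" using assms by (auto simp: h_def)
  define \<phi> :: "real \<Rightarrow> real" where "\<phi> = (\<lambda>x. x * ln x - x)"
  define L where "L = (\<lambda>n. - ln (ml_coeff \<rho> n))"
  have L: "L n = ln (Gamma (1 + n * h))" for n
    using h by (simp add: L_def ml_coeff_def h_def ln_div Gamma_real_pos add_pos_nonneg)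
  \<comment> \<open>The right-hand index is one ahead because the lower bound for an increment of ln
    Gamma starting at 1 + x involves ln x, not ln (1 + x).\<close>
  have low: "\<phi> (n * h) - \<phi> h + L 2 \<le> L (Suc n)" if "n \<ge> 1" for n :: nat
    using that
  proof (induction n rule: dec_induct)
    case (step n)
    have n: "real n * h > 0" using step h by auto
    have "\<phi> (n * h + h) - \<phi> (n * h) \<le> h * ln (n * h + h)"
      using mult_ln_minus_self_diff(2)[OF n, of h] h by (simp add: \<phi>_def)
    also have "\<dots> \<le> ln (Gamma (1 + (n * h + h) + h)) - ln (Gamma (1 + (n * h + h)))"
      using n h by (intro ln_Gamma_add_ge) auto
    also have "\<dots> = L (Suc (Suc n)) - L (Suc n)" by (simp add: L algebra_simps)
    finally show ?case using step.IH by (simp add: algebra_simps)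
  qed (simp add: numeral_2_eq_2)
  have upp: "L n \<le> \<phi> (1 + n * h) - \<phi> 1" for n :: nat
  proof (induction n)
    case (Suc n)
    have n: "1 + real n * h > 0" using h by (auto intro: add_pos_nonneg)
    have "L (Suc n) - L n = ln (Gamma (1 + n * h + h)) - ln (Gamma (1 + n * h))"
      by (simp add: L algebra_simps)
    also have "\<dots> \<le> h * ln (1 + n * h)" using n h by (intro ln_Gamma_add_le) auto
    also have "\<dots> \<le> \<phi> (1 + n * h + h) - \<phi> (1 + n * h)"
      using mult_ln_minus_self_diff(1)[OF n, of h] h by (simp add: \<phi>_def)
    finally show ?case using Suc by (simp add: algebra_simps)
  qed (simp add: L)
  show ?thesis
  proof (rule that[of "\<bar>\<phi> h - L 2\<bar> + \<bar>\<phi> 1\<bar>"])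
    fix n :: nat assume "n \<ge> 1"
    thus "- ln (ml_coeff \<rho> (Suc n)) \<ge> n / \<rho> * ln (n / \<rho>) - n / \<rho> - (\<bar>\<phi> h - L 2\<bar> + \<bar>\<phi> 1\<bar>)"
      using low[of n] by (simp add: L_def \<phi>_def h_def)
    show "- ln (ml_coeff \<rho> n) \<le> (1 + n / \<rho>) * ln (1 + n / \<rho>) - (1 + n / \<rho>) + (\<bar>\<phi> h - L 2\<bar> + \<bar>\<phi> 1\<bar>)"
      using upp[of n] by (simp add: L_def \<phi>_def h_def)
  qed
qed

text \<open>This turns the exponent (R z)^\<rho> of the main term of E into approximately n z^\<rho>
  / \<rho>, and is the source of the factor 1/\<rho> in \<open>ml_growth\<close>.\<close>

lemma tendsto_ml_radius_powr:
  assumes "\<rho> \<ge> 1"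
  shows "(\<lambda>n. ml_radius \<rho> n powr \<rho> / real n) \<longlonglongrightarrow> 1 / \<rho>"
proof -
  have "(\<lambda>n. ml_radius \<rho> (Suc n) powr \<rho> / real (Suc n)) \<longlonglongrightarrow> 1 / \<rho>"
  proof (rule tendsto_sandwich)
    have b: "real n / \<rho> \<le> ml_radius \<rho> (Suc n) powr \<rho> \<and> ml_radius \<rho> (Suc n) powr \<rho> \<le> 1 + real n / \<rho>"
      if "n \<ge> 1" for n
    proof -
      have p: "ml_radius \<rho> (Suc n) > 0" "real n / \<rho> > 0" "1 + real n / \<rho> > 0"
        using assms that ml_radius_pos[of \<rho> "Suc n"] by (auto intro: add_pos_nonneg)
      have e: "ml_radius \<rho> (Suc n) powr \<rho> = exp (\<rho> * ln (ml_radius \<rho> (Suc n)))"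
        using p by (simp add: powr_def)
      have "ln (real n / \<rho>) \<le> \<rho> * ln (ml_radius \<rho> (Suc n))"
           "\<rho> * ln (ml_radius \<rho> (Suc n)) \<le> ln (1 + real n / \<rho>)"
        using ln_ml_radius_bounds[OF assms that] assms by (auto simp: field_simps)
      thus ?thesis unfolding e using p by (metis exp_le_cancel_iff exp_ln)
    qed
    show "\<forall>\<^sub>F n in sequentially. real n / \<rho> / real (Suc n) \<le> ml_radius \<rho> (Suc n) powr \<rho> / real (Suc n)"
      using eventually_ge_at_top[of 1] by eventually_elim (use b in \<open>intro divide_right_mono; simp\<close>)
    show "\<forall>\<^sub>F n in sequentially. ml_radius \<rho> (Suc n) powr \<rho> / real (Suc n) \<le> (1 + real n / \<rho>) / real (Suc n)"
      using eventually_ge_at_top[of 1] by eventually_elim (use b in \<open>intro divide_right_mono; simp\<close>)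
    show "(\<lambda>n. real n / \<rho> / real (Suc n)) \<longlonglongrightarrow> 1 / \<rho>"
      using assms unfolding inverse_eq_divide [symmetric] by real_asymp
    show "(\<lambda>n. (1 + real n / \<rho>) / real (Suc n)) \<longlonglongrightarrow> 1 / \<rho>"
      using assms unfolding inverse_eq_divide [symmetric] by real_asymp
  qed
  thus ?thesis by (subst (asm) filterlim_sequentially_Suc)
qed

lemma ml_radius_at_top:
  assumes "\<rho> \<ge> 1"
  shows "filterlim (ml_radius \<rho>) at_top sequentially"
proof -
  have "filterlim (\<lambda>n. ln (ml_radius \<rho> (Suc n))) at_top sequentially"
  proof (rule filterlim_at_top_mono)
    show "filterlim (\<lambda>n. ln (real n / \<rho>) / \<rho>) at_top sequentially" using assms by real_asymp
    show "\<forall>\<^sub>F n in sequentially. ln (real n / \<rho>) / \<rho> \<le> ln (ml_radius \<rho> (Suc n))"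
      using eventually_ge_at_top[of 1] by eventually_elim (rule ln_ml_radius_bounds[OF assms])
  qed
  hence "filterlim (\<lambda>n. exp (ln (ml_radius \<rho> (Suc n)))) at_top sequentially"
    by (rule filterlim_compose[OF exp_at_top])
  also have "(\<lambda>n. exp (ln (ml_radius \<rho> (Suc n)))) = (\<lambda>n. ml_radius \<rho> (Suc n))"
    using ml_radius_pos[of \<rho>] assms by simp
  finally show ?thesis by (subst (asm) filterlim_sequentially_Suc)
qed

lemma tendsto_ln_ml_radius:
  assumes "\<rho> \<ge> 1"
  shows "(\<lambda>n. ln (ml_radius \<rho> n) / real n) \<longlonglongrightarrow> 0"
proof -
  have "(\<lambda>n. ln (ml_radius \<rho> (Suc n)) / real (Suc n)) \<longlonglongrightarrow> 0"
  proof (rule tendsto_sandwich)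
    show "\<forall>\<^sub>F n in sequentially. ln (real n / \<rho>) / \<rho> / real (Suc n) \<le> ln (ml_radius \<rho> (Suc n)) / real (Suc n)"
      using eventually_ge_at_top[of 1]
      by eventually_elim (intro divide_right_mono ln_ml_radius_bounds[OF assms]; simp)
    show "\<forall>\<^sub>F n in sequentially. ln (ml_radius \<rho> (Suc n)) / real (Suc n) \<le> ln (1 + real n / \<rho>) / \<rho> / real (Suc n)"
      using eventually_ge_at_top[of 1]
      by eventually_elim (intro divide_right_mono ln_ml_radius_bounds[OF assms]; simp)
    show "(\<lambda>n. ln (real n / \<rho>) / \<rho> / real (Suc n)) \<longlonglongrightarrow> 0" using assms by real_asymp
    show "(\<lambda>n. ln (1 + real n / \<rho>) / \<rho> / real (Suc n)) \<longlonglongrightarrow> 0" using assms by real_asymp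
  qed
  thus ?thesis by (subst (asm) filterlim_sequentially_Suc)
qed

text \<open>The contributions (n/\<rho>) ln (n/\<rho>) of the coefficient and of the power of the
  radius cancel, and what survives is the linear term n/\<rho> of Stirling's formula.\<close>

lemma tendsto_ln_ml_max_term:
  assumes "\<rho> \<ge> 1"
  shows "(\<lambda>n. ln (ml_coeff \<rho> n * ml_radius \<rho> n ^ n) / real n) \<longlonglongrightarrow> 1 / \<rho>"
proof -
  obtain C where C: "\<And>n. n \<ge> 1 \<Longrightarrow> - ln (ml_coeff \<rho> (Suc n)) \<ge> n / \<rho> * ln (n / \<rho>) - n / \<rho> - C"
    "\<And>n. n \<ge> 1 \<Longrightarrow> - ln (ml_coeff \<rho> n) \<le> (1 + n / \<rho>) * ln (1 + n / \<rho>) - (1 + n / \<rho>) + C"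
    using ln_ml_coeff_bounds[OF assms] by blast
  have p: "ml_coeff \<rho> n > 0" "ml_radius \<rho> (Suc n) > 0" for n
    using assms by (auto intro: ml_coeff_pos ml_radius_pos)
  have eq: "ln (ml_coeff \<rho> (Suc n) * ml_radius \<rho> (Suc n) ^ Suc n) =
      ln (ml_coeff \<rho> (Suc n)) + real (Suc n) * ln (ml_radius \<rho> (Suc n))" for n
    using p[of "Suc n"] p[of n] by (simp add: ln_mult ln_realpow del: power_Suc of_nat_Suc)
  have "(\<lambda>n. ln (ml_coeff \<rho> (Suc n) * ml_radius \<rho> (Suc n) ^ Suc n) / real (Suc n)) \<longlonglongrightarrow> 1 / \<rho>"
    unfolding eq
  proof (rule tendsto_sandwich)
    show "\<forall>\<^sub>F n in sequentially. (- ((1 + real (Suc n) / \<rho>) * ln (1 + real (Suc n) / \<rho>) - (1 + real (Suc n) / \<rho>) + C)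
         + real (Suc n) * (ln (real n / \<rho>) / \<rho>)) / real (Suc n)
       \<le> (ln (ml_coeff \<rho> (Suc n)) + real (Suc n) * ln (ml_radius \<rho> (Suc n))) / real (Suc n)"
      using eventually_ge_at_top[of 1]
    proof eventually_elim
      case (elim n)
      have "real (Suc n) * (ln (real n / \<rho>) / \<rho>) \<le> real (Suc n) * ln (ml_radius \<rho> (Suc n))"
        using ln_ml_radius_bounds[OF assms elim] by (intro mult_left_mono) auto
      thus ?case using C(2)[of "Suc n"] by (intro divide_right_mono) auto
    qed
    show "\<forall>\<^sub>F n in sequentially. (ln (ml_coeff \<rho> (Suc n)) + real (Suc n) * ln (ml_radius \<rho> (Suc n))) / real (Suc n)
       \<le> (- (real n / \<rho> * ln (real n / \<rho>) - real n / \<rho> - C)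
         + real (Suc n) * (ln (1 + real n / \<rho>) / \<rho>)) / real (Suc n)"
      using eventually_ge_at_top[of 1]
    proof eventually_elim
      case (elim n)
      have "real (Suc n) * ln (ml_radius \<rho> (Suc n)) \<le> real (Suc n) * (ln (1 + real n / \<rho>) / \<rho>)"
        using ln_ml_radius_bounds[OF assms elim] by (intro mult_left_mono) auto
      thus ?case using C(1)[OF elim] by (intro divide_right_mono) auto
    qed
    show "(\<lambda>n. (- ((1 + real (Suc n) / \<rho>) * ln (1 + real (Suc n) / \<rho>) - (1 + real (Suc n) / \<rho>) + C)
         + real (Suc n) * (ln (real n / \<rho>) / \<rho>)) / real (Suc n)) \<longlonglongrightarrow> 1 / \<rho>"
      using assms unfolding inverse_eq_divide [symmetric] by real_asymp
    show "(\<lambda>n. (- (real n / \<rho> * ln (real n / \<rho>) - real n / \<rho> - C)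
         + real (Suc n) * (ln (1 + real n / \<rho>) / \<rho>)) / real (Suc n)) \<longlonglongrightarrow> 1 / \<rho>"
      using assms unfolding inverse_eq_divide [symmetric] by real_asymp
  qed
  thus ?thesis by (subst (asm) filterlim_sequentially_Suc)
qed

lemma summable_norm_ml:
  fixes z :: complex
  assumes "\<rho> \<ge> 1"
  shows "summable (\<lambda>k. norm (of_real (ml_coeff \<rho> k) * z ^ k))"
proof -
  have "\<forall>\<^sub>F n in sequentially. ml_radius \<rho> n \<ge> 2 * (norm z + 1)"
    using ml_radius_at_top[OF assms] unfolding filterlim_at_top by blast
  then obtain N where N: "\<And>n. n \<ge> N \<Longrightarrow> ml_radius \<rho> n \<ge> 2 * (norm z + 1)"
    unfolding eventually_sequentially by blast
  show ?thesis
  proof (rule summable_ratio_test[of "1/2" N])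
    fix n assume n: "n \<ge> N"
    have p: "ml_coeff \<rho> n > 0" "ml_coeff \<rho> (Suc n) > 0" using assms by (auto intro: ml_coeff_pos)
    have "2 * norm z \<le> ml_coeff \<rho> n / ml_coeff \<rho> (Suc n)"
      using N[of "Suc n"] n assms ml_radius_Suc[of \<rho> n] by simp
    hence "norm z * ml_coeff \<rho> (Suc n) \<le> 1/2 * ml_coeff \<rho> n" using p by (simp add: field_simps)
    hence "norm z * ml_coeff \<rho> (Suc n) * norm z ^ n \<le> 1/2 * ml_coeff \<rho> n * norm z ^ n"
      by (rule mult_right_mono) auto
    thus "norm (norm (of_real (ml_coeff \<rho> (Suc n)) * z ^ Suc n)) \<le> 1/2 * norm (norm (of_real (ml_coeff \<rho> n) * z ^ n))"
      using p by (simp add: norm_mult norm_power mult_ac)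
  qed simp
qed

section \<open>Asymptotics of the Mittag-Leffler function\<close>

text \<open>With w the modulus of the exponential and t = pi \<beta> Re s, the squared modulus of
  the denominator is (w - 1)^2 + 4 w sin^2 t. It is comparable to (1 + w)^2 if the sine is bounded
  below, as on vertical edges away from the poles, or if w is far from 1, as on horizontal edges far
  from the real axis. Keeping 1 + w in the bound records the decay in the lower half plane.\<close>

lemma norm_periodic_kernel_le:
  fixes s :: complex and \<beta> C :: real
  assumes \<beta>: "\<beta> > 0" and C: "C > 0"
    and "1 \<le> C * \<bar>sin (pi * \<beta> * Re s)\<bar> \<or> C \<ge> 3 \<and> \<beta> * \<bar>Im s\<bar> \<ge> 1"
  shows "exp (2 * pi * \<i> * \<beta> * s) \<noteq> 1"
    and "norm (1 / (exp (2 * pi * \<i> * \<beta> * s) - 1)) \<le> C / (1 + exp (- 2 * pi * \<beta> * Im s))"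
proof -
  define w where "w = exp (- 2 * pi * \<beta> * Im s)"
  define t where "t = pi * \<beta> * Re s"
  have w: "w > 0" by (simp add: w_def)
  have E: "exp (2 * pi * \<i> * \<beta> * s) = of_real w * cis (2 * t)"
    by (simp add: exp_eq_polar w_def t_def mult_ac)
  have "norm (of_real w * cis (2 * t) - 1) ^ 2 = (w * cos (2 * t) - 1)\<^sup>2 + (w * sin (2 * t))\<^sup>2"
    by (simp add: cmod_power2)
  also have "\<dots> = w\<^sup>2 * ((cos (2*t))\<^sup>2 + (sin (2*t))\<^sup>2) - 2 * w * cos (2 * t) + 1"
    by algebra
  also have "\<dots> = (w - 1)\<^sup>2 + 4 * w * (sin t)\<^sup>2"
    unfolding sin_cos_squared_add2 unfolding cos_double_sin by (simp add: power2_eq_square algebra_simps)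
  finally have n: "norm (of_real w * cis (2 * t) - 1) ^ 2 = (w - 1)\<^sup>2 + 4 * w * (sin t)\<^sup>2" .
  have "(1 + w)\<^sup>2 \<le> C\<^sup>2 * ((w - 1)\<^sup>2 + 4 * w * (sin t)\<^sup>2)"
    using assms(3)
  proof
    assume "1 \<le> C * \<bar>sin (pi * \<beta> * Re s)\<bar>"
    hence "1\<^sup>2 \<le> (C * \<bar>sin t\<bar>)\<^sup>2" unfolding t_def by (intro power_mono) auto
    hence sn: "1 \<le> C\<^sup>2 * (sin t)\<^sup>2" by (simp add: power_mult_distrib)
    also have "\<dots> \<le> C\<^sup>2 * 1" by (intro mult_left_mono) (auto simp: abs_square_le_1)
    finally have C1: "1 \<le> C\<^sup>2" by simp
    have "(1 + w)\<^sup>2 = 1 * (w - 1)\<^sup>2 + 4 * w * 1" by (simp add: power2_eq_square algebra_simps)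
    also have "\<dots> \<le> C\<^sup>2 * (w - 1)\<^sup>2 + 4 * w * (C\<^sup>2 * (sin t)\<^sup>2)"
      using sn C1 w by (intro add_mono mult_right_mono mult_left_mono) auto
    finally show ?thesis by (simp add: algebra_simps)
  next
    assume A: "C \<ge> 3 \<and> \<beta> * \<bar>Im s\<bar> \<ge> 1"
    have e2: "exp (1::real) \<ge> 2" using exp_ge_add_one_self[of 1] by simp
    have p1: "2 * pi * (\<beta> * \<bar>Im s\<bar>) \<ge> 1 * 1"
      using A pi_gt3 by (intro mult_mono) auto
    \<comment> \<open>The constant 3 originates here: 1 + w \<le> 3 |w - 1| holds outside the
      interval (1/2, 2).\<close>
    have "w \<le> 1/2 \<or> w \<ge> 2"
    proof (cases "Im s \<ge> 0")
      case True
      hence "w \<le> exp (-1)" using p1 unfolding w_def by simp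
      also have "\<dots> \<le> 1/2" using e2 by (simp add: exp_minus field_simps)
      finally show ?thesis by simp
    next
      case False
      hence "w \<ge> exp 1" using p1 unfolding w_def by simp
      with e2 show ?thesis by linarith
    qed
    hence "(1 + w) \<le> 3 * \<bar>w - 1\<bar>" by (auto simp: abs_if)
    hence "(1 + w)\<^sup>2 \<le> (3 * \<bar>w - 1\<bar>)\<^sup>2" using w by (intro power_mono) auto
    also have "\<dots> = 3\<^sup>2 * (w - 1)\<^sup>2" by (simp add: power_mult_distrib)
    also have "\<dots> \<le> C\<^sup>2 * ((w - 1)\<^sup>2 + 4 * w * (sin t)\<^sup>2)"
      using A w by (intro mult_mono power_mono) auto
    finally show ?thesis .
  qed
  also have "\<dots> = (C * norm (of_real w * cis (2 * t) - 1))\<^sup>2" by (simp add: power_mult_distrib n)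
  finally have le: "1 + w \<le> C * norm (of_real w * cis (2 * t) - 1)"
    using C by (intro power2_le_imp_le[of "1 + w"]) auto
  have pos: "norm (of_real w * cis (2 * t) - 1) > 0"
    using le w C by (cases "norm (of_real w * cis (2 * t) - 1) = 0") auto
  thus "exp (2 * pi * \<i> * \<beta> * s) \<noteq> 1" unfolding E by auto
  show "norm (1 / (exp (2 * pi * \<i> * \<beta> * s) - 1)) \<le> C / (1 + exp (- 2 * pi * \<beta> * Im s))"
    unfolding E w_def[symmetric] norm_divide norm_one using le pos w by (simp add: field_simps)
qed

text \<open>The part of the bound for \<open>ml_interp\<close> that depends on Re s. The argument 2
  + a x and the additional linear factor come from the functional equation step in
  \<open>norm_rGamma_le_shift\<close>.\<close>

definition ml_weight :: "real \<Rightarrow> real \<Rightarrow> real \<Rightarrow> real" where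
  "ml_weight a r x = r powr x * (2 + a * x) * rGamma (2 + a * x)"

text \<open>For \<open>a = 1/\<rho>\<close> and \<open>z = rcis r \<theta>\<close> this entire function takes the values \<open>ml_coeff \<rho> k * z^k\<close> at the integers \<open>k\<close>
  and \<open>w^k / k!\<close> with \<open>w = z^\<rho>\<close> at the points \<open>k * \<rho>\<close>. It depends on the chosen argument \<open>\<theta>\<close> of \<open>z\<close>.\<close>

definition ml_interp :: "real \<Rightarrow> real \<Rightarrow> real \<Rightarrow> complex \<Rightarrow> complex" where
  "ml_interp a r \<theta> s = exp (s * (of_real (ln r) + \<i> * of_real \<theta>)) * rGamma (1 + of_real a * s)"

lemma holomorphic_ml_interp: "ml_interp a r \<theta> holomorphic_on A"
  unfolding ml_interp_def by (intro holomorphic_intros)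

lemma scaled_lower_bound:
  fixes a x :: real
  assumes "0 < a" "a \<le> 1" "x \<ge> -3/2"
  shows "a * x \<ge> -3/2"
proof (cases "x \<ge> 0")
  case True
  hence "a * x \<ge> 0" using assms by simp
  thus ?thesis by linarith
next
  case False
  hence "a * x \<ge> 1 * x" using assms by (intro mult_right_mono_neg) auto
  thus ?thesis using assms by linarith
qed

text \<open>The critical angle has its origin in this exponential: 1/Gamma grows at most like exp
  (pi a |Im s| / 2), while the power of z contributes exp (- \<theta> Im s). Whether the vertical
  integrals converge depends on what the kernel adds to these two.\<close>

lemma norm_ml_interp_le:
  fixes a r \<theta> :: real and s :: complex
  assumes a: "0 < a" "a \<le> 1" and r: "r > 0" and x: "Re s \<ge> -3/2"
  shows "norm (ml_interp a r \<theta> s) \<le> ml_weight a r (Re s) *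
           ((1 + 2 * \<bar>Im s\<bar>) * exp (pi * a * \<bar>Im s\<bar> / 2 - \<theta> * Im s))"
proof -
  let ?x = "Re s" and ?y = "Im s"
  have ax: "a * ?x \<ge> -3/2" by (rule scaled_lower_bound[OF a x])
  have "norm (1 + of_real a * s) \<le> \<bar>1 + a * ?x\<bar> + \<bar>a * ?y\<bar>"
    using cmod_le[of "1 + of_real a * s"] by simp
  also have "\<bar>1 + a * ?x\<bar> \<le> 2 + a * ?x" using ax by linarith
  also have "\<bar>a * ?y\<bar> \<le> 1 * \<bar>?y\<bar>" unfolding abs_mult using a by (intro mult_right_mono) auto
  also have "\<dots> \<le> (2 + a * ?x) * (2 * \<bar>?y\<bar>)"
  proof -
    have "1/2 * (2 * \<bar>?y\<bar>) \<le> (2 + a * ?x) * (2 * \<bar>?y\<bar>)"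
      using ax by (intro mult_right_mono) auto
    thus ?thesis by simp
  qed
  finally have n1: "norm (1 + of_real a * s) \<le> (2 + a * ?x) * (1 + 2 * \<bar>?y\<bar>)"
    by (simp add: algebra_simps)
  have "norm (rGamma (1 + of_real a * s)) \<le>
     norm (1 + of_real a * s) * exp (pi * \<bar>Im (1 + of_real a * s)\<bar> / 2) * rGamma (Re (1 + of_real a * s) + 1)"
    using ax by (intro norm_rGamma_le_shift) simp
  also have "\<dots> = norm (1 + of_real a * s) * (exp (pi * a * \<bar>?y\<bar> / 2) * rGamma (2 + a * ?x))"
    using a by (simp add: abs_mult algebra_simps)
  also have "\<dots> \<le> (2 + a * ?x) * (1 + 2 * \<bar>?y\<bar>) * (exp (pi * a * \<bar>?y\<bar> / 2) * rGamma (2 + a * ?x))"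
    using ax by (intro mult_right_mono n1 mult_nonneg_nonneg) (auto simp: rGamma_inverse_Gamma)
  finally have n2: "norm (rGamma (1 + of_real a * s)) \<le> \<dots>" .
  have "norm (ml_interp a r \<theta> s) = exp (?x * ln r - \<theta> * ?y) * norm (rGamma (1 + of_real a * s))"
    by (simp add: ml_interp_def norm_mult algebra_simps)
  also have "\<dots> \<le> exp (?x * ln r - \<theta> * ?y) *
     ((2 + a * ?x) * (1 + 2 * \<bar>?y\<bar>) * (exp (pi * a * \<bar>?y\<bar> / 2) * rGamma (2 + a * ?x)))"
    by (intro mult_left_mono n2) auto
  also have "\<dots> = (exp (?x * ln r) * (2 + a * ?x) * rGamma (2 + a * ?x)) *
      ((1 + 2 * \<bar>?y\<bar>) * (exp (pi * a * \<bar>?y\<bar> / 2) * exp (- (\<theta> * ?y))))"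
    by (simp add: exp_diff exp_minus field_simps)
  also have "exp (pi * a * \<bar>?y\<bar> / 2) * exp (- (\<theta> * ?y)) = exp (pi * a * \<bar>?y\<bar> / 2 - \<theta> * ?y)"
    by (simp flip: exp_add)
  finally show ?thesis using r by (simp add: ml_weight_def powr_def)
qed

text \<open>Cubing u/3 \<le> exp (u/3) with u = \<epsilon> (1 + |y|) gives 27 and the factor exp
  \<epsilon>; the remaining 2 comes from (1 + 2t)(1 + t^2) \<le> 2 (1 + t)^3. The constant depends
  on \<epsilon> alone, which keeps the later error terms uniform in z.\<close>

lemma exp_decay_le:
  fixes \<epsilon> y :: real
  assumes "\<epsilon> > 0"
  shows "(1 + 2 * \<bar>y\<bar>) * exp (- \<epsilon> * \<bar>y\<bar>) \<le> (54 * exp \<epsilon> / \<epsilon> ^ 3) / (1 + y\<^sup>2)"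
proof -
  define t where "t = \<bar>y\<bar>"
  have t: "t \<ge> 0" "y\<^sup>2 = t\<^sup>2" by (auto simp: t_def)
  have "\<epsilon> * (1 + t) / 3 \<le> exp (\<epsilon> * (1 + t) / 3)" using exp_ge_add_one_self[of "\<epsilon> * (1 + t) / 3"] by linarith
  hence "(\<epsilon> * (1 + t) / 3) ^ 3 \<le> exp (\<epsilon> * (1 + t) / 3) ^ 3" using assms t by (intro power_mono) auto
  also have "\<dots> = exp (\<epsilon> * (1 + t))" by (simp flip: exp_of_nat_mult)
  also have "\<dots> = exp \<epsilon> * exp (\<epsilon> * t)" by (simp add: algebra_simps exp_add)
  finally have *: "(\<epsilon> * (1 + t) / 3) ^ 3 \<le> exp \<epsilon> * exp (\<epsilon> * t)" .
  have **: "(1 + t) ^ 3 \<le> 27 / \<epsilon> ^ 3 * (exp \<epsilon> * exp (\<epsilon> * t))"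
  proof -
    have "(\<epsilon> * (1 + t) / 3) ^ 3 = \<epsilon> ^ 3 * (1 + t) ^ 3 / 27"
      by (simp only: power_mult_distrib power_divide) simp
    with * show ?thesis using assms by (simp add: field_simps)
  qed
  have "(1 + 2 * t) * (1 + t\<^sup>2) \<le> (2 * (1 + t)) * (1 + t)\<^sup>2"
    using t by (intro mult_mono) (auto simp: power2_eq_square algebra_simps)
  also have "\<dots> = 2 * (1 + t) ^ 3" by (simp add: power2_eq_square power3_eq_cube)
  also have "\<dots> \<le> 2 * (27 / \<epsilon> ^ 3 * (exp \<epsilon> * exp (\<epsilon> * t)))" using ** by simp
  finally have "(1 + 2 * t) * (1 + t\<^sup>2) \<le> 54 * exp \<epsilon> / \<epsilon> ^ 3 * exp (\<epsilon> * t)" by simp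
  hence "(1 + 2 * t) * (1 + t\<^sup>2) * exp (- (\<epsilon> * t)) \<le> 54 * exp \<epsilon> / \<epsilon> ^ 3 * exp (\<epsilon> * t) * exp (- (\<epsilon> * t))"
    by (rule mult_right_mono) simp
  hence "(1 + 2 * t) * exp (- (\<epsilon> * t)) * (1 + t\<^sup>2) \<le> 54 * exp \<epsilon> / \<epsilon> ^ 3"
    by (simp only: mult.assoc exp_minus_inverse mult_1_right) (simp add: mult_ac)
  moreover have "1 + t\<^sup>2 > 0" by (simp add: add_pos_nonneg)
  ultimately show ?thesis
    unfolding t_def[symmetric] t by (subst pos_le_divide_eq) auto
qed

lemma ml_weight_nonneg: "0 < a \<Longrightarrow> a \<le> 1 \<Longrightarrow> x \<ge> -3/2 \<Longrightarrow> ml_weight a r x \<ge> 0"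
proof -
  assume a: "0 < a" "a \<le> 1" and x: "x \<ge> -3/2"
  have "a * x \<ge> -3/2" by (rule scaled_lower_bound[OF a x])
  thus ?thesis unfolding ml_weight_def by (auto simp: rGamma_inverse_Gamma intro!: mult_nonneg_nonneg)
qed

text \<open>Two kinds of bounds for two kinds of edges: on the right edge the bound must tend to 0,
  whereas on the horizontal edges a constant is enough, because 1/(1 + N^2) outweighs their
  length.\<close>

lemma ml_weight_bounds:
  assumes \<rho>: "\<rho> \<ge> 1" and r: "r > 0"
  obtains \<mu> :: "nat \<Rightarrow> real" and B :: real
  where "\<mu> \<longlonglongrightarrow> 0" "\<And>N x. real N \<le> x \<Longrightarrow> x \<le> real N + 1 \<Longrightarrow> ml_weight (1/\<rho>) r x \<le> \<mu> N"
    "\<And>x. x \<ge> -3/2 \<Longrightarrow> ml_weight (1/\<rho>) r x \<le> B" "B \<ge> 0"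
proof -
  define a where "a = 1 / \<rho>"
  have a: "0 < a" "a \<le> 1" using \<rho> by (auto simp: a_def)
  define R where "R = max 1 r"
  have R: "R \<ge> 1" "r \<le> R" by (auto simp: R_def)
  \<comment> \<open>These are multiples of the terms of the convergent series at 2 R. The argument 2
    R in place of R leaves room for 2 + a x \<le> 3 * 2^N.\<close>
  define \<mu> where "\<mu> = (\<lambda>N. 3 * R * (ml_coeff \<rho> N * (2 * R) ^ N))"
  have c: "ml_coeff \<rho> N > 0" for N using \<rho> by (intro ml_coeff_pos) simp
  have lim: "\<mu> \<longlonglongrightarrow> 0"
  proof -
    have "summable (\<lambda>k. norm (of_real (ml_coeff \<rho> k) * (of_real (2 * R) :: complex) ^ k))"
      by (rule summable_norm_ml[OF \<rho>])
    hence "(\<lambda>k. norm (of_real (ml_coeff \<rho> k) * (of_real (2 * R) :: complex) ^ k)) \<longlonglongrightarrow> 0"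
      by (rule summable_LIMSEQ_zero)
    also have "(\<lambda>k. norm (of_real (ml_coeff \<rho> k) * (of_real (2 * R) :: complex) ^ k)) = (\<lambda>k. ml_coeff \<rho> k * (2 * R) ^ k)"
      using c R by (auto simp: norm_mult norm_power less_imp_le simp del: of_real_mult)
    finally show ?thesis unfolding \<mu>_def by (intro tendsto_mult_right_zero)
  qed
  have le: "ml_weight a r x \<le> \<mu> N" if x: "real N \<le> x" "x \<le> real N + 1" for N x
  proof -
    have ax: "0 \<le> a * real N" "a * real N \<le> a * x" "a * x \<le> x"
      using a x by (auto intro!: mult_left_mono mult_left_le_one_le)
    \<comment> \<open>Gamma decreases up to its minimum, which lies below 3/2. For small arguments
      the two sides are therefore separated by the common value 1 of Gamma at 1 and 2.\<close>
    have g1: "Gamma (1 + a * N) \<le> Gamma (2 + a * x)"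
    proof (cases "1 + a * N > 3/2")
      case True
      thus ?thesis using ax by (intro less_imp_le Gamma_real_strict_mono) auto
    next
      case False
      have "ln (Gamma (1 + a * N)) \<le> a * N * ln 1 + ln (Gamma 1)"
        using ln_Gamma_add_le[of 1 "a * N"] ax False by simp
      hence l1: "Gamma (1 + a * N) \<le> 1" using ax by (simp add: Gamma_real_pos)
      have "1 = Gamma (2::real)" by (simp add: Gamma_numeral)
      also have "\<dots> \<le> Gamma (2 + a * x)"
      proof (cases "0 < a * x")
        case True
        thus ?thesis by (intro less_imp_le Gamma_real_strict_mono) auto
      next
        case False
        hence "a * x = 0" using ax by linarith
        thus ?thesis by (simp only: add_0_right order_refl)
      qed
      finally show ?thesis using l1 by linarith
    qed
    have "r powr x \<le> R powr x" using r R x by (intro powr_mono2) auto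
    also have "\<dots> \<le> R powr (real N + 1)" using R x by (intro powr_mono) auto
    also have "\<dots> = R * R ^ N" using R by (simp add: powr_add powr_realpow)
    finally have 1: "r powr x \<le> R * R ^ N" .
    have "real N + 1 \<le> 2 ^ N" by (induction N) auto
    hence 2: "2 + a * x \<le> 3 * 2 ^ N" using ax x by linarith
    have 3: "rGamma (2 + a * x) \<le> ml_coeff \<rho> N"
    proof -
      have "inverse (Gamma (2 + a * x)) \<le> inverse (Gamma (1 + a * N))"
        using ax by (intro le_imp_inverse_le g1 Gamma_real_pos) auto
      thus ?thesis by (simp add: rGamma_inverse_Gamma ml_coeff_def a_def inverse_eq_divide)
    qed
    have "ml_weight a r x \<le> (R * R ^ N) * (3 * 2 ^ N) * ml_coeff \<rho> N"
      unfolding ml_weight_def using 1 2 3 R ax x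
      by (intro mult_mono) (auto simp: rGamma_inverse_Gamma intro!: mult_nonneg_nonneg)
    thus ?thesis by (simp add: \<mu>_def power_mult_distrib mult_ac)
  qed
  obtain B1 where B1: "\<And>N. norm (\<mu> N) \<le> B1"
    using lim convergentI convergent_imp_Bseq BseqE by (metis (no_types))
  have "compact ((\<lambda>x. ml_weight a r x) ` {-3/2..0})"
    unfolding ml_weight_def using r by (intro compact_continuous_image continuous_intros
        continuous_on_compose2[OF continuous_on_rGamma[of UNIV]]) auto
  hence "bounded ((\<lambda>x. ml_weight a r x) ` {-3/2..0})" by (rule compact_imp_bounded)
  then obtain B2 where "\<forall>w\<in>(\<lambda>x. ml_weight a r x) ` {-3/2..0}. norm w \<le> B2"
    unfolding bounded_iff by blast
  hence B2: "\<And>x. x \<in> {-3/2..0} \<Longrightarrow> norm (ml_weight a r x) \<le> B2" by blast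
  show ?thesis
  proof (rule that[of \<mu> "max B1 B2"])
    show "ml_weight (1/\<rho>) r x \<le> max B1 B2" if x: "x \<ge> -3/2" for x
    proof (cases "x \<le> 0")
      case True
      thus ?thesis using B2[of x] x by (simp add: a_def)
    next
      case False
      have "ml_weight a r x \<le> \<mu> (nat \<lfloor>x\<rfloor>)"
        using False by (intro le) (auto simp: of_nat_nat le_floor_iff)
      also have "\<dots> \<le> B1" using B1[of "nat \<lfloor>x\<rfloor>"] by simp
      finally show ?thesis by (simp add: a_def)
    qed
    show "max B1 B2 \<ge> 0" using B1[of 0] norm_ge_zero[of "\<mu> 0"] by linarith
  qed (use lim le in \<open>auto simp: a_def\<close>)
qed

text \<open>The right edge vanishes in the limit by the decay of the coefficients, and the
  horizontal edges by the decay in Im s. Only the left edge remains; its weight contains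
  \<open>r powr x0\<close>, so the position of that edge decides the power of r in the error
  term.\<close>

lemma norm_limit_rectpath_integrals_le:
  fixes f :: "complex \<Rightarrow> complex"
  assumes \<rho>: "\<rho> \<ge> 1" and r: "r > 0" and \<epsilon>: "\<epsilon> > 0" and C: "C > 0" and x0: "-3/2 \<le> x0" "x0 \<le> 0"
    and X: "\<And>N. real N \<le> X N \<and> X N \<le> real N + 1"
    and cont: "\<And>N. real N \<ge> T0 \<Longrightarrow> continuous_on (path_image (rectpath (Complex x0 (- real N)) (Complex (X N) (real N)))) f"
    and bound: "\<And>s. Re s \<ge> x0 \<Longrightarrow> Re s = x0 \<or> Re s \<in> range X \<or> \<bar>Im s\<bar> \<ge> T0 \<Longrightarrow>
       norm (f s) \<le> C * (ml_weight (1/\<rho>) r (Re s) * ((1 + 2 * \<bar>Im s\<bar>) * exp (- \<epsilon> * \<bar>Im s\<bar>)))"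
    and lim: "(\<lambda>N. contour_integral (rectpath (Complex x0 (- real N)) (Complex (X N) (real N))) f) \<longlonglongrightarrow> L"
  shows "norm L \<le> pi * (C * ml_weight (1/\<rho>) r x0 * (54 * exp \<epsilon> / \<epsilon> ^ 3))"
proof -
  define K where "K = 54 * exp \<epsilon> / \<epsilon> ^ 3"
  have K: "K > 0" using \<epsilon> by (simp add: K_def)
  have a: "0 < 1/\<rho>" "1/\<rho> \<le> 1" using \<rho> by auto
  obtain \<mu> B where \<mu>: "\<mu> \<longlonglongrightarrow> 0"
    and \<mu>le: "\<And>N x. real N \<le> x \<Longrightarrow> x \<le> real N + 1 \<Longrightarrow> ml_weight (1/\<rho>) r x \<le> \<mu> N"
    and B: "\<And>x. x \<ge> -3/2 \<Longrightarrow> ml_weight (1/\<rho>) r x \<le> B" "B \<ge> 0"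
    using ml_weight_bounds[OF \<rho> r] by metis
  have w0: "ml_weight (1/\<rho>) r x \<ge> 0" if "x \<ge> x0" for x
    using ml_weight_nonneg[OF a, of x] that x0 by simp
  have \<mu>0: "\<mu> N \<ge> 0" for N using \<mu>le[of N "real N"] w0[of "real N"] x0 by force
  have bnd: "norm (f s) \<le> C * W * K / (1 + (Im s)\<^sup>2)"
    if "Re s \<ge> x0" "Re s = x0 \<or> Re s \<in> range X \<or> \<bar>Im s\<bar> \<ge> T0" "ml_weight (1/\<rho>) r (Re s) \<le> W" for s W
  proof -
    have "norm (f s) \<le> C * (ml_weight (1/\<rho>) r (Re s) * ((1 + 2 * \<bar>Im s\<bar>) * exp (- \<epsilon> * \<bar>Im s\<bar>)))"
      by (rule bound[OF that(1,2)])
    also have "\<dots> \<le> C * (W * (K / (1 + (Im s)\<^sup>2)))"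
      unfolding K_def using C that w0[OF that(1)]
      by (intro mult_left_mono mult_mono exp_decay_le \<epsilon>) auto
    finally show ?thesis by simp
  qed
  have ev: "\<forall>\<^sub>F N in sequentially. norm (contour_integral (rectpath (Complex x0 (- real N)) (Complex (X N) (real N))) f)
    \<le> pi * (C * ml_weight (1/\<rho>) r x0 * K) + pi * (C * \<mu> N * K) + 2 * (C * B * K / (1 + (real N)\<^sup>2)) * (real N + 5/2)"
    using eventually_ge_at_top[of "nat \<lceil>max T0 1\<rceil>"]
  proof eventually_elim
    case (elim N)
    hence N: "real N \<ge> T0" "real N \<ge> 1" by linarith+
    have "norm (contour_integral (rectpath (Complex x0 (- real N)) (Complex (X N) (real N))) f)
       \<le> pi * (C * ml_weight (1/\<rho>) r x0 * K) + pi * (C * \<mu> N * K) + 2 * (C * B * K / (1 + (real N)\<^sup>2)) * (X N - x0)"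
    proof (rule norm_contour_integral_rectpath_le)
      show "x0 < X N" "0 < real N" using X[of N] x0 N by auto
      show "norm (f (Complex x y)) \<le> C * B * K / (1 + (real N)\<^sup>2)"
        if "x0 \<le> x" "x \<le> X N" "\<bar>y\<bar> = real N" for x y
      proof -
        have "y\<^sup>2 = (real N)\<^sup>2" using that by (metis power2_abs)
        thus ?thesis using bnd[of "Complex x y" B] that B(1)[of x] x0 N by simp
      qed
      show "norm (f (Complex x0 y)) \<le> C * ml_weight (1/\<rho>) r x0 * K / (1 + y\<^sup>2)" for y
        using bnd[of "Complex x0 y" "ml_weight (1/\<rho>) r x0"] by simp
      show "norm (f (Complex (X N) y)) \<le> C * \<mu> N * K / (1 + y\<^sup>2)" for y
        using bnd[of "Complex (X N) y" "\<mu> N"] X[of N] x0 \<mu>le[of N "X N"] by simp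
    qed (use C K w0[of x0] \<mu>0[of N] B cont[OF N(1)] in auto)
    also have "2 * (C * B * K / (1 + (real N)\<^sup>2)) * (X N - x0) \<le> 2 * (C * B * K / (1 + (real N)\<^sup>2)) * (real N + 5/2)"
      using C K B X[of N] x0 by (intro mult_left_mono) auto
    finally show ?case by simp
  qed
  have z: "(\<lambda>N. (real N + 5/2) / (1 + (real N)\<^sup>2)) \<longlonglongrightarrow> 0" by real_asymp
  have "(\<lambda>N. pi * (C * ml_weight (1/\<rho>) r x0 * K) + pi * (C * \<mu> N * K) + (2 * C * B * K) * ((real N + 5/2) / (1 + (real N)\<^sup>2)))
     \<longlonglongrightarrow> pi * (C * ml_weight (1/\<rho>) r x0 * K) + pi * (C * 0 * K) + (2 * C * B * K) * 0"
    by (intro tendsto_intros \<mu> z)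
  hence "(\<lambda>N. pi * (C * ml_weight (1/\<rho>) r x0 * K) + pi * (C * \<mu> N * K) + 2 * (C * B * K / (1 + (real N)\<^sup>2)) * (real N + 5/2))
     \<longlonglongrightarrow> pi * (C * ml_weight (1/\<rho>) r x0 * K)" by (simp add: mult_ac)
  from tendsto_le[OF sequentially_bot this tendsto_norm[OF lim] ev]
  show ?thesis by (simp add: K_def)
qed

section \<open>The two asymptotic regimes of the Mittag-Leffler function\<close>

definition mittag_leffler :: "real \<Rightarrow> complex \<Rightarrow> complex" where
  "mittag_leffler \<rho> z = (\<Sum>k. of_real (ml_coeff \<rho> k) * z ^ k)"

lemma sums_mittag_leffler:
  "\<rho> \<ge> 1 \<Longrightarrow> (\<lambda>k. of_real (ml_coeff \<rho> k) * z ^ k) sums mittag_leffler \<rho> z"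
  unfolding mittag_leffler_def by (intro summable_sums summable_norm_cancel[OF summable_norm_ml])

lemma rGamma_of_real_nonzero: "x > 0 \<Longrightarrow> rGamma (complex_of_real x) \<noteq> 0"
  by (subst rGamma_complex_of_real) (auto simp: rGamma_inverse_Gamma Gamma_eq_zero_iff elim!: nonpos_Ints_cases)

lemma ml_interp_nonzero:
  assumes "1 + a * x > 0"
  shows "ml_interp a r \<theta> (of_real x) \<noteq> 0"
  using rGamma_of_real_nonzero[OF assms] by (simp add: ml_interp_def)

lemma exp_ln_plus_arg:
  assumes "r > 0"
  shows "exp (of_real (ln r) + \<i> * of_real \<theta>) = rcis r \<theta>"
  using assms by (simp add: exp_add rcis_def cis_conv_exp exp_of_real)

lemma ml_interp_of_nat:
  assumes "r > 0"
  shows "ml_interp (1/\<rho>) r \<theta> (of_nat k) = of_real (ml_coeff \<rho> k) * rcis r \<theta> ^ k"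
proof -
  have "rGamma (1 + of_real (1/\<rho>) * of_nat k) = rGamma (complex_of_real (1 + real k / \<rho>))" by simp
  also have "\<dots> = of_real (ml_coeff \<rho> k)"
    by (subst rGamma_complex_of_real) (simp add: ml_coeff_def rGamma_inverse_Gamma inverse_eq_divide)
  finally show ?thesis
    unfolding ml_interp_def exp_ln_plus_arg[OF assms, symmetric]
    by (simp add: exp_of_nat_mult)
qed

lemma ml_interp_minus_one:
  assumes "r > 0"
  shows "ml_interp (1/\<rho>) r \<theta> (-1) = of_real (rGamma (1 - 1/\<rho>)) / rcis r \<theta>"
proof -
  have "rGamma (1 + of_real (1/\<rho>) * (-1)) = rGamma (complex_of_real (1 - 1 / \<rho>))" by simp
  also have "\<dots> = of_real (rGamma (1 - 1/\<rho>))" by (rule rGamma_complex_of_real)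
  finally show ?thesis
    unfolding ml_interp_def exp_ln_plus_arg[OF assms, symmetric]
    by (simp add: exp_minus exp_add exp_diff divide_simps)
qed

lemma ml_interp_scaled:
  assumes "\<rho> > 0"
  shows "ml_interp (1/\<rho>) r \<theta> (of_real (real k * \<rho>)) =
    exp (of_real \<rho> * (of_real (ln r) + \<i> * of_real \<theta>)) ^ k / fact k"
proof -
  have "rGamma (1 + of_real (1/\<rho>) * of_real (real k * \<rho>)) = rGamma (1 + of_nat k :: complex)"
    using assms by simp
  also have "\<dots> = 1 / fact k" unfolding rGamma_inverse_Gamma Gamma_fact by (simp add: inverse_eq_divide)
  finally show ?thesis unfolding ml_interp_def
    by (simp add: mult.assoc flip: exp_of_nat_mult)
qed

text \<open>The kernel \<open>1 / (e\<^sup>2\<^sup>\<pi>\<^sup>i\<^sup>s - 1)\<close> makes the integral over a vertical line converge exactly for arguments of \<open>z\<close>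
  strictly between \<open>\<pi>/(2\<rho>)\<close> and \<open>2\<pi> - \<pi>/(2\<rho>)\<close>. On the line \<open>Re s = -3/2\<close> the pole at \<open>-1\<close> supplies the leading term.\<close>

lemma mittag_leffler_outside:
  assumes \<rho>: "\<rho> > 1" and \<epsilon>: "\<epsilon> > 0"
  obtains C where "\<And>r \<theta>. r > 0 \<Longrightarrow> pi / (2 * \<rho>) + \<epsilon> \<le> \<theta> \<Longrightarrow> \<theta> \<le> 2 * pi - pi / (2 * \<rho>) - \<epsilon> \<Longrightarrow>
    norm (mittag_leffler \<rho> (rcis r \<theta>) + of_real (rGamma (1 - 1/\<rho>)) / rcis r \<theta>) \<le> C * r powr (-3/2)"
proof -
  define a where "a = 1 / \<rho>"
  have a: "0 < a" "a < 1" using \<rho> by (auto simp: a_def)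
  \<comment> \<open>The left-edge bound on Re s = -3/2 with the power of r split off; the leading 3
    inside is the kernel constant.\<close>
  define C where "C = pi * (3 * ((2 + a * (-3/2)) * rGamma (2 + a * (-3/2))) * (54 * exp \<epsilon> / \<epsilon> ^ 3))"
  show ?thesis
  proof (rule that[of C])
    fix r \<theta> :: real
    assume r: "r > 0" and \<theta>: "pi / (2 * \<rho>) + \<epsilon> \<le> \<theta>" "\<theta> \<le> 2 * pi - pi / (2 * \<rho>) - \<epsilon>"
    define z where "z = rcis r \<theta>"
    define G where "G = ml_interp a r \<theta>"
    define f where "f = (\<lambda>s. G s / (exp (2 * pi * \<i> * of_real 1 * s) - 1))"
    define X where "X = (\<lambda>N::nat. real N + 1/2)"
    define L where "L = mittag_leffler \<rho> z + of_real (rGamma (1 - 1/\<rho>)) / z"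
    \<comment> \<open>The first inequality gives decay in the upper half plane, where the kernel is
      merely bounded. In the lower half plane the kernel contributes exp (2 pi Im s), so that 2 pi -
      \<theta> takes the place of \<theta>.\<close>
    have \<theta>': "pi * a / 2 - \<theta> \<le> - \<epsilon>" "pi * a / 2 + \<theta> - 2 * pi \<le> - \<epsilon>" using \<theta> by (simp_all add: a_def)
    have sinhalf: "\<bar>sin (pi * 1 * (real N + 1/2))\<bar> = 1" for N
    proof -
      have "sin (pi * 1 * (real N + 1/2)) = sin (real N * pi + pi / 2)" by (simp add: algebra_simps)
      also have "\<dots> = (-1) ^ N" by (simp add: sin_add)
      finally show ?thesis by (simp add: power_abs)
    qed
    have good: "1 \<le> 3 * \<bar>sin (pi * 1 * Re s)\<bar> \<or> (3::real) \<ge> 3 \<and> 1 * \<bar>Im s\<bar> \<ge> 1"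
      if "Re s = -3/2 \<or> Re s \<in> range X \<or> \<bar>Im s\<bar> \<ge> 1" for s
    proof -
      have "\<bar>sin (pi * 1 * (-3/2))\<bar> = 1" using sinhalf[of 1] by (simp add: algebra_simps)
      thus ?thesis using that sinhalf by (auto simp: X_def)
    qed
    have ker: "exp (2 * pi * \<i> * of_real 1 * s) \<noteq> 1"
      "norm (1 / (exp (2 * pi * \<i> * of_real 1 * s) - 1)) \<le> 3 / (1 + exp (- 2 * pi * 1 * Im s))"
      if "Re s = -3/2 \<or> Re s \<in> range X \<or> \<bar>Im s\<bar> \<ge> 1" for s
      by (rule norm_periodic_kernel_le[OF _ _ good[OF that]]; simp)+
    have "norm L \<le> pi * (3 * ml_weight (1/\<rho>) r (-3/2) * (54 * exp \<epsilon> / \<epsilon> ^ 3))"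
    proof (rule norm_limit_rectpath_integrals_le[of _ _ _ _ _ X 1 f])
      show "continuous_on (path_image (rectpath (Complex (-3/2) (- real N)) (Complex (X N) (real N)))) f"
        if N: "real N \<ge> 1" for N
        unfolding f_def
      proof (intro continuous_intros holomorphic_on_imp_continuous_on[of G] ballI)
        fix s assume "s \<in> path_image (rectpath (Complex (-3/2) (- real N)) (Complex (X N) (real N)))"
        hence "Re s = -3/2 \<or> Re s \<in> range X \<or> \<bar>Im s\<bar> \<ge> 1"
          using N by (subst (asm) path_image_rectpath) (auto simp: X_def)
        from ker(1)[OF this] show "exp (2 * pi * \<i> * of_real 1 * s) - 1 \<noteq> 0" by simp
      qed (auto simp: G_def intro: holomorphic_ml_interp)
      show "norm (f s) \<le> 3 * (ml_weight (1/\<rho>) r (Re s) * ((1 + 2 * \<bar>Im s\<bar>) * exp (- \<epsilon> * \<bar>Im s\<bar>)))"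
        if s: "Re s \<ge> -3/2" "Re s = -3/2 \<or> Re s \<in> range X \<or> \<bar>Im s\<bar> \<ge> 1" for s
      proof -
        define y where "y = Im s"
        have g: "norm (G s) \<le> ml_weight a r (Re s) * ((1 + 2 * \<bar>y\<bar>) * exp (pi * a * \<bar>y\<bar> / 2 - \<theta> * y))"
          unfolding G_def y_def using a r s by (intro norm_ml_interp_le) auto
        have k: "norm (1 / (exp (2 * pi * \<i> * of_real 1 * s) - 1)) \<le> 3 / (1 + exp (- (2 * pi * y)))"
          using ker(2)[OF s(2)] by (simp add: y_def)
        have e: "exp (pi * a * \<bar>y\<bar> / 2 - \<theta> * y) * (3 / (1 + exp (- (2 * pi * y)))) \<le> 3 * exp (- \<epsilon> * \<bar>y\<bar>)"
        proof (cases "y \<ge> 0")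
          case True
          have "(pi * a / 2 - \<theta>) * y \<le> - \<epsilon> * y" by (rule mult_right_mono[OF \<theta>'(1) True])
          hence "exp (pi * a * \<bar>y\<bar> / 2 - \<theta> * y) \<le> exp (- \<epsilon> * \<bar>y\<bar>)" using True by (simp add: algebra_simps)
          moreover have "3 / (1 + exp (- (2 * pi * y))) \<le> 3" by (simp add: divide_simps add_pos_pos)
          ultimately have "exp (pi * a * \<bar>y\<bar> / 2 - \<theta> * y) * (3 / (1 + exp (- (2 * pi * y)))) \<le> exp (- \<epsilon> * \<bar>y\<bar>) * 3"
            by (intro mult_mono) (auto intro!: divide_nonneg_nonneg add_nonneg_nonneg)
          thus ?thesis by simp
        next
          case False
          have "(pi * a / 2 + \<theta> - 2 * pi) * (- y) \<le> - \<epsilon> * (- y)"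
            using False by (intro mult_right_mono[OF \<theta>'(2)]) auto
          hence le: "pi * a * \<bar>y\<bar> / 2 - \<theta> * y + 2 * pi * y \<le> - \<epsilon> * \<bar>y\<bar>"
            using False by (simp add: algebra_simps)
          have "3 / (1 + exp (- (2 * pi * y))) \<le> 3 / exp (- (2 * pi * y))"
            by (intro divide_left_mono) (auto intro!: mult_pos_pos add_pos_pos)
          hence "exp (pi * a * \<bar>y\<bar> / 2 - \<theta> * y) * (3 / (1 + exp (- (2 * pi * y))))
             \<le> exp (pi * a * \<bar>y\<bar> / 2 - \<theta> * y) * (3 / exp (- (2 * pi * y)))"
            by (intro mult_left_mono) auto
          also have "\<dots> = 3 * exp (pi * a * \<bar>y\<bar> / 2 - \<theta> * y + 2 * pi * y)"
          proof -
            have "3 / exp (- (2 * pi * y)) = 3 * exp (2 * pi * y)"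
              by (metis divide_inverse exp_minus minus_minus)
            thus ?thesis by (simp only: exp_add mult.left_commute)
          qed
          also have "\<dots> \<le> 3 * exp (- \<epsilon> * \<bar>y\<bar>)" using le by simp
          finally show ?thesis .
        qed
        have w: "ml_weight a r (Re s) \<ge> 0" using ml_weight_nonneg a s by simp
        have "norm (f s) = norm (G s) * norm (1 / (exp (2 * pi * \<i> * of_real 1 * s) - 1))"
          by (simp add: f_def norm_divide)
        also have "\<dots> \<le> (ml_weight a r (Re s) * ((1 + 2 * \<bar>y\<bar>) * exp (pi * a * \<bar>y\<bar> / 2 - \<theta> * y)))
             * (3 / (1 + exp (- (2 * pi * y))))"
          using w by (intro mult_mono g k) auto
        also have "\<dots> = (ml_weight a r (Re s) * (1 + 2 * \<bar>y\<bar>)) *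
            (exp (pi * a * \<bar>y\<bar> / 2 - \<theta> * y) * (3 / (1 + exp (- (2 * pi * y)))))"
          by (simp only: mult.assoc)
        also have "\<dots> \<le> (ml_weight a r (Re s) * (1 + 2 * \<bar>y\<bar>)) * (3 * exp (- \<epsilon> * \<bar>y\<bar>))"
          using w by (intro mult_left_mono e) auto
        finally show ?thesis by (simp add: a_def y_def mult_ac)
      qed
      show "(\<lambda>N. contour_integral (rectpath (Complex (-3/2) (- real N)) (Complex (X N) (real N))) f) \<longlonglongrightarrow> L"
      proof (rule Lim_transform_eventually)
        show "(\<lambda>N. of_real (rGamma (1 - 1/\<rho>)) / z + (\<Sum>k<Suc N. of_real (ml_coeff \<rho> k) * z ^ k)) \<longlonglongrightarrow> L"
          unfolding L_def add.commute[of "mittag_leffler \<rho> z"]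
          using sums_mittag_leffler[of \<rho> z, unfolded sums_def] \<rho>
          by (intro tendsto_intros LIMSEQ_Suc) simp
        show "\<forall>\<^sub>F N in sequentially. of_real (rGamma (1 - 1/\<rho>)) / z + (\<Sum>k<Suc N. of_real (ml_coeff \<rho> k) * z ^ k)
           = contour_integral (rectpath (Complex (-3/2) (- real N)) (Complex (X N) (real N))) f"
          using eventually_gt_at_top[of 0]
        proof eventually_elim
          case (elim N)
          have ni: "real N + 1/2 \<notin> \<int>" "-3/2 \<notin> (\<int> :: real set)"
          proof -
            have "x \<notin> \<int>" if "2 * x = of_int (2 * m + 1)" for x :: real and m
            proof
              assume "x \<in> \<int>"
              then obtain k where "x = of_int k" by (auto elim: Ints_cases)
              hence "real_of_int (2 * k) = of_int (2 * m + 1)" using that by simp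
              hence "2 * k = 2 * m + 1" by (simp only: of_int_eq_iff)
              thus False by presburger
            qed
            from this[of _ "int N"] this[of _ "-2"] show "real N + 1/2 \<notin> \<int>" "-3/2 \<notin> (\<int> :: real set)" by auto
          qed
          have set: "{k::int. -3/2 < real_of_int k / 1 \<and> real_of_int k / 1 < X N} = insert (-1) (int ` {..<Suc N})"
          proof -
            have "-3/2 < real_of_int k / 1 \<and> real_of_int k / 1 < X N \<longleftrightarrow> -1 \<le> k \<and> k \<le> int N" for k
              unfolding X_def by linarith
            moreover have "k \<in> int ` {..<Suc N} \<longleftrightarrow> 0 \<le> k \<and> k \<le> int N" for k
              by (auto simp: image_iff simp del: lessThan_Suc intro!: bexI[of _ "nat k"])
            ultimately show ?thesis by (intro set_eqI) (simp del: lessThan_Suc, linarith)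
          qed
          have "contour_integral (rectpath (Complex (-3/2) (- real N)) (Complex (X N) (real N))) f =
             (\<Sum>k | -3/2 < real_of_int k / 1 \<and> real_of_int k / 1 < X N. G (of_real (real_of_int k / 1))) / of_real 1"
            unfolding f_def
          proof (rule contour_integral_rectpath_periodic_kernel)
            show "G (of_real (real_of_int k / 1)) \<noteq> 0" if "-3/2 < real_of_int k / 1" for k
            proof -
              have "k \<ge> -1" using that by linarith
              hence "real_of_int k \<ge> -1" by simp
              hence "a * real_of_int k \<ge> a * (-1)" using a by (intro mult_left_mono) auto
              thus ?thesis unfolding G_def using a by (intro ml_interp_nonzero) auto
            qed
          qed (use elim ni in \<open>auto simp: G_def X_def intro: holomorphic_ml_interp\<close>)
          also have "\<dots> = (\<Sum>k\<in>insert (-1) (int ` {..<Suc N}). G (of_int k))" unfolding set by simp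
          also have "\<dots> = G (-1) + (\<Sum>k\<in>int ` {..<Suc N}. G (of_int k))" by (subst sum.insert) auto
          also have "(\<Sum>k\<in>int ` {..<Suc N}. G (of_int k)) = (\<Sum>k<Suc N. of_real (ml_coeff \<rho> k) * z ^ k)"
            by (subst sum.reindex) (auto simp: G_def a_def z_def ml_interp_of_nat[OF r] simp del: sum.lessThan_Suc)
          also have "G (-1) = of_real (rGamma (1 - 1/\<rho>)) / z"
            unfolding G_def a_def z_def by (rule ml_interp_minus_one[OF r])
          finally show ?case by simp
        qed
      qed
    qed (use \<rho> r \<epsilon> in \<open>auto simp: X_def\<close>)
    also have "\<dots> = C * r powr (-3/2)" by (simp add: C_def ml_weight_def a_def)
    finally show "norm (mittag_leffler \<rho> (rcis r \<theta>) + of_real (rGamma (1 - 1/\<rho>)) / rcis r \<theta>) \<le> C * r powr (-3/2)"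
      by (simp add: L_def z_def)
  qed
qed

text \<open>The right edges of the rectangles must stay away from the poles of both kernels used below, i.e. from the
  integers and from the multiples of \<open>1/a\<close>.\<close>

lemma sin_line_choice:
  assumes a: "0 < a" "a \<le> 1"
  obtains X :: "nat \<Rightarrow> real" where "\<And>N. real N \<le> X N \<and> X N \<le> real N + 1"
    "\<And>N. 1/2 \<le> \<bar>sin (pi * X N)\<bar>" "\<And>N. sin (pi * a / 3) / 2 \<le> \<bar>sin (pi * a * X N)\<bar>"
proof -
  \<comment> \<open>Both candidates keep their distance from the integers. Their phases u and v
    differ by pi a / 3, and sin (v - u) \<le> |sin u| + |sin v| prevents both sines from being
    small.\<close>
  have "\<exists>x. (x = real N + 1/3 \<or> x = real N + 2/3) \<and> sin (pi * a / 3) / 2 \<le> \<bar>sin (pi * a * x)\<bar>" for N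
  proof -
    define u v where "u = pi * a * (real N + 1/3)" and "v = pi * a * (real N + 2/3)"
    have "sin (pi * a / 3) = sin (v - u)" by (simp add: u_def v_def field_simps)
    also have "\<dots> = sin v * cos u - cos v * sin u" by (rule sin_diff)
    also have "\<dots> \<le> \<bar>sin v * cos u\<bar> + \<bar>cos v * sin u\<bar>" by linarith
    also have "\<bar>sin v * cos u\<bar> \<le> \<bar>sin v\<bar> * 1" unfolding abs_mult by (intro mult_left_mono) auto
    also have "\<bar>cos v * sin u\<bar> \<le> 1 * \<bar>sin u\<bar>" unfolding abs_mult by (intro mult_right_mono) auto
    finally have "sin (pi * a / 3) / 2 \<le> \<bar>sin u\<bar> \<or> sin (pi * a / 3) / 2 \<le> \<bar>sin v\<bar>" by linarith
    thus ?thesis unfolding u_def v_def by blast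
  qed
  then obtain X where X: "\<And>N. X N = real N + 1/3 \<or> X N = real N + 2/3"
    "\<And>N. sin (pi * a / 3) / 2 \<le> \<bar>sin (pi * a * X N)\<bar>" by metis
  have abs_sin: "\<bar>sin (real N * pi + t)\<bar> = \<bar>sin t\<bar>" for N t
    by (simp add: sin_add abs_mult power_abs)
  have s: "sin (pi * 2 / 3) = sqrt 3 / 2"
  proof -
    have "sin (pi * 2 / 3) = sin (pi - pi / 3)" by (rule arg_cong[where f = sin]) simp
    thus ?thesis by (simp only: sin_pi_minus sin_60)
  qed
  have half: "1/2 \<le> \<bar>sin (pi * X N)\<bar>" for N
    using X(1)[of N]
  proof
    assume "X N = real N + 1/3"
    hence "pi * X N = real N * pi + pi / 3" by (simp add: algebra_simps)
    thus ?thesis by (simp only: abs_sin sin_60) simp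
  next
    assume "X N = real N + 2/3"
    hence "pi * X N = real N * pi + pi * 2 / 3" by (simp add: algebra_simps)
    thus ?thesis by (simp only: abs_sin s) simp
  qed
  show ?thesis
  proof (rule that[of X])
    show "real N \<le> X N \<and> X N \<le> real N + 1" for N using X(1)[of N] by auto
  qed (use half X(2) in auto)
qed

text \<open>The sums for the Mittag-Leffler function and for \<open>\<rho> * exp (z^\<rho>)\<close> are compared through the difference of the kernels
  with periods \<open>1\<close> and \<open>\<rho>\<close>. Both tend to \<open>-1\<close> in the upper half plane and to \<open>0\<close> in the lower one, so the difference
  decays in both directions although neither kernel does.\<close>

lemma mittag_leffler_inside:
  assumes \<rho>: "\<rho> > 1"
  obtains C where "\<And>r \<theta>. r > 0 \<Longrightarrow> \<bar>\<theta>\<bar> \<le> pi / (2 * \<rho>) \<Longrightarrow>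
    norm (mittag_leffler \<rho> (rcis r \<theta>) - of_real \<rho> * exp (rcis (r powr \<rho>) (\<rho> * \<theta>))) \<le> C * r powr (-1/2)"
proof -
  define a where "a = 1 / \<rho>"
  have a: "0 < a" "a < 1" using \<rho> by (auto simp: a_def)
  \<comment> \<open>One summand for each obstruction: 3 for horizontal edges and for the kernel of
    period 1 on vertical edges, then the right edge and the left edge for the kernel of period
    \<rho>.\<close>
  define c where "c = 3 + 2 / sin (pi * a / 3) + 1 / sin (pi * a / 2)"
  have sp: "sin (pi * a / 3) > 0" "sin (pi * a / 2) > 0"
    using a by (auto intro!: sin_gt_zero simp: field_simps intro: less_trans[of _ "pi * 1"] mult_strict_left_mono)
  have c3: "c \<ge> 3" using sp by (simp add: c_def)
  have cs: "1 \<le> c * t" if "t \<ge> sin (pi * a / 3) / 2 \<or> t \<ge> sin (pi * a / 2) \<or> t \<ge> 1/2" for t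
  proof -
    have *: "1 \<le> c * t" if "d > 0" "t \<ge> d" "c \<ge> 1 / d" for d
    proof -
      have "1 = (1 / d) * d" using that by simp
      also have "\<dots> \<le> c * t" using that c3 by (intro mult_mono) auto
      finally show ?thesis .
    qed
    have "c \<ge> 1 / (sin (pi * a / 3) / 2)" "c \<ge> 1 / sin (pi * a / 2)" "c \<ge> 1 / (1/2)"
      using sp by (auto simp: c_def)
    thus ?thesis using that *[of "sin (pi * a / 3) / 2"] *[of "sin (pi * a / 2)"] *[of "1/2"] sp by auto
  qed
  obtain X :: "nat \<Rightarrow> real" where X: "\<And>N. real N \<le> X N \<and> X N \<le> real N + 1"
    "\<And>N. 1/2 \<le> \<bar>sin (pi * X N)\<bar>" "\<And>N. sin (pi * a / 3) / 2 \<le> \<bar>sin (pi * a * X N)\<bar>"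
    using sin_line_choice[of a] a by auto
  \<comment> \<open>The difference of the kernels decays like exp (- 2 pi a |Im s|), while the
    interpolating function grows at most with exponent pi a / 2 + |\<theta>| \<le> pi a. The surplus
    pi a remains even on the critical rays.\<close>
  define \<epsilon> where "\<epsilon> = pi * a"
  have \<epsilon>: "\<epsilon> > 0" using a by (simp add: \<epsilon>_def)
  define C where "C = pi * ((2 * c) * ((2 + a * (-1/2)) * rGamma (2 + a * (-1/2))) * (54 * exp \<epsilon> / \<epsilon> ^ 3))"
  show ?thesis
  proof (rule that[of C])
    fix r \<theta> :: real
    assume r: "r > 0" and \<theta>: "\<bar>\<theta>\<bar> \<le> pi / (2 * \<rho>)"
    define z where "z = rcis r \<theta>"
    define w where "w = exp (of_real \<rho> * (of_real (ln r) + \<i> * of_real \<theta>))"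
    have w: "w = rcis (r powr \<rho>) (\<rho> * \<theta>)"
      using r by (simp add: w_def rcis_def powr_def distrib_left exp_add cis_conv_exp mult_ac flip: exp_of_real)
    define G where "G = ml_interp a r \<theta>"
    define E where "E = (\<lambda>\<beta> s. exp (2 * pi * \<i> * complex_of_real \<beta> * s))"
    define f where "f = (\<lambda>s. G s / (E 1 s - 1) - G s / (E a s - 1))"
    define L where "L = mittag_leffler \<rho> z - of_real \<rho> * exp w"
    have good: "1 \<le> c * \<bar>sin (pi * \<beta> * Re s)\<bar> \<or> c \<ge> 3 \<and> \<beta> * \<bar>Im s\<bar> \<ge> 1"
      if s: "Re s = -1/2 \<or> Re s \<in> range X \<or> \<bar>Im s\<bar> \<ge> \<rho>" and \<beta>: "\<beta> = 1 \<or> \<beta> = a" for s \<beta>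
      using s
    proof (elim disjE)
      assume "Re s = -1/2"
      hence "\<bar>sin (pi * \<beta> * Re s)\<bar> = \<bar>sin (pi * \<beta> / 2)\<bar>" by simp
      hence "1 \<le> c * \<bar>sin (pi * \<beta> * Re s)\<bar>" using \<beta> by (intro cs) auto
      thus ?thesis ..
    next
      assume "Re s \<in> range X"
      hence "1 \<le> c * \<bar>sin (pi * \<beta> * Re s)\<bar>" using \<beta> X by (intro cs) auto
      thus ?thesis ..
    next
      assume "\<bar>Im s\<bar> \<ge> \<rho>"
      hence "\<bar>Im s\<bar> \<ge> 1" "a * \<bar>Im s\<bar> \<ge> 1" using \<rho> by (auto simp: a_def field_simps)
      thus ?thesis using \<beta> c3 by auto
    qed
    have ker: "E \<beta> s \<noteq> 1" "norm (1 / (E \<beta> s - 1)) \<le> c / (1 + exp (- 2 * pi * \<beta> * Im s))"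
      if "Re s = -1/2 \<or> Re s \<in> range X \<or> \<bar>Im s\<bar> \<ge> \<rho>" "\<beta> = 1 \<or> \<beta> = a" for s \<beta>
      unfolding E_def by (rule norm_periodic_kernel_le[OF _ _ good[OF that]]; use a c3 that in auto)+
    \<comment> \<open>The common rate is that of the slower kernel, since a < 1. In the upper half
      plane it appears only after the common limit -1 has been removed from both kernels.\<close>
    have diff: "norm (1 / (E 1 s - 1) - 1 / (E a s - 1)) \<le> 2 * c * exp (- 2 * pi * a * \<bar>Im s\<bar>)"
      if s: "Re s = -1/2 \<or> Re s \<in> range X \<or> \<bar>Im s\<bar> \<ge> \<rho>" for s
    proof (cases "Im s \<le> 0")
      case True
      have *: "norm (1 / (E \<beta> s - 1)) \<le> c * exp (- 2 * pi * a * \<bar>Im s\<bar>)" if \<beta>: "\<beta> = 1 \<or> \<beta> = a" for \<beta>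
      proof -
        have "norm (1 / (E \<beta> s - 1)) \<le> c / (1 + exp (- 2 * pi * \<beta> * Im s))" by (rule ker(2)[OF s \<beta>])
        also have "\<dots> \<le> c / exp (- 2 * pi * \<beta> * Im s)"
          using c3 by (intro divide_left_mono) (auto intro!: mult_pos_pos add_pos_pos)
        also have "\<dots> = c * exp (- (- 2 * pi * \<beta> * Im s))" by (metis divide_inverse exp_minus)
        also have "- (- 2 * pi * \<beta> * Im s) = 2 * pi * (\<beta> * Im s)" by simp
        also have "2 * pi * (\<beta> * Im s) \<le> 2 * pi * (a * Im s)"
          using True \<beta> a by (intro mult_left_mono mult_right_mono_neg) auto
        hence "c * exp (2 * pi * (\<beta> * Im s)) \<le> c * exp (- 2 * pi * a * \<bar>Im s\<bar>)"
          using True c3 by (simp add: mult_ac)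
        finally show ?thesis .
      qed
      have "norm (1 / (E 1 s - 1) - 1 / (E a s - 1)) \<le> norm (1 / (E 1 s - 1)) + norm (1 / (E a s - 1))"
        by (rule norm_triangle_ineq4)
      also have "\<dots> \<le> c * exp (- 2 * pi * a * \<bar>Im s\<bar>) + c * exp (- 2 * pi * a * \<bar>Im s\<bar>)"
        by (intro add_mono *) auto
      finally show ?thesis by simp
    next
      case False
      have *: "norm (E \<beta> s * (1 / (E \<beta> s - 1))) \<le> c * exp (- 2 * pi * a * \<bar>Im s\<bar>)" if \<beta>: "\<beta> = 1 \<or> \<beta> = a" for \<beta>
      proof -
        have "norm (1 / (E \<beta> s - 1)) \<le> c / (1 + exp (- 2 * pi * \<beta> * Im s))" by (rule ker(2)[OF s \<beta>])
        also have "\<dots> \<le> c / 1"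
          using c3 by (intro divide_left_mono) (auto intro!: add_pos_pos)
        finally have 1: "norm (1 / (E \<beta> s - 1)) \<le> c" by simp
        have "2 * pi * (a * Im s) \<le> 2 * pi * (\<beta> * Im s)"
          using False \<beta> a by (intro mult_left_mono mult_right_mono) auto
        hence 2: "norm (E \<beta> s) \<le> exp (- 2 * pi * a * \<bar>Im s\<bar>)"
          using False by (simp add: E_def mult_ac)
        show ?thesis unfolding norm_mult using mult_mono[OF 2 1] by (simp add: mult_ac)
      qed
      have eq: "1 / (E \<beta> s - 1) = E \<beta> s * (1 / (E \<beta> s - 1)) - 1" if \<beta>: "\<beta> = 1 \<or> \<beta> = a" for \<beta>
        using ker(1)[OF s \<beta>] by (simp add: field_simps)
      have "1 / (E 1 s - 1) - 1 / (E a s - 1) = E 1 s * (1 / (E 1 s - 1)) - E a s * (1 / (E a s - 1))"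
      proof -
        have "1 / (E 1 s - 1) - 1 / (E a s - 1) = (E 1 s * (1 / (E 1 s - 1)) - 1) - (E a s * (1 / (E a s - 1)) - 1)"
          by (rule arg_cong2[where f = "(-)", OF eq eq]) auto
        thus ?thesis by simp
      qed
      also have "norm \<dots> \<le> norm (E 1 s * (1 / (E 1 s - 1))) + norm (E a s * (1 / (E a s - 1)))"
        by (rule norm_triangle_ineq4)
      also have "\<dots> \<le> c * exp (- 2 * pi * a * \<bar>Im s\<bar>) + c * exp (- 2 * pi * a * \<bar>Im s\<bar>)"
        by (intro add_mono *) auto
      finally show ?thesis by simp
    qed
    have contG: "continuous_on A G" for A
      by (auto simp: G_def intro!: holomorphic_on_imp_continuous_on holomorphic_ml_interp)
    have "norm L \<le> pi * (2 * c * ml_weight (1/\<rho>) r (-1/2) * (54 * exp \<epsilon> / \<epsilon> ^ 3))"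
    proof (rule norm_limit_rectpath_integrals_le[of _ _ _ _ _ X \<rho> f])
      show "continuous_on (path_image (rectpath (Complex (-1/2) (- real N)) (Complex (X N) (real N)))) f"
        if N: "real N \<ge> \<rho>" for N
      proof -
        have "E \<beta> s - 1 \<noteq> 0" if \<beta>: "\<beta> = 1 \<or> \<beta> = a"
          and s: "s \<in> path_image (rectpath (Complex (-1/2) (- real N)) (Complex (X N) (real N)))" for s \<beta>
        proof -
          have "Re s = -1/2 \<or> Re s \<in> range X \<or> \<bar>Im s\<bar> \<ge> \<rho>"
            using N X(1)[of N] s by (subst (asm) path_image_rectpath) auto
          from ker(1)[OF this \<beta>] show ?thesis by simp
        qed
        moreover have "continuous_on A (E \<beta>)" for \<beta> A unfolding E_def by (intro continuous_intros)
        ultimately show ?thesis unfolding f_def by (intro continuous_intros contG) auto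
      qed
      show "norm (f s) \<le> 2 * c * (ml_weight (1/\<rho>) r (Re s) * ((1 + 2 * \<bar>Im s\<bar>) * exp (- \<epsilon> * \<bar>Im s\<bar>)))"
        if s: "Re s \<ge> -1/2" "Re s = -1/2 \<or> Re s \<in> range X \<or> \<bar>Im s\<bar> \<ge> \<rho>" for s
      proof -
        define y where "y = Im s"
        have g: "norm (G s) \<le> ml_weight a r (Re s) * ((1 + 2 * \<bar>y\<bar>) * exp (pi * a * \<bar>y\<bar> / 2 - \<theta> * y))"
          unfolding G_def y_def using a r s by (intro norm_ml_interp_le) auto
        have wt: "ml_weight a r (Re s) \<ge> 0" using ml_weight_nonneg a s by simp
        have "- \<theta> * y \<le> \<bar>\<theta>\<bar> * \<bar>y\<bar>" by (metis abs_ge_self abs_minus_cancel abs_mult)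
        also have "\<dots> \<le> pi * a / 2 * \<bar>y\<bar>" using \<theta> by (intro mult_right_mono) (auto simp: a_def)
        finally have le: "pi * a * \<bar>y\<bar> / 2 - \<theta> * y + - 2 * pi * a * \<bar>y\<bar> \<le> - \<epsilon> * \<bar>y\<bar>"
          by (simp add: \<epsilon>_def)
        have "norm (f s) = norm (G s) * norm (1 / (E 1 s - 1) - 1 / (E a s - 1))"
          unfolding f_def norm_mult[symmetric] by (simp add: algebra_simps)
        also have "\<dots> \<le> (ml_weight a r (Re s) * ((1 + 2 * \<bar>y\<bar>) * exp (pi * a * \<bar>y\<bar> / 2 - \<theta> * y)))
             * (2 * c * exp (- 2 * pi * a * \<bar>y\<bar>))"
          unfolding y_def using wt by (intro mult_mono g[unfolded y_def] diff s) auto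
        also have "\<dots> = 2 * c * (ml_weight a r (Re s) * ((1 + 2 * \<bar>y\<bar>) *
            exp (pi * a * \<bar>y\<bar> / 2 - \<theta> * y + - 2 * pi * a * \<bar>y\<bar>)))"
          unfolding exp_add by (simp only: mult_ac)
        also have "\<dots> \<le> 2 * c * (ml_weight a r (Re s) * ((1 + 2 * \<bar>y\<bar>) * exp (- \<epsilon> * \<bar>y\<bar>)))"
          using le c3 wt by (intro mult_left_mono) auto
        finally show ?thesis by (simp add: a_def y_def)
      qed
      have lim1: "(\<lambda>N. \<Sum>k<nat \<lceil>1 * X N\<rceil>. of_real (ml_coeff \<rho> k) * z ^ k) \<longlonglongrightarrow> mittag_leffler \<rho> z"
        and lim2: "(\<lambda>N. (\<Sum>k<nat \<lceil>a * X N\<rceil>. w ^ k / fact k) / a) \<longlonglongrightarrow> exp w / a"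
      proof -
        have flim: "filterlim (\<lambda>N. nat \<lceil>\<beta> * X N\<rceil>) at_top sequentially" if "\<beta> > 0" for \<beta>
        proof (rule filterlim_at_top_mono)
          show "filterlim (\<lambda>N. nat \<lceil>\<beta> * real N\<rceil>) at_top sequentially" using that by real_asymp
          show "\<forall>\<^sub>F N in sequentially. nat \<lceil>\<beta> * real N\<rceil> \<le> nat \<lceil>\<beta> * X N\<rceil>"
            using X(1) that by (intro always_eventually allI nat_mono ceiling_mono mult_left_mono) auto
        qed
        show "(\<lambda>N. \<Sum>k<nat \<lceil>1 * X N\<rceil>. of_real (ml_coeff \<rho> k) * z ^ k) \<longlonglongrightarrow> mittag_leffler \<rho> z"
          using sums_mittag_leffler[of \<rho> z] \<rho> unfolding sums_def
          by (intro filterlim_compose[OF _ flim]) auto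
        have "(\<lambda>k. w ^ k / fact k) sums exp w"
          using exp_converges[of w] by (simp add: scaleR_conv_of_real divide_inverse mult.commute)
        thus "(\<lambda>N. (\<Sum>k<nat \<lceil>a * X N\<rceil>. w ^ k / fact k) / a) \<longlonglongrightarrow> exp w / a"
          unfolding sums_def using a by (intro tendsto_intros filterlim_compose[OF _ flim]) auto
      qed
      show "(\<lambda>N. contour_integral (rectpath (Complex (-1/2) (- real N)) (Complex (X N) (real N))) f) \<longlonglongrightarrow> L"
      proof (rule Lim_transform_eventually)
        show "(\<lambda>N. (\<Sum>k<nat \<lceil>1 * X N\<rceil>. of_real (ml_coeff \<rho> k) * z ^ k) -
           (\<Sum>k<nat \<lceil>a * X N\<rceil>. w ^ k / fact k) / a) \<longlonglongrightarrow> L"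
          using tendsto_diff[OF lim1 lim2] \<rho> by (simp add: L_def a_def mult.commute)
        show "\<forall>\<^sub>F N in sequentially. (\<Sum>k<nat \<lceil>1 * X N\<rceil>. of_real (ml_coeff \<rho> k) * z ^ k) -
           (\<Sum>k<nat \<lceil>a * X N\<rceil>. w ^ k / fact k) / a
           = contour_integral (rectpath (Complex (-1/2) (- real N)) (Complex (X N) (real N))) f"
          using eventually_gt_at_top[of 0]
        proof eventually_elim
          case (elim N)
          let ?\<gamma> = "rectpath (Complex (-1/2) (- real N)) (Complex (X N) (real N))"
          have part: "contour_integral ?\<gamma> (\<lambda>s. G s / (E \<beta> s - 1)) = (\<Sum>k<nat \<lceil>\<beta> * X N\<rceil>. G (of_real (real k / \<beta>))) / \<beta>"
            "(\<lambda>s. G s / (E \<beta> s - 1)) contour_integrable_on ?\<gamma>" if \<beta>: "\<beta> = 1 \<or> \<beta> = a" for \<beta>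
          proof -
            have b: "0 < \<beta>" "\<beta> \<le> 1" using \<beta> a by auto
            \<comment> \<open>At height 0 the second alternative of \<open>good\<close> fails, so
              the first one keeps the sine away from 0 and no vertical edge passes through a
              pole.\<close>
            have ni: "\<beta> * x \<notin> \<int>" if "x = -1/2 \<or> x = X N" for x
            proof
              assume "\<beta> * x \<in> \<int>"
              then obtain m where "\<beta> * x = of_int m" by (auto elim: Ints_cases)
              hence "sin (pi * \<beta> * x) = sin (pi * of_int m)" by (simp add: mult.assoc)
              hence "sin (pi * \<beta> * x) = 0" by (simp add: sin_zero_iff_int2)
              moreover have "1 \<le> c * \<bar>sin (pi * \<beta> * x)\<bar> \<or> c \<ge> 3 \<and> \<beta> * \<bar>0\<bar> \<ge> 1"
                using good[of "Complex x 0" \<beta>] that \<beta> by auto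
              ultimately show False by auto
            qed
            have nz: "G (of_real (real_of_int k / \<beta>)) \<noteq> 0" if "-1/2 < real_of_int k / \<beta>" "real_of_int k / \<beta> < X N" for k
            proof -
              have "a * (real_of_int k / \<beta>) \<ge> a * (-1/2)" using a that by (intro mult_left_mono) auto
              thus ?thesis unfolding G_def using a by (intro ml_interp_nonzero) auto
            qed
            have hG: "G holomorphic_on UNIV" by (simp add: G_def holomorphic_ml_interp)
            have x01: "-1/2 < X N" "0 < real N" using X(1)[of N] elim by auto
            show "(\<lambda>s. G s / (E \<beta> s - 1)) contour_integrable_on ?\<gamma>" unfolding E_def
              by (rule contour_integral_rectpath_periodic_kernel(2)[OF hG b(1) x01 ni ni nz]) auto
            have set: "{k::int. -1/2 < real_of_int k / \<beta> \<and> real_of_int k / \<beta> < X N} = int ` {..<nat \<lceil>\<beta> * X N\<rceil>}"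
            proof (intro equalityI subsetI)
              fix k assume "k \<in> {k::int. -1/2 < real_of_int k / \<beta> \<and> real_of_int k / \<beta> < X N}"
              hence k: "- \<beta> / 2 < real_of_int k" "real_of_int k < \<beta> * X N" using b by (auto simp: field_simps)
              hence "k \<ge> 0" using b by linarith
              moreover have "k < \<lceil>\<beta> * X N\<rceil>" using k by (simp add: less_ceiling_iff)
              ultimately show "k \<in> int ` {..<nat \<lceil>\<beta> * X N\<rceil>}"
                by (intro image_eqI[of _ _ "nat k"]; (simp only: lessThan_iff)?; linarith)
            next
              fix k assume "k \<in> int ` {..<nat \<lceil>\<beta> * X N\<rceil>}"
              then obtain j where j: "k = int j" "int j < \<lceil>\<beta> * X N\<rceil>" by auto
              hence "real j < \<beta> * X N" by (simp add: less_ceiling_iff)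
              moreover have "0 \<le> real j / \<beta>" using b by simp
              hence "-1/2 < real j / \<beta>" by linarith
              ultimately show "k \<in> {k::int. -1/2 < real_of_int k / \<beta> \<and> real_of_int k / \<beta> < X N}"
                using j b by (auto simp: field_simps)
            qed
            have "contour_integral ?\<gamma> (\<lambda>s. G s / (E \<beta> s - 1)) =
              (\<Sum>k | -1/2 < real_of_int k / \<beta> \<and> real_of_int k / \<beta> < X N. G (of_real (real_of_int k / \<beta>))) / \<beta>"
              unfolding E_def
              by (rule contour_integral_rectpath_periodic_kernel(1)[OF hG b(1) x01 ni ni nz]) auto
            also have "\<dots> = (\<Sum>k<nat \<lceil>\<beta> * X N\<rceil>. G (of_real (real k / \<beta>))) / \<beta>"
              unfolding set by (subst sum.reindex) auto
            finally show "contour_integral ?\<gamma> (\<lambda>s. G s / (E \<beta> s - 1)) = \<dots>" .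
          qed
          have "contour_integral ?\<gamma> f = contour_integral ?\<gamma> (\<lambda>s. G s / (E 1 s - 1)) - contour_integral ?\<gamma> (\<lambda>s. G s / (E a s - 1))"
            unfolding f_def by (intro contour_integral_diff part(2)) auto
          also have "\<dots> = (\<Sum>k<nat \<lceil>1 * X N\<rceil>. G (of_real (real k / 1))) / of_real 1 -
               (\<Sum>k<nat \<lceil>a * X N\<rceil>. G (of_real (real k / a))) / of_real a"
            using part(1)[of 1] part(1)[of a] by simp
          also have "(\<Sum>k<nat \<lceil>1 * X N\<rceil>. G (of_real (real k / 1))) / of_real 1 =
              (\<Sum>k<nat \<lceil>1 * X N\<rceil>. of_real (ml_coeff \<rho> k) * z ^ k)"
            by (simp add: G_def a_def z_def ml_interp_of_nat[OF r])
          also have "(\<Sum>k<nat \<lceil>a * X N\<rceil>. G (of_real (real k / a))) = (\<Sum>k<nat \<lceil>a * X N\<rceil>. w ^ k / fact k)"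
          proof (rule sum.cong[OF refl])
            fix k
            have "real k / a = real k * \<rho>" by (simp add: a_def)
            thus "G (of_real (real k / a)) = w ^ k / fact k"
              unfolding G_def a_def w_def using ml_interp_scaled[of \<rho> r \<theta> k] \<rho> by simp
          qed
          finally show ?case by simp
        qed
      qed
    qed (use \<rho> r \<epsilon> c3 X(1) in auto)
    also have "\<dots> = C * r powr (-1/2)" by (simp add: C_def ml_weight_def a_def)
    finally show "norm (mittag_leffler \<rho> (rcis r \<theta>) - of_real \<rho> * exp (rcis (r powr \<rho>) (\<rho> * \<theta>))) \<le> C * r powr (-1/2)"
      by (simp add: L_def z_def w)
  qed
qed

section \<open>Exponential growth rates\<close>

text \<open>Locally uniform limits in \<open>z\<close> as \<open>n \<rightarrow> \<infinity>\<close> are expressed by the product filter \<open>sequentially \<times>\<^sub>F nhds z0\<close>.\<close>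

lemma filterlim_fst_snd_seq:
  "filterlim f G sequentially \<Longrightarrow> filterlim (\<lambda>p. f (fst p)) G (sequentially \<times>\<^sub>F H)"
  "filterlim g G H \<Longrightarrow> filterlim (\<lambda>p. g (snd p)) G (sequentially \<times>\<^sub>F H)"
  by (erule filterlim_compose, rule filterlim_fst, erule filterlim_compose, rule filterlim_snd)

lemma eventually_fst_snd_seq:
  "eventually P sequentially \<Longrightarrow> eventually (\<lambda>p. P (fst p)) (sequentially \<times>\<^sub>F H)"
  "eventually Q H \<Longrightarrow> eventually (\<lambda>p. Q (snd p)) (sequentially \<times>\<^sub>F H)"
  using filterlim_fst filterlim_snd unfolding filterlim_iff by blast+

section \<open>Sectors, and the growth rate of the Mittag-Leffler function\<close>

lemma norm_mult_cos_Arg: "norm z * cos (Arg z) = Re z"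
  by (metis Re_rcis rcis_cmod_Arg)

text \<open>The form in terms of the real part and the norm involves only continuous functions, so
  membership in the sector persists near a point without regard to branch cuts.\<close>

lemma inside_sector_iff_Arg:
  assumes "z \<noteq> 0" "0 < \<beta>" "\<beta> < pi"
  shows "norm z * cos \<beta> < Re z \<longleftrightarrow> \<bar>Arg z\<bar> < \<beta>"
proof -
  have "norm z * cos \<beta> < Re z \<longleftrightarrow> norm z * cos \<beta> < norm z * cos \<bar>Arg z\<bar>"
    using norm_mult_cos_Arg[of z] by simp
  also have "\<dots> \<longleftrightarrow> cos \<beta> < cos \<bar>Arg z\<bar>" using assms by simp
  also have "\<dots> \<longleftrightarrow> \<bar>Arg z\<bar> < \<beta>"
    using assms Arg_bounded[of z] by (intro cos_mono_less_eq) auto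
  finally show ?thesis .
qed

text \<open>The complementary sector contains the negative real axis, where \<open>Arg\<close>
  jumps; \<open>Arg2pi\<close> is continuous there and takes values in the range for which
  \<open>mittag_leffler_outside\<close> is stated.\<close>

lemma outside_sector_iff_Arg2pi:
  assumes "z \<noteq> 0" "0 < \<beta>" "\<beta> < pi"
  shows "Re z < norm z * cos \<beta> \<longleftrightarrow> \<beta> < Arg2pi z \<and> Arg2pi z < 2 * pi - \<beta>"
proof -
  define \<theta> where "\<theta> = Arg2pi z"
  have \<theta>: "0 \<le> \<theta>" "\<theta> < 2 * pi" using Arg2pi[of z] by (auto simp: \<theta>_def)
  have "Re z < norm z * cos \<beta> \<longleftrightarrow> norm z * cos \<theta> < norm z * cos \<beta>"
    using cos_Arg2pi[of z] by (simp add: \<theta>_def)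
  also have "\<dots> \<longleftrightarrow> cos \<theta> < cos \<beta>" using assms by simp
  also have "\<dots> \<longleftrightarrow> \<beta> < \<theta> \<and> \<theta> < 2 * pi - \<beta>"
  proof (cases "\<theta> \<le> pi")
    case True
    thus ?thesis using cos_mono_less_eq[of \<theta> \<beta>] \<theta> assms by auto
  next
    case False
    have "cos \<theta> = cos (2 * pi - \<theta>)" by (simp add: cos_diff)
    thus ?thesis using cos_mono_less_eq[of "2 * pi - \<theta>" \<beta>] \<theta> assms False by auto
  qed
  finally show ?thesis by (simp add: \<theta>_def)
qed

lemma rcis_Arg2pi: "rcis (norm z) (Arg2pi z) = z"
  using Arg2pi_eq[of z] by (simp add: rcis_def cis_conv_exp mult.commute)

lemma half_angle_bounds: "\<rho> > 1 \<Longrightarrow> 0 < pi / (2 * \<rho>) \<and> pi / (2 * \<rho>) < pi / 2"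
  by (auto simp: field_simps)

text \<open>Inside the sector this is Re (z^\<rho>) / \<rho> with the principal branch: up to the
  factor 1/\<rho> it is the indicator of E, extended homogeneously of degree \<rho>. The two cases
  agree on the critical rays, where the cosine vanishes.\<close>

definition ml_growth :: "real \<Rightarrow> complex \<Rightarrow> real" where
  "ml_growth \<rho> z = (if norm z * cos (pi / (2 * \<rho>)) < Re z then norm z powr \<rho> * cos (\<rho> * Arg z) / \<rho> else 0)"

lemma ml_growth_inside:
  assumes \<rho>: "\<rho> > 1" and z0: "norm z0 * cos (pi / (2 * \<rho>)) < Re z0"
  defines "F \<equiv> sequentially \<times>\<^sub>F nhds z0"
  shows "((\<lambda>p. ln (norm (mittag_leffler \<rho> (of_real (ml_radius \<rho> (fst p)) * snd p))) / real (fst p))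
           \<longlongrightarrow> ml_growth \<rho> z0) F"
    and "\<forall>\<^sub>F p in F. mittag_leffler \<rho> (of_real (ml_radius \<rho> (fst p)) * snd p) \<noteq> 0"
proof -
  define \<beta> where "\<beta> = pi / (2 * \<rho>)"
  have \<beta>: "0 < \<beta>" "\<beta> < pi / 2" using half_angle_bounds[OF \<rho>] by (auto simp: \<beta>_def)
  have cb: "cos \<beta> > 0" using \<beta> by (intro cos_gt_zero) auto
  have z0': "z0 \<noteq> 0" "Re z0 > 0"
  proof -
    have "0 \<le> norm z0 * cos \<beta>" using cb by auto
    thus "Re z0 > 0" using z0 by (simp add: \<beta>_def)
    thus "z0 \<noteq> 0" by auto
  qed
  define R where "R = ml_radius \<rho>"
  define E where "E = (\<lambda>p. norm (mittag_leffler \<rho> (of_real (R (fst p)) * snd p)))"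
  define c where "c = (\<lambda>z. norm z powr \<rho> * cos (\<rho> * Arg z))"
  define W where "W = (\<lambda>p. R (fst p) powr \<rho> * c (snd p))"
  define X where "X = (\<lambda>p. E p / (\<rho> * exp (W p)))"
  obtain C where C: "\<And>r \<theta>. r > 0 \<Longrightarrow> \<bar>\<theta>\<bar> \<le> pi / (2 * \<rho>) \<Longrightarrow>
    norm (mittag_leffler \<rho> (rcis r \<theta>) - of_real \<rho> * exp (rcis (r powr \<rho>) (\<rho> * \<theta>))) \<le> C * r powr (-1/2)"
    using mittag_leffler_inside[OF \<rho>] by blast
  have lim_snd: "(snd \<longlongrightarrow> z0) F" unfolding F_def by (rule filterlim_snd)
  have lim_norm: "((\<lambda>p. norm (snd p)) \<longlongrightarrow> norm z0) F" by (intro tendsto_intros lim_snd)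
  have Rtop: "filterlim (\<lambda>p. R (fst p)) at_top F"
    unfolding F_def R_def using \<rho> by (intro filterlim_fst_snd_seq ml_radius_at_top) simp
  have cone: "\<forall>\<^sub>F p in F. norm (snd p) * cos \<beta> < Re (snd p)"
  proof -
    have "((\<lambda>p. Re (snd p) - norm (snd p) * cos \<beta>) \<longlongrightarrow> Re z0 - norm z0 * cos \<beta>) F"
      by (intro tendsto_intros lim_snd)
    hence "\<forall>\<^sub>F p in F. Re (snd p) - norm (snd p) * cos \<beta> > 0"
      by (rule order_tendstoD) (use z0 in \<open>simp add: \<beta>_def\<close>)
    thus ?thesis by eventually_elim simp
  qed
  have nz: "\<forall>\<^sub>F p in F. snd p \<noteq> 0"
    using tendsto_imp_eventually_ne[OF lim_snd z0'(1)] .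
  have Rpos: "\<forall>\<^sub>F p in F. R (fst p) > 0" using Rtop unfolding filterlim_at_top_dense by blast
  have lim_c: "((\<lambda>p. c (snd p)) \<longlongrightarrow> c z0) F"
  proof -
    have "isCont Arg z0" using z0' by (intro continuous_at_Arg) (auto simp: complex_nonpos_Reals_iff)
    hence A: "((\<lambda>p. Arg (snd p)) \<longlongrightarrow> Arg z0) F" using isCont_tendsto_compose lim_snd by blast
    show ?thesis unfolding c_def
      by (intro tendsto_mult tendsto_powr tendsto_cos tendsto_const lim_norm A) (use z0' in auto)
  qed
  have main: "\<forall>\<^sub>F p in F. \<bar>X p - 1\<bar> \<le> C / \<rho> * (R (fst p) * norm (snd p)) powr (-1/2)"
    using cone nz Rpos
  proof eventually_elim
    case (elim p)
    define z r \<theta> where "z = snd p" and "r = R (fst p) * norm (snd p)" and "\<theta> = Arg (snd p)"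
    have r: "r > 0" using elim by (simp add: r_def)
    have \<theta>: "\<bar>\<theta>\<bar> < pi / (2 * \<rho>)"
      using inside_sector_iff_Arg[of z \<beta>] elim \<beta> by (simp add: \<theta>_def z_def \<beta>_def)
    have rz: "rcis r \<theta> = of_real (R (fst p)) * z"
      unfolding r_def \<theta>_def z_def by (metis mult.assoc of_real_mult rcis_cmod_Arg rcis_def)
    \<comment> \<open>In the sector W is nonnegative, so the main term has modulus at least \<rho>,
      and the additive error \<open>r powr (-1/2)\<close> becomes a relative one.\<close>
    have "\<rho> * \<bar>\<theta>\<bar> \<le> pi / 2" using \<theta> \<rho> by (simp add: field_simps)
    hence "\<bar>\<rho> * \<theta>\<bar> \<le> pi / 2" using \<rho> by (simp add: abs_mult)
    hence "cos (\<rho> * \<theta>) \<ge> 0" by (intro cos_ge_zero) linarith+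
    hence W0: "W p \<ge> 0" by (simp add: W_def c_def \<theta>_def)
    have We: "norm (exp (rcis (r powr \<rho>) (\<rho> * \<theta>))) = exp (W p)"
      using elim by (simp add: W_def c_def r_def \<theta>_def powr_mult mult_ac)
    have "\<bar>E p - \<rho> * exp (W p)\<bar> \<le> norm (mittag_leffler \<rho> (rcis r \<theta>) - of_real \<rho> * exp (rcis (r powr \<rho>) (\<rho> * \<theta>)))"
      using norm_triangle_ineq3[of "mittag_leffler \<rho> (rcis r \<theta>)" "of_real \<rho> * exp (rcis (r powr \<rho>) (\<rho> * \<theta>))"] \<rho>
      unfolding norm_mult We by (simp add: E_def rz z_def)
    also have "\<dots> \<le> C * r powr (-1/2)" using C[OF r] \<theta> by simp
    finally have le: "\<bar>E p - \<rho> * exp (W p)\<bar> \<le> C * r powr (-1/2)" .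
    have pos: "\<rho> * exp (W p) > 0" using \<rho> by simp
    have "X p - 1 = (E p - \<rho> * exp (W p)) / (\<rho> * exp (W p))"
      unfolding X_def using pos \<rho> by (simp add: diff_divide_distrib)
    hence "\<bar>X p - 1\<bar> = \<bar>E p - \<rho> * exp (W p)\<bar> / (\<rho> * exp (W p))"
      using pos \<rho> by (simp add: abs_divide abs_mult)
    also have "\<dots> \<le> \<bar>E p - \<rho> * exp (W p)\<bar> / (\<rho> * 1)"
      using \<rho> W0 by (intro divide_left_mono mult_left_mono) auto
    also have "\<dots> \<le> C * r powr (-1/2) / \<rho>" using le \<rho> by (simp add: divide_right_mono)
    finally show ?case by (simp add: r_def)
  qed
  have rtop: "filterlim (\<lambda>p. R (fst p) * norm (snd p)) at_top F"
    by (rule filterlim_at_top_mult_tendsto_pos[OF lim_norm _ Rtop]) (use z0' in auto)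
  have "((\<lambda>p. C / \<rho> * (R (fst p) * norm (snd p)) powr (-1/2)) \<longlongrightarrow> C / \<rho> * 0) F"
    by (intro tendsto_intros tendsto_neg_powr rtop) auto
  hence z: "((\<lambda>p. C / \<rho> * (R (fst p) * norm (snd p)) powr (-1/2)) \<longlongrightarrow> 0) F" by simp
  have "((\<lambda>p. X p - 1) \<longlongrightarrow> 0) F"
    by (rule Lim_null_comparison[OF _ z]) (use main in \<open>simp add: real_norm_def\<close>)
  hence X1: "(X \<longlongrightarrow> 1) F" by (simp add: LIM_zero_iff)
  have Xpos: "\<forall>\<^sub>F p in F. X p > 0" by (rule order_tendstoD(1)[OF X1]) simp
  show "\<forall>\<^sub>F p in F. mittag_leffler \<rho> (of_real (ml_radius \<rho> (fst p)) * snd p) \<noteq> 0"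
    using Xpos by eventually_elim (auto simp: X_def E_def R_def)
  have ntop: "filterlim (\<lambda>p. real (fst p)) at_top F"
    unfolding F_def by (intro filterlim_fst_snd_seq filterlim_real_sequentially)
  have lim: "((\<lambda>p. ln \<rho> / real (fst p) + (R (fst p) powr \<rho> / real (fst p)) * c (snd p) + ln (X p) / real (fst p))
      \<longlongrightarrow> 0 + 1 / \<rho> * c z0 + 0) F"
  proof (intro tendsto_add tendsto_mult lim_c)
    show "((\<lambda>p. ln \<rho> / real (fst p)) \<longlongrightarrow> 0) F" by (rule real_tendsto_divide_at_top[OF tendsto_const ntop])
    show "((\<lambda>p. R (fst p) powr \<rho> / real (fst p)) \<longlongrightarrow> 1 / \<rho>) F"
      unfolding F_def R_def by (rule filterlim_fst_snd_seq(1)[OF tendsto_ml_radius_powr]) (use \<rho> in simp)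
    show "((\<lambda>p. ln (X p) / real (fst p)) \<longlongrightarrow> 0) F"
      by (rule real_tendsto_divide_at_top[OF tendsto_ln[OF X1] ntop]) simp
  qed
  have eq: "0 + 1 / \<rho> * c z0 + 0 = ml_growth \<rho> z0" using z0 by (simp add: ml_growth_def c_def)
  have ev: "\<forall>\<^sub>F p in F. ln \<rho> / real (fst p) + (R (fst p) powr \<rho> / real (fst p)) * c (snd p) + ln (X p) / real (fst p)
     = ln (E p) / real (fst p)"
    using Xpos
  proof eventually_elim
    case (elim p)
    have "E p = \<rho> * exp (W p) * X p" using \<rho> by (simp add: X_def)
    hence "ln (E p) = ln \<rho> + W p + ln (X p)" using elim \<rho> by (simp add: ln_mult_pos)
    thus ?case by (simp add: W_def add_divide_distrib)
  qed
  have "((\<lambda>p. ln (E p) / real (fst p)) \<longlongrightarrow> ml_growth \<rho> z0) F"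
    by (rule Lim_transform_eventually[OF lim[unfolded eq] ev])
  thus "((\<lambda>p. ln (norm (mittag_leffler \<rho> (of_real (ml_radius \<rho> (fst p)) * snd p))) / real (fst p))
           \<longlongrightarrow> ml_growth \<rho> z0) F"
    by (simp add: E_def R_def)
qed

text \<open>The leading coefficient \<open>rGamma (1 - 1/\<rho>)\<close> is positive because \<rho>
  > 1. Hence E decays exactly like a constant over R |z|: the rate is 0, and E has no zeros nearby
  for large n.\<close>

lemma ml_growth_outside:
  assumes \<rho>: "\<rho> > 1" and z0: "Re z0 < norm z0 * cos (pi / (2 * \<rho>))"
  defines "F \<equiv> sequentially \<times>\<^sub>F nhds z0"
  shows "((\<lambda>p. ln (norm (mittag_leffler \<rho> (of_real (ml_radius \<rho> (fst p)) * snd p))) / real (fst p))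
           \<longlongrightarrow> ml_growth \<rho> z0) F"
    and "\<forall>\<^sub>F p in F. mittag_leffler \<rho> (of_real (ml_radius \<rho> (fst p)) * snd p) \<noteq> 0"
proof -
  define \<beta> where "\<beta> = pi / (2 * \<rho>)"
  have \<beta>: "0 < \<beta>" "\<beta> < pi / 2" using half_angle_bounds[OF \<rho>] by (auto simp: \<beta>_def)
  have z0': "z0 \<noteq> 0" using z0 by auto
  \<comment> \<open>The outer asymptotics are uniform only at a fixed angular distance from the
    critical rays. Here t is the unsigned angle of z0, and \<epsilon> below is half its excess over
    \<beta>.\<close>
  define t where "t = arccos (Re z0 / norm z0)"
  have rb: "-1 \<le> Re z0 / norm z0" "Re z0 / norm z0 \<le> 1"
    using z0' abs_Re_le_cmod[of z0] by (auto simp: field_simps abs_le_iff)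
  have t: "0 \<le> t" "t \<le> pi" "cos t = Re z0 / norm z0"
    unfolding t_def using rb by (auto intro: arccos_lbound arccos_ubound cos_arccos)
  have "cos t < cos \<beta>" unfolding t using z0 z0' by (simp add: field_simps \<beta>_def)
  hence tb: "\<beta> < t" using cos_mono_less_eq[of t \<beta>] t \<beta> by auto
  define \<epsilon> where "\<epsilon> = (t - \<beta>) / 2"
  have \<epsilon>: "\<epsilon> > 0" "\<beta> + \<epsilon> < t" using tb by (auto simp: \<epsilon>_def field_simps)
  have \<gamma>: "0 < \<beta> + \<epsilon>" "\<beta> + \<epsilon> < pi" using \<epsilon> \<beta> t by auto
  have "cos t < cos (\<beta> + \<epsilon>)" using cos_mono_less_eq[of t "\<beta> + \<epsilon>"] t \<gamma> \<epsilon> by auto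
  hence z0\<epsilon>: "Re z0 < norm z0 * cos (\<beta> + \<epsilon>)" unfolding t using z0' by (simp add: field_simps)
  define g where "g = rGamma (1 - 1/\<rho>)"
  have g: "g > 0" using \<rho> by (auto simp: g_def rGamma_inverse_Gamma intro!: Gamma_real_pos)
  define R where "R = ml_radius \<rho>"
  define E where "E = (\<lambda>p. norm (mittag_leffler \<rho> (of_real (R (fst p)) * snd p)))"
  define Y where "Y = (\<lambda>p. E p * (R (fst p) * norm (snd p)))"
  obtain C where C: "\<And>r \<theta>. r > 0 \<Longrightarrow> pi / (2 * \<rho>) + \<epsilon> \<le> \<theta> \<Longrightarrow> \<theta> \<le> 2 * pi - pi / (2 * \<rho>) - \<epsilon> \<Longrightarrow>
    norm (mittag_leffler \<rho> (rcis r \<theta>) + of_real (rGamma (1 - 1/\<rho>)) / rcis r \<theta>) \<le> C * r powr (-3/2)"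
    using mittag_leffler_outside[OF \<rho> \<epsilon>(1)] by blast
  have lim_snd: "(snd \<longlongrightarrow> z0) F" unfolding F_def by (rule filterlim_snd)
  have lim_norm: "((\<lambda>p. norm (snd p)) \<longlongrightarrow> norm z0) F" by (intro tendsto_intros lim_snd)
  have Rtop: "filterlim (\<lambda>p. R (fst p)) at_top F"
    unfolding F_def R_def using \<rho> by (intro filterlim_fst_snd_seq ml_radius_at_top) simp
  have cone: "\<forall>\<^sub>F p in F. Re (snd p) < norm (snd p) * cos (\<beta> + \<epsilon>)"
  proof -
    have "((\<lambda>p. norm (snd p) * cos (\<beta> + \<epsilon>) - Re (snd p)) \<longlongrightarrow> norm z0 * cos (\<beta> + \<epsilon>) - Re z0) F"
      by (intro tendsto_intros lim_snd)
    hence "\<forall>\<^sub>F p in F. norm (snd p) * cos (\<beta> + \<epsilon>) - Re (snd p) > 0"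
      by (rule order_tendstoD) (use z0\<epsilon> in simp)
    thus ?thesis by eventually_elim simp
  qed
  have nz: "\<forall>\<^sub>F p in F. snd p \<noteq> 0" using tendsto_imp_eventually_ne[OF lim_snd z0'] .
  have Rpos: "\<forall>\<^sub>F p in F. R (fst p) > 0" using Rtop unfolding filterlim_at_top_dense by blast
  have main: "\<forall>\<^sub>F p in F. \<bar>Y p - g\<bar> \<le> C * (R (fst p) * norm (snd p)) powr (-1/2)"
    using cone nz Rpos
  proof eventually_elim
    case (elim p)
    define z r \<theta> where "z = snd p" and "r = R (fst p) * norm (snd p)" and "\<theta> = Arg2pi (snd p)"
    have r: "r > 0" using elim by (simp add: r_def)
    have \<theta>: "pi / (2 * \<rho>) + \<epsilon> \<le> \<theta>" "\<theta> \<le> 2 * pi - pi / (2 * \<rho>) - \<epsilon>"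
      using outside_sector_iff_Arg2pi[of z "\<beta> + \<epsilon>"] elim \<gamma> by (auto simp: \<theta>_def z_def \<beta>_def)
    have rz: "rcis r \<theta> = of_real (R (fst p)) * z"
      unfolding r_def \<theta>_def z_def by (metis mult.assoc of_real_mult rcis_Arg2pi rcis_def)
    define M where "M = mittag_leffler \<rho> (rcis r \<theta>)"
    have nr: "norm (rcis r \<theta>) = r" using r by simp
    have "Y p = norm (M * rcis r \<theta>)"
      unfolding norm_mult nr Y_def E_def M_def rz unfolding z_def r_def using elim by simp
    moreover have "g = norm (complex_of_real g)" using g by simp
    ultimately have "\<bar>Y p - g\<bar> \<le> norm (M * rcis r \<theta> + of_real g)"
      using norm_triangle_ineq3[of "M * rcis r \<theta>" "- of_real g"] by simp
    also have "M * rcis r \<theta> + of_real g = (M + of_real g / rcis r \<theta>) * rcis r \<theta>"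
      using r by (simp add: field_simps)
    also have "norm \<dots> \<le> (C * r powr (-3/2)) * r"
      unfolding norm_mult nr M_def g_def using r by (intro mult_right_mono C \<theta>) auto
    also have "\<dots> = C * (r powr (-3/2) * r powr 1)" using r by simp
    also have "\<dots> = C * r powr (-1/2)" by (simp only: powr_add [symmetric]) simp
    finally show ?case by (simp add: r_def)
  qed
  have rtop: "filterlim (\<lambda>p. R (fst p) * norm (snd p)) at_top F"
    by (rule filterlim_at_top_mult_tendsto_pos[OF lim_norm _ Rtop]) (use z0' in auto)
  have "((\<lambda>p. C * (R (fst p) * norm (snd p)) powr (-1/2)) \<longlongrightarrow> C * 0) F"
    by (intro tendsto_intros tendsto_neg_powr rtop) auto
  hence z: "((\<lambda>p. C * (R (fst p) * norm (snd p)) powr (-1/2)) \<longlongrightarrow> 0) F" by simp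
  have "((\<lambda>p. Y p - g) \<longlongrightarrow> 0) F"
    by (rule Lim_null_comparison[OF _ z]) (use main in \<open>simp add: real_norm_def\<close>)
  hence Y1: "(Y \<longlongrightarrow> g) F" by (simp add: LIM_zero_iff)
  have Ypos: "\<forall>\<^sub>F p in F. Y p > 0" by (rule order_tendstoD(1)[OF Y1 g])
  show "\<forall>\<^sub>F p in F. mittag_leffler \<rho> (of_real (ml_radius \<rho> (fst p)) * snd p) \<noteq> 0"
    using Ypos by eventually_elim (auto simp: Y_def E_def R_def)
  have ntop: "filterlim (\<lambda>p. real (fst p)) at_top F"
    unfolding F_def by (intro filterlim_fst_snd_seq filterlim_real_sequentially)
  have lim: "((\<lambda>p. ln (Y p) / real (fst p) - ln (R (fst p)) / real (fst p) - ln (norm (snd p)) / real (fst p))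
      \<longlongrightarrow> 0 - 0 - 0) F"
  proof (intro tendsto_diff)
    show "((\<lambda>p. ln (Y p) / real (fst p)) \<longlongrightarrow> 0) F"
      by (rule real_tendsto_divide_at_top[OF tendsto_ln[OF Y1] ntop]) (use g in simp)
    show "((\<lambda>p. ln (norm (snd p)) / real (fst p)) \<longlongrightarrow> 0) F"
      by (rule real_tendsto_divide_at_top[OF tendsto_ln[OF lim_norm] ntop]) (use z0' in simp)
    show "((\<lambda>p. ln (R (fst p)) / real (fst p)) \<longlongrightarrow> 0) F"
      unfolding F_def R_def by (rule filterlim_fst_snd_seq(1)[OF tendsto_ln_ml_radius]) (use \<rho> in simp)
  qed
  have eq: "0 - 0 - 0 = ml_growth \<rho> z0" using z0 by (simp add: ml_growth_def)
  have ev: "\<forall>\<^sub>F p in F. ln (Y p) / real (fst p) - ln (R (fst p)) / real (fst p) - ln (norm (snd p)) / real (fst p)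
     = ln (E p) / real (fst p)"
    using Ypos Rpos nz
  proof eventually_elim
    case (elim p)
    have "E p \<noteq> 0" using elim by (auto simp: Y_def)
    hence "E p > 0" by (simp add: E_def)
    hence "ln (Y p) = ln (E p) + (ln (R (fst p)) + ln (norm (snd p)))"
      using elim by (simp add: Y_def ln_mult_pos)
    thus ?case by (simp add: add_divide_distrib)
  qed
  have "((\<lambda>p. ln (E p) / real (fst p)) \<longlongrightarrow> ml_growth \<rho> z0) F"
    by (rule Lim_transform_eventually[OF lim[unfolded eq] ev])
  thus "((\<lambda>p. ln (norm (mittag_leffler \<rho> (of_real (ml_radius \<rho> (fst p)) * snd p))) / real (fst p))
           \<longlongrightarrow> ml_growth \<rho> z0) F"
    by (simp add: E_def R_def)
qed

section \<open>Sections and tails\<close>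

lemma one_minus_times_power_sum:
  fixes c :: "nat \<Rightarrow> real" and z :: complex
  shows "(1 - z) * (\<Sum>k\<le>m. of_real (c k) * z ^ k) =
    of_real (c 0) - (\<Sum>k<m. of_real (c k - c (Suc k)) * z ^ Suc k) - of_real (c m) * z ^ Suc m"
  by (induction m) (simp_all add: algebra_simps)

text \<open>The Enestroem-Kakeya argument, kept quantitative up to the unit circle.\<close>

lemma decreasing_power_sum_bounds:
  fixes c :: "nat \<Rightarrow> real" and z :: complex
  assumes z: "norm z \<le> 1" and dec: "\<And>k. k < m \<Longrightarrow> c (Suc k) \<le> c k" and nn: "c m \<ge> 0" and "M \<le> m"
  shows "(\<Sum>k<M. (c k - c (Suc k)) * (1 - Re (z ^ Suc k))) \<le> norm ((1 - z) * (\<Sum>k\<le>m. of_real (c k) * z ^ k))"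
    and "norm ((1 - z) * (\<Sum>k\<le>m. of_real (c k) * z ^ k)) \<le> 2 * c 0"
proof -
  have tele: "c 0 = (\<Sum>k<m. c k - c (Suc k)) + c m" by (simp add: sum_lessThan_telescope')
  have zk: "norm (z ^ k) \<le> 1" for k using z by (simp add: norm_power power_le_one)
  hence rk: "Re (z ^ k) \<le> 1" for k using complex_Re_le_cmod order_trans by blast
  \<comment> \<open>Every term is nonnegative because |z| \<le> 1, so the sum may be cut after M
    terms. The tail needs M = 1 and the section M = 3.\<close>
  have "(\<Sum>k<M. (c k - c (Suc k)) * (1 - Re (z ^ Suc k))) \<le> (\<Sum>k<m. (c k - c (Suc k)) * (1 - Re (z ^ Suc k)))"
    using \<open>M \<le> m\<close> dec rk by (intro sum_mono2) (auto intro!: mult_nonneg_nonneg simp del: power_Suc)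
  also have "\<dots> \<le> \<dots> + c m * (1 - Re (z ^ Suc m))"
    using nn rk[of "Suc m"] by (simp del: power_Suc)
  also have "\<dots> = Re (of_real (c 0) - (\<Sum>k<m. of_real (c k - c (Suc k)) * z ^ Suc k) - of_real (c m) * z ^ Suc m)"
    using tele by (simp add: algebra_simps sum_subtractf sum.distrib del: power_Suc)
  also have "\<dots> \<le> norm ((1 - z) * (\<Sum>k\<le>m. of_real (c k) * z ^ k))"
    unfolding one_minus_times_power_sum by (rule complex_Re_le_cmod)
  finally show "(\<Sum>k<M. (c k - c (Suc k)) * (1 - Re (z ^ Suc k))) \<le> norm ((1 - z) * (\<Sum>k\<le>m. of_real (c k) * z ^ k))" .
  have "norm ((1 - z) * (\<Sum>k\<le>m. of_real (c k) * z ^ k)) \<le>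
     norm (of_real (c 0) :: complex) + norm (\<Sum>k<m. of_real (c k - c (Suc k)) * z ^ Suc k) + norm (of_real (c m) * z ^ Suc m)"
    unfolding one_minus_times_power_sum by (intro order_trans[OF norm_triangle_ineq4] add_mono) auto
  also have "norm (\<Sum>k<m. of_real (c k - c (Suc k)) * z ^ Suc k) \<le> (\<Sum>k<m. c k - c (Suc k))"
  proof (rule sum_norm_le)
    fix k assume "k \<in> {..<m}"
    hence "c k - c (Suc k) \<ge> 0" using dec by simp
    thus "norm (of_real (c k - c (Suc k)) * z ^ Suc k) \<le> c k - c (Suc k)"
      using zk[of "Suc k"] unfolding norm_mult norm_of_real by (simp add: mult_left_le del: power_Suc)
  qed
  also have "norm (of_real (c m) * z ^ Suc m) \<le> c m"
    using zk[of "Suc m"] nn unfolding norm_mult norm_of_real by (simp add: mult_left_le del: power_Suc)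
  also have "norm (of_real (c 0) :: complex) = c 0"
  proof -
    have "(\<Sum>k<m. c k - c (Suc k)) \<ge> 0" using dec by (intro sum_nonneg) auto
    hence "c 0 \<ge> 0" using tele nn by linarith
    thus ?thesis by simp
  qed
  finally show "norm ((1 - z) * (\<Sum>k\<le>m. of_real (c k) * z ^ k)) \<le> 2 * c 0" using tele by simp
qed

lemma decreasing_power_series_bounds:
  fixes c :: "nat \<Rightarrow> real" and z :: complex
  assumes z: "norm z \<le> 1" and dec: "\<And>k. c (Suc k) \<le> c k" and nn: "\<And>k. c k \<ge> 0"
    and sm: "summable (\<lambda>k. of_real (c k) * z ^ k)"
  shows "(c 0 - c 1) * (1 - Re z) \<le> norm ((1 - z) * (\<Sum>k. of_real (c k) * z ^ k))"
    and "norm ((1 - z) * (\<Sum>k. of_real (c k) * z ^ k)) \<le> 2 * c 0"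
proof -
  have lim: "(\<lambda>m. norm ((1 - z) * (\<Sum>k\<le>m. of_real (c k) * z ^ k))) \<longlonglongrightarrow>
      norm ((1 - z) * (\<Sum>k. of_real (c k) * z ^ k))"
    by (intro tendsto_intros summable_LIMSEQ' sm)
  show "(c 0 - c 1) * (1 - Re z) \<le> norm ((1 - z) * (\<Sum>k. of_real (c k) * z ^ k))"
  proof (rule LIMSEQ_le_const[OF lim], intro exI[of _ 1] allI impI)
    fix m :: nat assume "1 \<le> m"
    thus "(c 0 - c 1) * (1 - Re z) \<le> norm ((1 - z) * (\<Sum>k\<le>m. of_real (c k) * z ^ k))"
      using decreasing_power_sum_bounds(1)[of z m c 1] z dec nn by simp
  qed
  show "norm ((1 - z) * (\<Sum>k. of_real (c k) * z ^ k)) \<le> 2 * c 0"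
    by (rule LIMSEQ_le_const2[OF lim]) (use decreasing_power_sum_bounds(2)[of z _ c 0] z dec nn in auto)
qed

text \<open>The logarithmic bounds for the radii give at least t^(1/\<rho>) with t = (n - 1)/(n +
  \<rho>), and t^(1/\<rho>) \<ge> t since t \<le> 1 \<le> \<rho>.\<close>

lemma ml_radius_ratio_ge:
  assumes \<rho>: "\<rho> \<ge> 1" and n: "n \<ge> 2"
  shows "(real n - 1) / (real n + \<rho>) \<le> ml_radius \<rho> n / ml_radius \<rho> (Suc n)"
proof -
  obtain m where m: "n = Suc m" "m \<ge> 1" using n by (cases n) auto
  define t where "t = real m / (real n + \<rho>)"
  have t: "0 < t" "t \<le> 1" using m \<rho> by (auto simp: t_def field_simps)
  have p: "ml_radius \<rho> n > 0" "ml_radius \<rho> (Suc n) > 0" using \<rho> n by (auto intro: ml_radius_pos)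
  have "\<rho> * ln t \<le> 1 * ln t" using t \<rho> by (intro mult_right_mono_neg) auto
  hence "ln t \<le> ln t / \<rho>" using \<rho> by (simp add: field_simps)
  also have "ln t / \<rho> = (ln (real m / \<rho>) - ln (1 + real n / \<rho>)) / \<rho>"
  proof -
    have "t = (real m / \<rho>) / (1 + real n / \<rho>)" using \<rho> by (simp add: t_def field_simps)
    moreover have "real m / \<rho> > 0" "1 + real n / \<rho> > 0" using m \<rho> by (auto intro: add_pos_nonneg)
    ultimately have "ln t = ln (real m / \<rho>) - ln (1 + real n / \<rho>)" by (metis ln_divide_pos)
    thus ?thesis by simp
  qed
  also have "\<dots> \<le> ln (ml_radius \<rho> n) - ln (ml_radius \<rho> (Suc n))"
    using ln_ml_radius_bounds(1)[OF \<rho> m(2)] ln_ml_radius_bounds(2)[OF \<rho>, of n] n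
    unfolding m(1)[symmetric] diff_divide_distrib by simp
  also have "\<dots> = ln (ml_radius \<rho> n / ml_radius \<rho> (Suc n))" using p by (simp add: ln_divide_pos)
  finally have "t \<le> ml_radius \<rho> n / ml_radius \<rho> (Suc n)" using t p by simp
  thus ?thesis using m by (simp add: t_def)
qed

text \<open>The product of the lower bounds of \<open>ml_radius_ratio_ge\<close> and
  \<open>ml_radius_gap\<close>. The numerator n - 2 fits both uses, since the section applies the
  ratio bound at n - 1. Being only polynomially small, it has exponential rate 0.\<close>

definition ml_gap :: "real \<Rightarrow> nat \<Rightarrow> real" where
  "ml_gap \<rho> n = (real n - 2) / (real n + \<rho>) ^ 3"

lemma ml_radius_gap:
  assumes "\<rho> > 0" "1 \<le> m" "m < k"
  shows "1 / (real m + \<rho>)\<^sup>2 \<le> 1 - ml_radius \<rho> m / ml_radius \<rho> k"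
proof -
  have p: "ml_radius \<rho> (Suc m) > 0" "ml_radius \<rho> k > 0" "ml_radius \<rho> m > 0"
    using assms by (auto intro: ml_radius_pos)
  have "ml_radius \<rho> m / ml_radius \<rho> k \<le> ml_radius \<rho> m / ml_radius \<rho> (Suc m)"
    using p assms by (intro divide_left_mono ml_radius_mono) auto
  also have "\<dots> \<le> 1 - 1 / (real m + \<rho>)\<^sup>2"
    using ml_radius_growth[of \<rho> m] p assms by (simp add: pos_divide_le_eq)
  finally show ?thesis by simp
qed

text \<open>Consecutive normalised coefficients have the ratio R n / R (n + 2 + k) \<le> 1, so they
  decrease. Factoring out \<open>a n * R n ^ n\<close> in place of the first tail coefficient gives
  the tail and the section the same normalisation; the price is a leading coefficient R n / R (n +
  1) in place of 1, which the ratio bound controls.\<close>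

lemma ml_tail_factor:
  fixes z :: complex
  assumes \<rho>: "\<rho> \<ge> 1" and n: "n \<ge> 3" and z: "norm z \<le> 1"
  obtains V where "ml_tail \<rho> (n + 1) (of_real (ml_radius \<rho> n) * z) =
      of_real (ml_coeff \<rho> n * ml_radius \<rho> n ^ n) * z ^ (n + 1) * V"
    "ml_gap \<rho> n * (1 - Re z) \<le> norm ((1 - z) * V)" "norm ((1 - z) * V) \<le> 2"
proof -
  define R where "R = ml_radius \<rho>"
  define a where "a = ml_coeff \<rho>"
  have a: "a k > 0" for k using \<rho> by (auto simp: a_def intro: ml_coeff_pos)
  have R: "R k > 0" if "k \<ge> 1" for k using \<rho> that by (auto simp: R_def intro: ml_radius_pos)
  have RS: "R (Suc k) = a k / a (Suc k)" for k using \<rho> by (simp add: R_def a_def ml_radius_Suc)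
  define c where "c = (\<lambda>k. a (n + 1 + k) * R n ^ (k + 1) / a n)"
  have Rn: "R n > 0" using R n by simp
  have c0: "c k \<ge> 0" for k using a[of n] a[of "n+1+k"] Rn by (simp add: c_def)
  have cS: "c (Suc k) = c k * (R n / R (n + 2 + k))" for k
  proof -
    have RR: "R (n + 2 + k) = a (n + 1 + k) / a (n + 2 + k)" using RS[of "n+1+k"] by simp
    show ?thesis unfolding RR using a[of "n + 1 + k"] a[of "n + 2 + k"] by (simp add: c_def)
  qed
  have c_dec: "c (Suc k) \<le> c k" for k
  proof -
    have "R n \<le> R (n + 2 + k)" unfolding R_def using \<rho> n by (intro ml_radius_mono) auto
    hence "R n / R (n + 2 + k) \<le> 1" using R[of "n+2+k"] by simp
    thus ?thesis unfolding cS using c0[of k] by (rule mult_left_le)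
  qed
  have c00: "c 0 = R n / R (Suc n)" using RS[of n] by (simp add: c_def)
  have c01: "c 0 \<le> 1" unfolding c00 using R[of "Suc n"] \<rho> n ml_radius_mono[of \<rho> n "Suc n"] by (simp add: R_def)
  have terms: "of_real (a (n + 1 + k)) * (of_real (R n) * z) ^ (n + 1 + k) =
     (of_real (a n * R n ^ n) * z ^ (n + 1)) * (of_real (c k) * z ^ k)" for k
    using a[of n] by (simp add: c_def power_add power_mult_distrib field_simps)
  have sm: "summable (\<lambda>k. of_real (c k) * z ^ k)"
  proof (cases "z = 0")
    case True
    thus ?thesis by (intro summable_finite[of "{0}"]) auto
  next
    case False
    have "summable (\<lambda>k. of_real (a k) * (of_real (R n) * z) ^ k)"
      unfolding a_def by (rule summable_norm_cancel[OF summable_norm_ml[OF \<rho>]])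
    hence "summable (\<lambda>k. of_real (a (k + (n + 1))) * (of_real (R n) * z) ^ (k + (n + 1)))"
      by (rule summable_ignore_initial_segment)
    moreover have "of_real (a (k + (n + 1))) * (of_real (R n) * z) ^ (k + (n + 1)) =
        (of_real (a n * R n ^ n) * z ^ (n + 1)) * (of_real (c k) * z ^ k)" for k
      unfolding add.commute[of k "n + 1"] by (rule terms)
    ultimately have "summable (\<lambda>k. (of_real (a n * R n ^ n) * z ^ (n + 1)) * (of_real (c k) * z ^ k))"
      by (simp only:)
    thus ?thesis by (rule summable_mult_D) (use False a[of n] Rn in auto)
  qed
  define V where "V = (\<Sum>k. of_real (c k) * z ^ k)"
  note bds = decreasing_power_series_bounds[OF z c_dec c0 sm]
  have "ml_gap \<rho> n \<le> c 0 - c 1"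
  proof -
    have "ml_gap \<rho> n = (real n - 2) / (real n + \<rho>) * (1 / (real n + \<rho>)\<^sup>2)"
      by (simp add: ml_gap_def power2_eq_square power3_eq_cube)
    also have "\<dots> \<le> c 0 * (1 - R n / R (n + 2))"
    proof (rule mult_mono)
      have "(real n - 2) / (real n + \<rho>) \<le> (real n - 1) / (real n + \<rho>)"
        using \<rho> by (intro divide_right_mono) auto
      also have "\<dots> \<le> c 0" unfolding c00 R_def using ml_radius_ratio_ge \<rho> n by simp
      finally show "(real n - 2) / (real n + \<rho>) \<le> c 0" .
      show "1 / (real n + \<rho>)\<^sup>2 \<le> 1 - R n / R (n + 2)"
        unfolding R_def using \<rho> n by (intro ml_radius_gap) auto
    qed (use c0 in auto)
    also have "\<dots> = c 0 - c 1" using cS[of 0] by (simp add: algebra_simps)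
    finally show ?thesis .
  qed
  moreover have "Re z \<le> 1" using z complex_Re_le_cmod[of z] by linarith
  ultimately have "ml_gap \<rho> n * (1 - Re z) \<le> (c 0 - c 1) * (1 - Re z)" by (intro mult_right_mono) auto
  hence low: "ml_gap \<rho> n * (1 - Re z) \<le> norm ((1 - z) * V)" using bds(1) by (simp add: V_def)
  have upp: "norm ((1 - z) * V) \<le> 2" using bds(2) c01 by (simp add: V_def)
  have "ml_tail \<rho> (n + 1) (of_real (ml_radius \<rho> n) * z) =
        of_real (ml_coeff \<rho> n * ml_radius \<rho> n ^ n) * z ^ (n + 1) * V"
    unfolding ml_tail_def V_def R_def[symmetric] a_def[symmetric] terms by (rule suminf_mult[OF sm])
  from that[OF this low upp] show ?thesis .
qed

text \<open>The first two normalised coefficients of a section coincide by the choice of \<open>ml_radius\<close>, so the gap is extracted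
  from the next two; both are needed because \<open>1 - Re (w^2)\<close> vanishes at \<open>w = -1\<close>.\<close>

lemma ml_section_factor:
  fixes z :: complex
  assumes \<rho>: "\<rho> \<ge> 1" and n: "n \<ge> 3" and z: "norm z \<ge> 1"
  obtains V where "ml_section \<rho> n (of_real (ml_radius \<rho> n) * z) =
      of_real (ml_coeff \<rho> n * ml_radius \<rho> n ^ n) * z ^ n * V"
    "ml_gap \<rho> n * (2 - Re (inverse z ^ 2) - Re (inverse z ^ 3)) \<le> norm ((1 - inverse z) * V)"
    "norm ((1 - inverse z) * V) \<le> 2"
proof -
  define R where "R = ml_radius \<rho>"
  define a where "a = ml_coeff \<rho>"
  have a: "a k > 0" for k using \<rho> by (auto simp: a_def intro: ml_coeff_pos)
  have R: "R k > 0" if "k \<ge> 1" for k using \<rho> that by (auto simp: R_def intro: ml_radius_pos)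
  have RS: "R (Suc k) = a k / a (Suc k)" for k using \<rho> by (simp add: R_def a_def ml_radius_Suc)
  have Rn: "R n > 0" using R n by simp
  \<comment> \<open>Read from the top degree downwards, the section is z^n times a polynomial in w =
    1/z with nonincreasing coefficients.\<close>
  define b where "b = (\<lambda>k. a (n - k) / (a n * R n ^ k))"
  define w where "w = inverse z"
  have z0: "z \<noteq> 0" using z by auto
  have w: "norm w \<le> 1" using z by (simp add: w_def norm_inverse inverse_le_1_iff)
  have b0: "b k \<ge> 0" for k using a[of n] a[of "n-k"] Rn by (simp add: b_def)
  have bS: "b (Suc k) = b k * (R (n - k) / R n)" if "k < n" for k
  proof -
    have "Suc (n - Suc k) = n - k" using that by simp
    hence "R (n - k) = a (n - Suc k) / a (n - k)" using RS[of "n - Suc k"] by simp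
    thus ?thesis using a[of "n - k"] Rn by (simp add: b_def)
  qed
  have b_dec: "b (Suc k) \<le> b k" if "k < n" for k
  proof -
    have "R (n - k) \<le> R n" unfolding R_def using \<rho> n that by (intro ml_radius_mono) auto
    hence "R (n - k) / R n \<le> 1" using Rn by simp
    thus ?thesis unfolding bS[OF that] using b0[of k] by (rule mult_left_le)
  qed
  have b00: "b 0 = 1" using a[of n] by (simp add: b_def)
  have b1: "b 1 = 1" using bS[of 0] n Rn b00 by simp
  have b2: "b 2 = R (n - 1) / R n" using bS[of 1] n b1 by (simp add: numeral_2_eq_2)
  have b3: "b 3 = b 2 * (R (n - 2) / R n)" using bS[of 2] n by (simp add: numeral_3_eq_3 numeral_2_eq_2)
  define V where "V = (\<Sum>k\<le>n. of_real (b k) * w ^ k)"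
  have "ml_section \<rho> n (of_real (ml_radius \<rho> n) * z) = (\<Sum>k\<le>n. of_real (a k) * (of_real (R n) * z) ^ k)"
    by (simp add: ml_section_def a_def R_def)
  also have "\<dots> = (\<Sum>k\<le>n. of_real (a (n - k)) * (of_real (R n) * z) ^ (n - k))"
    by (rule sum.nat_diff_reindex[symmetric, of _ "Suc n", simplified lessThan_Suc_atMost diff_Suc_Suc])
  also have "\<dots> = (\<Sum>k\<le>n. (of_real (a n * R n ^ n) * z ^ n) * (of_real (b k) * w ^ k))"
  proof (rule sum.cong[OF refl])
    fix k assume "k \<in> {..n}"
    hence k: "k \<le> n" by simp
    have e: "x ^ n = x ^ (n - k) * x ^ k" for x :: complex using k by (simp flip: power_add)
    show "of_real (a (n - k)) * (of_real (R n) * z) ^ (n - k) = of_real (a n * R n ^ n) * z ^ n * (of_real (b k) * w ^ k)"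
      using a[of n] Rn z0 e[of z] e[of "of_real (R n)"]
      by (simp add: b_def w_def power_mult_distrib field_simps)
  qed
  also have "\<dots> = of_real (a n * R n ^ n) * z ^ n * V" by (simp add: V_def sum_distrib_left)
  finally have eq: "ml_section \<rho> n (of_real (ml_radius \<rho> n) * z) = of_real (a n * R n ^ n) * z ^ n * V" .
  note bds = decreasing_power_sum_bounds[OF w, of n b 3]
  have rk: "Re (w ^ k) \<le> 1" for k
    using complex_Re_le_cmod[of "w ^ k"] power_le_one[OF norm_ge_zero w, of k] by (simp add: norm_power)
  have sq: "1 / (real n + \<rho>)\<^sup>2 \<le> 1 / (real (n - 1) + \<rho>)\<^sup>2"
    using \<rho> n by (intro divide_left_mono power_mono) auto
  have g1: "1 / (real n + \<rho>)\<^sup>2 \<le> b 1 - b 2"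
    unfolding b1 b2 R_def by (intro order_trans[OF sq ml_radius_gap]) (use \<rho> n in linarith)+
  have q: "ml_gap \<rho> n = (real n - 2) / (real n + \<rho>) * (1 / (real n + \<rho>)\<^sup>2)"
    by (simp add: ml_gap_def power2_eq_square power3_eq_cube)
  have q1: "ml_gap \<rho> n \<le> b 1 - b 2"
  proof -
    have "ml_gap \<rho> n \<le> 1 * (1 / (real n + \<rho>)\<^sup>2)" unfolding q using \<rho> n by (intro mult_right_mono) auto
    thus ?thesis using g1 by simp
  qed
  have q2: "ml_gap \<rho> n \<le> b 2 - b 3"
  proof -
    have "ml_gap \<rho> n \<le> b 2 * (1 - R (n - 2) / R n)" unfolding q
    proof (rule mult_mono)
      have "(real n - 2) / (real n + \<rho>) \<le> (real (n - 1) - 1) / (real (n - 1) + \<rho>)"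
        using \<rho> n by (intro frac_le) auto
      also have "\<dots> \<le> b 2" unfolding b2 R_def using ml_radius_ratio_ge[of \<rho> "n-1"] \<rho> n by simp
      finally show "(real n - 2) / (real n + \<rho>) \<le> b 2" .
      have "1 / (real n + \<rho>)\<^sup>2 \<le> 1 / (real (n - 2) + \<rho>)\<^sup>2"
        using \<rho> n by (intro divide_left_mono power_mono) auto
      also have "\<dots> \<le> 1 - R (n - 2) / R n" unfolding R_def using \<rho> n by (intro ml_radius_gap) auto
      finally show "1 / (real n + \<rho>)\<^sup>2 \<le> 1 - R (n - 2) / R n" .
    qed (use b0 in auto)
    thus ?thesis unfolding b3 by (simp add: algebra_simps)
  qed
  have "ml_gap \<rho> n * (2 - Re (w ^ 2) - Re (w ^ 3)) = ml_gap \<rho> n * (1 - Re (w ^ 2)) + ml_gap \<rho> n * (1 - Re (w ^ 3))"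
    by (simp add: algebra_simps)
  also have "\<dots> \<le> (b 1 - b 2) * (1 - Re (w ^ 2)) + (b 2 - b 3) * (1 - Re (w ^ 3))"
    using q1 q2 rk by (intro add_mono mult_right_mono) auto
  also have "\<dots> = (\<Sum>k<3. (b k - b (Suc k)) * (1 - Re (w ^ Suc k)))"
    using b00 b1 by (simp add: numeral_3_eq_3 numeral_2_eq_2)
  also have "\<dots> \<le> norm ((1 - w) * V)" unfolding V_def using bds(1) b_dec b0 n by simp
  finally have low: "ml_gap \<rho> n * (2 - Re (w ^ 2) - Re (w ^ 3)) \<le> norm ((1 - w) * V)" .
  have "norm ((1 - w) * V) \<le> 2" unfolding V_def using bds(2) b_dec b0 n b00 by simp
  with low eq show ?thesis by (intro that[of V]) (simp_all add: a_def R_def w_def)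
qed

text \<open>Equality would force both powers to be 1, and then w = w^3 / w^2 = 1. Thus the lower
  bound for the section degenerates only at z = 1.\<close>

lemma Re_square_plus_cube_less:
  fixes w :: complex
  assumes w: "norm w \<le> 1" "w \<noteq> 1"
  shows "Re (w ^ 2) + Re (w ^ 3) < 2"
proof (rule ccontr)
  assume "\<not> Re (w ^ 2) + Re (w ^ 3) < 2"
  moreover have n: "norm (w ^ k) \<le> 1" for k using w by (simp add: norm_power power_le_one)
  hence "Re (w ^ k) \<le> 1" for k using complex_Re_le_cmod order_trans by blast
  from this[of 2] this[of 3] have "Re (w ^ 2) = 1" "Re (w ^ 3) = 1" using calculation by linarith+
  moreover have one: "u = 1" if "Re u = 1" "norm u \<le> 1" for u :: complex
  proof -
    have "(Re u)\<^sup>2 + (Im u)\<^sup>2 \<le> 1\<^sup>2" using that(2) unfolding cmod_power2[symmetric] by (intro power_mono) auto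
    thus ?thesis using that by (simp add: complex_eq_iff)
  qed
  ultimately have "w ^ 2 = 1" "w ^ 3 = 1" using n by auto
  hence "w = 1" by (simp add: power2_eq_square power3_eq_cube)
  with w show False by simp
qed

text \<open>With \<open>E = ml_section + ml_tail\<close> the root equation reads both \<open>ml_tail = (1 - lam) * E\<close> and \<open>ml_section = lam * E\<close>.
  The first is used on the closed unit disc, where the tail is dominated by its first term, and the second
  outside, where the section is dominated by its last term.\<close>

definition ml_part :: "real \<Rightarrow> nat \<Rightarrow> complex \<Rightarrow> complex" where
  "ml_part \<rho> n z = (if norm z \<le> 1 then ml_tail \<rho> (n + 1) (of_real (ml_radius \<rho> n) * z)
                       else ml_section \<rho> n (of_real (ml_radius \<rho> n) * z))"

text \<open>A single constant valid on a neighbourhood of z0. On the unit circle both forms of the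
  root equation occur arbitrarily close to z0, so all the quantities have to be bounded at
  once.\<close>

lemma ml_part_factor_bounds:
  assumes z0: "z0 \<noteq> 0" "z0 \<noteq> 1"
  obtains A where "A > 0"
    "\<forall>\<^sub>F z in nhds z0. (norm z \<le> 1 \<longrightarrow> A \<le> 1 - Re z \<and> A \<le> norm (1 - z)) \<and>
       (norm z > 1 \<longrightarrow> A \<le> 2 - Re (inverse z ^ 2) - Re (inverse z ^ 3) \<and> A \<le> norm (1 - inverse z))"
proof -
  have lim: "((\<lambda>z. z) \<longlongrightarrow> z0) (nhds z0)" by (rule filterlim_ident)
  \<comment> \<open>The second alternative covers z0 strictly on the other side of the unit circle,
    where the implication is vacuous nearby.\<close>
  have pos: "\<exists>a>0. \<forall>\<^sub>F z in nhds z0. P z \<longrightarrow> a \<le> f z"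
    if "(f \<longlongrightarrow> f z0) (nhds z0)" "f z0 > 0 \<or> (\<forall>\<^sub>F z in nhds z0. \<not> P z)" for P and f :: "complex \<Rightarrow> real"
    using that(2)
  proof
    assume f: "f z0 > 0"
    hence "\<forall>\<^sub>F z in nhds z0. f z > f z0 / 2" by (intro order_tendstoD(1)[OF that(1)]) simp
    hence "\<forall>\<^sub>F z in nhds z0. P z \<longrightarrow> f z0 / 2 \<le> f z" by eventually_elim simp
    thus ?thesis using f by (intro exI[of _ "f z0 / 2"]) auto
  next
    assume "\<forall>\<^sub>F z in nhds z0. \<not> P z"
    hence "\<forall>\<^sub>F z in nhds z0. P z \<longrightarrow> 1 \<le> f z" by eventually_elim simp
    thus ?thesis by (intro exI[of _ 1]) auto
  qed
  have "\<exists>a>0. \<forall>\<^sub>F z in nhds z0. norm z \<le> 1 \<longrightarrow> a \<le> 1 - Re z"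
  proof (rule pos)
    show "((\<lambda>z. 1 - Re z) \<longlongrightarrow> 1 - Re z0) (nhds z0)" by (intro tendsto_intros lim)
    show "0 < 1 - Re z0 \<or> (\<forall>\<^sub>F z in nhds z0. \<not> norm z \<le> 1)"
    proof (cases "norm z0 \<le> 1")
      case True
      have "Re z0 \<noteq> 1"
      proof
        assume 1: "Re z0 = 1"
        have "(Re z0)\<^sup>2 + (Im z0)\<^sup>2 \<le> 1\<^sup>2" using True unfolding cmod_power2[symmetric] by (intro power_mono) auto
        with 1 z0 show False by (simp add: complex_eq_iff)
      qed
      moreover have "Re z0 \<le> 1" using True complex_Re_le_cmod[of z0] by linarith
      ultimately show ?thesis by simp
    next
      case False
      have "((\<lambda>z. norm z) \<longlongrightarrow> norm z0) (nhds z0)" by (intro tendsto_intros lim)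
      hence "\<forall>\<^sub>F z in nhds z0. norm z > 1" by (rule order_tendstoD) (use False in simp)
      thus ?thesis by (simp add: not_le)
    qed
  qed
  then obtain a1 where a1: "a1 > 0" "\<forall>\<^sub>F z in nhds z0. norm z \<le> 1 \<longrightarrow> a1 \<le> 1 - Re z" by blast
  have "\<exists>a>0. \<forall>\<^sub>F z in nhds z0. norm z > 1 \<longrightarrow> a \<le> 2 - Re (inverse z ^ 2) - Re (inverse z ^ 3)"
  proof (rule pos)
    show "((\<lambda>z. 2 - Re (inverse z ^ 2) - Re (inverse z ^ 3)) \<longlongrightarrow> 2 - Re (inverse z0 ^ 2) - Re (inverse z0 ^ 3)) (nhds z0)"
      by (intro tendsto_intros lim z0)
    show "0 < 2 - Re (inverse z0 ^ 2) - Re (inverse z0 ^ 3) \<or> (\<forall>\<^sub>F z in nhds z0. \<not> norm z > 1)"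
    proof (cases "norm z0 \<ge> 1")
      case True
      have "Re (inverse z0 ^ 2) + Re (inverse z0 ^ 3) < 2"
        using True z0 by (intro Re_square_plus_cube_less) (auto simp: norm_inverse inverse_le_1_iff)
      thus ?thesis by simp
    next
      case False
      have "((\<lambda>z. norm z) \<longlongrightarrow> norm z0) (nhds z0)" by (intro tendsto_intros lim)
      hence "\<forall>\<^sub>F z in nhds z0. norm z < 1" by (rule order_tendstoD) (use False in simp)
      hence "\<forall>\<^sub>F z in nhds z0. \<not> norm z > 1" by eventually_elim simp
      thus ?thesis ..
    qed
  qed
  then obtain a2 where a2: "a2 > 0"
    "\<forall>\<^sub>F z in nhds z0. norm z > 1 \<longrightarrow> a2 \<le> 2 - Re (inverse z ^ 2) - Re (inverse z ^ 3)" by blast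
  have "\<exists>a>0. \<forall>\<^sub>F z in nhds z0. True \<longrightarrow> a \<le> norm (1 - z)"
    by (rule pos) (use z0 in \<open>auto intro!: tendsto_intros lim\<close>)
  then obtain a3 where a3: "a3 > 0" "\<forall>\<^sub>F z in nhds z0. True \<longrightarrow> a3 \<le> norm (1 - z)" by blast
  have "\<exists>a>0. \<forall>\<^sub>F z in nhds z0. True \<longrightarrow> a \<le> norm (1 - inverse z)"
    by (rule pos) (use z0 in \<open>auto intro!: tendsto_intros lim\<close>)
  then obtain a4 where a4: "a4 > 0" "\<forall>\<^sub>F z in nhds z0. True \<longrightarrow> a4 \<le> norm (1 - inverse z)" by blast
  show ?thesis
  proof (rule that[of "min (min a1 a2) (min a3 a4)"])
    show "\<forall>\<^sub>F z in nhds z0. (norm z \<le> 1 \<longrightarrow> min (min a1 a2) (min a3 a4) \<le> 1 - Re z \<and> min (min a1 a2) (min a3 a4) \<le> norm (1 - z)) \<and>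
       (norm z > 1 \<longrightarrow> min (min a1 a2) (min a3 a4) \<le> 2 - Re (inverse z ^ 2) - Re (inverse z ^ 3) \<and>
          min (min a1 a2) (min a3 a4) \<le> norm (1 - inverse z))"
      using a1(2) a2(2) a3(2) a4(2) by eventually_elim auto
  qed (use a1 a2 a3 a4 in auto)
qed

text \<open>After the factorisation V lies between a polynomially small and a constant bound, so the
  rate comes from the maximal term m and from |z|^e. The exponent e is n + 1 for the tail and n for
  the section, which makes no difference after division by n; hence the limit is locally uniform
  across the unit circle.\<close>

lemma ml_part_growth:
  assumes \<rho>: "\<rho> \<ge> 1" and z0: "z0 \<noteq> 0" "z0 \<noteq> 1"
  defines "F \<equiv> sequentially \<times>\<^sub>F nhds z0"
  shows "((\<lambda>p. ln (norm (ml_part \<rho> (fst p) (snd p))) / real (fst p)) \<longlongrightarrow> ln (norm z0) + 1/\<rho>) F"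
    and "\<forall>\<^sub>F p in F. ml_part \<rho> (fst p) (snd p) \<noteq> 0"
proof -
  obtain A where A: "A > 0" and evA:
    "\<forall>\<^sub>F z in nhds z0. (norm z \<le> 1 \<longrightarrow> A \<le> 1 - Re z \<and> A \<le> norm (1 - z)) \<and>
       (norm z > 1 \<longrightarrow> A \<le> 2 - Re (inverse z ^ 2) - Re (inverse z ^ 3) \<and> A \<le> norm (1 - inverse z))"
    using ml_part_factor_bounds[OF z0] by blast
  define m where "m = (\<lambda>n. ml_coeff \<rho> n * ml_radius \<rho> n ^ n)"
  define lo where "lo = (\<lambda>n. ml_gap \<rho> n * A / 2)"
  have lim_snd: "(snd \<longlongrightarrow> z0) F" unfolding F_def by (rule filterlim_snd)
  have nz: "\<forall>\<^sub>F p in F. snd p \<noteq> 0" using tendsto_imp_eventually_ne[OF lim_snd z0(1)] .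
  have big: "\<forall>\<^sub>F p in F. fst p \<ge> 3" unfolding F_def
    by (intro eventually_fst_snd_seq(1) eventually_ge_at_top)
  have factor: "\<exists>e V. (e = n \<or> e = n + 1) \<and> ml_part \<rho> n z = of_real (m n) * z ^ e * V \<and>
       0 < lo n \<and> lo n \<le> norm V \<and> norm V \<le> 2 / A"
    if n: "n \<ge> 3" and z: "(norm z \<le> 1 \<longrightarrow> A \<le> 1 - Re z \<and> A \<le> norm (1 - z)) \<and>
       (norm z > 1 \<longrightarrow> A \<le> 2 - Re (inverse z ^ 2) - Re (inverse z ^ 3) \<and> A \<le> norm (1 - inverse z))" for n z
  proof -
    have gap: "ml_gap \<rho> n > 0" using n \<rho> by (simp add: ml_gap_def)
    have fin: "0 < lo n \<and> lo n \<le> norm V \<and> norm V \<le> 2 / A"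
      if "A \<le> u" "ml_gap \<rho> n * u \<le> norm ((1 - w) * V)" "norm ((1 - w) * V) \<le> 2" "norm w \<le> 1" "A \<le> norm (1 - w)"
      for u w and V :: complex
    proof -
      have "ml_gap \<rho> n * A \<le> ml_gap \<rho> n * u" using that gap by (intro mult_left_mono) auto
      also have "\<dots> \<le> norm (1 - w) * norm V" using that by (simp add: norm_mult)
      also have "\<dots> \<le> 2 * norm V"
        using norm_triangle_ineq4[of 1 w] that by (intro mult_right_mono) auto
      finally have 1: "lo n \<le> norm V" by (simp add: lo_def)
      have "A * norm V \<le> norm (1 - w) * norm V" using that by (intro mult_right_mono) auto
      also have "\<dots> \<le> 2" using that by (simp add: norm_mult)
      finally have "norm V \<le> 2 / A" using A by (simp add: field_simps)
      with 1 show ?thesis using gap A by (simp add: lo_def)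
    qed
    show ?thesis
    proof (cases "norm z \<le> 1")
      case True
      obtain V where V: "ml_tail \<rho> (n + 1) (of_real (ml_radius \<rho> n) * z) =
        of_real (ml_coeff \<rho> n * ml_radius \<rho> n ^ n) * z ^ (n + 1) * V"
        "ml_gap \<rho> n * (1 - Re z) \<le> norm ((1 - z) * V)" "norm ((1 - z) * V) \<le> 2"
        using ml_tail_factor[OF \<rho> n True] by blast
      thus ?thesis using True z fin[OF _ V(2,3) True]
        by (intro exI[of _ "n + 1"] exI[of _ V]) (simp add: ml_part_def m_def)
    next
      case False
      hence z1: "norm z \<ge> 1" by simp
      have iz: "norm (inverse z) \<le> 1" using z1 by (simp add: norm_inverse inverse_le_1_iff)
      obtain V where V: "ml_section \<rho> n (of_real (ml_radius \<rho> n) * z) =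
        of_real (ml_coeff \<rho> n * ml_radius \<rho> n ^ n) * z ^ n * V"
        "ml_gap \<rho> n * (2 - Re (inverse z ^ 2) - Re (inverse z ^ 3)) \<le> norm ((1 - inverse z) * V)"
        "norm ((1 - inverse z) * V) \<le> 2"
        using ml_section_factor[OF \<rho> n z1] by blast
      thus ?thesis using False z fin[OF _ V(2,3) iz]
        by (intro exI[of _ n] exI[of _ V]) (simp add: ml_part_def m_def)
    qed
  qed
  have mpos: "m n > 0" if "n \<ge> 1" for n
    using \<rho> that by (auto simp: m_def intro!: mult_pos_pos ml_coeff_pos zero_less_power ml_radius_pos)
  have evA': "\<forall>\<^sub>F p in F. (norm (snd p) \<le> 1 \<longrightarrow> A \<le> 1 - Re (snd p) \<and> A \<le> norm (1 - snd p)) \<and>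
       (norm (snd p) > 1 \<longrightarrow> A \<le> 2 - Re (inverse (snd p) ^ 2) - Re (inverse (snd p) ^ 3) \<and> A \<le> norm (1 - inverse (snd p)))"
    unfolding F_def by (rule eventually_fst_snd_seq(2)[OF evA])
  have main: "\<forall>\<^sub>F p in F. ml_part \<rho> (fst p) (snd p) \<noteq> 0 \<and>
     \<bar>ln (norm (ml_part \<rho> (fst p) (snd p))) / real (fst p) - (ln (m (fst p)) / real (fst p) + ln (norm (snd p)))\<bar>
       \<le> \<bar>ln (norm (snd p))\<bar> / real (fst p) + (\<bar>ln (lo (fst p)) / real (fst p)\<bar> + \<bar>ln (2 / A)\<bar> / real (fst p))"
    using nz big evA'
  proof eventually_elim
    case (elim p)
    define n z where "n = fst p" and "z = snd p"
    have n: "n \<ge> 3" "z \<noteq> 0" using elim by (auto simp: n_def z_def)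
    obtain e V where e: "e = n \<or> e = n + 1" and eq: "ml_part \<rho> n z = of_real (m n) * z ^ e * V"
      and V: "0 < lo n" "lo n \<le> norm V" "norm V \<le> 2 / A"
      using factor[of n z] elim by (auto simp: n_def z_def)
    have mp: "m n > 0" using n by (intro mpos) auto
    have Vp: "norm V > 0" using V by linarith
    have "ln (lo n) \<le> ln (norm V)" "ln (norm V) \<le> ln (2 / A)" using V Vp A by auto
    hence lnV: "\<bar>ln (norm V)\<bar> \<le> \<bar>ln (lo n)\<bar> + \<bar>ln (2 / A)\<bar>" by linarith
    have "norm (ml_part \<rho> n z) = m n * norm z ^ e * norm V"
      using mp by (simp add: eq norm_mult norm_power)
    hence "ln (norm (ml_part \<rho> n z)) = ln (m n) + real e * ln (norm z) + ln (norm V)"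
      using mp n Vp by (simp add: ln_mult_pos ln_realpow)
    hence "ln (norm (ml_part \<rho> n z)) / real n - (ln (m n) / real n + ln (norm z)) =
       (real e - real n) * ln (norm z) / real n + ln (norm V) / real n"
      using n by (simp add: field_simps)
    also have "\<bar>\<dots>\<bar> \<le> \<bar>(real e - real n) * ln (norm z) / real n\<bar> + \<bar>ln (norm V) / real n\<bar>"
      by (rule abs_triangle_ineq)
    also have "\<bar>(real e - real n) * ln (norm z) / real n\<bar> \<le> \<bar>ln (norm z)\<bar> / real n"
      using e by auto
    also have "\<bar>ln (norm V) / real n\<bar> \<le> \<bar>ln (lo n) / real n\<bar> + \<bar>ln (2 / A)\<bar> / real n"
      using divide_right_mono[OF lnV, of "real n"] by (simp add: add_divide_distrib abs_divide)
    finally show ?case using eq mp n Vp unfolding n_def z_def by auto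
  qed
  show "\<forall>\<^sub>F p in F. ml_part \<rho> (fst p) (snd p) \<noteq> 0" using main by eventually_elim blast
  have ntop: "filterlim (\<lambda>p. real (fst p)) at_top F"
    unfolding F_def by (intro filterlim_fst_snd_seq filterlim_real_sequentially)
  have lim_ln: "((\<lambda>p. ln (norm (snd p))) \<longlongrightarrow> ln (norm z0)) F"
    using z0 by (intro tendsto_intros lim_snd) auto
  have lim_lo: "(\<lambda>n. ln (lo n) / real n) \<longlonglongrightarrow> 0"
    unfolding lo_def ml_gap_def using A \<rho> by real_asymp
  have err: "((\<lambda>p. \<bar>ln (norm (snd p))\<bar> / real (fst p) + (\<bar>ln (lo (fst p)) / real (fst p)\<bar> + \<bar>ln (2 / A)\<bar> / real (fst p)))
      \<longlongrightarrow> 0 + (\<bar>0\<bar> + 0)) F"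
    unfolding F_def
    by (intro tendsto_add tendsto_rabs filterlim_fst_snd_seq(1)[OF lim_lo])
       (rule real_tendsto_divide_at_top[OF tendsto_rabs[OF lim_ln[unfolded F_def]] ntop[unfolded F_def]]
             real_tendsto_divide_at_top[OF tendsto_const ntop[unfolded F_def]])+
  have "((\<lambda>p. ln (norm (ml_part \<rho> (fst p) (snd p))) / real (fst p) - (ln (m (fst p)) / real (fst p) + ln (norm (snd p)))) \<longlongrightarrow> 0) F"
    by (rule Lim_null_comparison[OF _ err[simplified]]) (use main in \<open>auto elim: eventually_mono\<close>)
  moreover have "((\<lambda>p. ln (m (fst p)) / real (fst p) + ln (norm (snd p))) \<longlongrightarrow> 1 / \<rho> + ln (norm z0)) F"
    using lim_ln unfolding F_def m_def
    by (intro tendsto_add filterlim_fst_snd_seq(1)[OF tendsto_ln_ml_max_term[OF \<rho>]])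
  ultimately have "((\<lambda>p. (ln (norm (ml_part \<rho> (fst p) (snd p))) / real (fst p) - (ln (m (fst p)) / real (fst p) + ln (norm (snd p))))
      + (ln (m (fst p)) / real (fst p) + ln (norm (snd p)))) \<longlongrightarrow> 0 + (1 / \<rho> + ln (norm z0))) F"
    by (rule tendsto_add)
  thus "((\<lambda>p. ln (norm (ml_part \<rho> (fst p) (snd p))) / real (fst p)) \<longlongrightarrow> ln (norm z0) + 1/\<rho>) F"
    by (simp add: add.commute)
qed

section \<open>The critical rays and the curve in terms of growth rates\<close>

lemma critical_rays_iff:
  assumes \<rho>: "\<rho> > 1"
  shows "z \<in> critical_rays \<rho> \<longleftrightarrow> Re z = norm z * cos (pi / (2 * \<rho>))"
proof
  assume "z \<in> critical_rays \<rho>"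
  from this[unfolded critical_rays_def mem_Collect_eq]
  obtain r \<theta> where z: "z = of_real r * cis \<theta>" and r: "r \<ge> 0"
    and \<theta>: "\<theta> = pi / (2 * \<rho>) \<or> \<theta> = - (pi / (2 * \<rho>))"
    by (elim exE conjE)
  have c: "cos \<theta> = cos (pi / (2 * \<rho>))" using \<theta> by (elim disjE) simp_all
  show "Re z = norm z * cos (pi / (2 * \<rho>))" unfolding z using r c by (simp add: norm_mult)
next
  assume *: "Re z = norm z * cos (pi / (2 * \<rho>))"
  define \<beta> where "\<beta> = pi / (2 * \<rho>)"
  have \<beta>: "0 < \<beta>" "\<beta> < pi / 2" using half_angle_bounds[OF \<rho>] by (auto simp: \<beta>_def)
  show "z \<in> critical_rays \<rho>"
  proof (cases "z = 0")
    case True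
    thus ?thesis unfolding critical_rays_def
      by (intro CollectI exI[of _ 0] exI[of _ "pi / (2 * \<rho>)"]) simp
  next
    case False
    have "cos \<bar>Arg z\<bar> = cos (Arg z)" by (simp add: abs_if)
    hence "norm z * cos \<bar>Arg z\<bar> = norm z * cos \<beta>" unfolding \<beta>_def *[symmetric] using norm_mult_cos_Arg[of z] by simp
    hence "cos \<bar>Arg z\<bar> = cos \<beta>" using False by simp
    moreover have "\<bar>Arg z\<bar> \<le> pi" using Arg_bounded[of z] by linarith
    ultimately have Ar: "\<bar>Arg z\<bar> = \<beta>" using \<beta> cos_inj_pi[of "\<bar>Arg z\<bar>" \<beta>] by linarith
    have "x = c \<or> x = - c" if "\<bar>x\<bar> = c" for x c :: real using that by linarith
    from this[OF Ar] have "Arg z = pi / (2 * \<rho>) \<or> Arg z = - (pi / (2 * \<rho>))" unfolding \<beta>_def .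
    moreover have "z = of_real (norm z) * cis (Arg z)" using rcis_cmod_Arg[of z] by (simp add: rcis_def)
    ultimately show ?thesis unfolding critical_rays_def
      by (intro CollectI exI[of _ "norm z"] exI[of _ "Arg z"] conjI norm_ge_zero)
  qed
qed

text \<open>Inside the sector the defining equation divided by \<rho> is the equality of rates;
  outside, \<open>\<sigma> = exp (- 1 / \<rho>)\<close> says ln \<sigma> + 1/\<rho> = 0. Off the
  critical rays the angle range of the curve splits into two open sectors, which match the two cases
  of \<open>ml_growth\<close>.\<close>

lemma szego_curve_iff:
  assumes \<rho>: "\<rho> > 1" and z: "z \<notin> critical_rays \<rho>"
  shows "z \<in> szego_curve \<rho> \<longleftrightarrow> ln (norm z) + 1/\<rho> = ml_growth \<rho> z"
proof -
  define \<beta> where "\<beta> = pi / (2 * \<rho>)"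
  have \<beta>: "0 < \<beta>" "\<beta> < pi / 2" using half_angle_bounds[OF \<rho>] by (auto simp: \<beta>_def)
  have z0: "z \<noteq> 0" using z critical_rays_iff[OF \<rho>, of z] by auto
  have re: "Re z \<noteq> norm z * cos \<beta>" using z critical_rays_iff[OF \<rho>] by (simp add: \<beta>_def)
  show ?thesis
  proof
    assume "z \<in> szego_curve \<rho>"
    then obtain \<sigma> \<phi> where s: "z = of_real \<sigma> * cis \<phi>" "\<sigma> > 0" "- \<beta> \<le> \<phi>" "\<phi> < 2 * pi - \<beta>"
      "\<phi> \<le> \<beta> \<Longrightarrow> \<sigma> powr \<rho> * cos (\<phi> * \<rho>) - 1 - \<rho> * ln \<sigma> = 0"
      "\<beta> < \<phi> \<Longrightarrow> \<sigma> = exp (- 1 / \<rho>)"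
      unfolding szego_curve_def \<beta>_def by auto
    have nz: "norm z = \<sigma>" using s by (simp add: norm_mult)
    have rz: "Re z = \<sigma> * cos \<phi>" using s by simp
    show "ln (norm z) + 1/\<rho> = ml_growth \<rho> z"
    proof (cases "\<phi> \<le> \<beta>")
      case True
      have "\<phi> \<noteq> \<beta>" "\<phi> \<noteq> - \<beta>" using re s(2) unfolding nz rz by auto
      hence ph: "\<bar>\<phi>\<bar> < \<beta>" using True s by auto
      have Ar: "Arg z = \<phi>" unfolding s(1) using ph \<beta> s(2) by (subst Arg_rcis[unfolded rcis_def]) auto
      have "cos \<beta> < cos \<bar>\<phi>\<bar>" using ph \<beta> by (intro cos_monotone_0_pi) auto
      hence "norm z * cos \<beta> < Re z" unfolding nz rz using s(2) by simp
      hence "ml_growth \<rho> z = \<sigma> powr \<rho> * cos (\<phi> * \<rho>) / \<rho>"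
        unfolding ml_growth_def \<beta>_def[symmetric] by (simp add: nz Ar mult.commute)
      also have "\<dots> = (1 + \<rho> * ln \<sigma>) / \<rho>" using s(5)[OF True] by simp
      also have "\<dots> = ln (norm z) + 1/\<rho>" using \<rho> by (simp add: nz field_simps)
      finally show ?thesis by simp
    next
      case False
      have "cos \<phi> < cos \<beta>"
      proof (cases "\<phi> \<le> pi")
        case True
        thus ?thesis using False \<beta> by (intro cos_monotone_0_pi) auto
      next
        case F: False
        have "cos (2 * pi - \<phi>) < cos \<beta>" using F s \<beta> by (intro cos_monotone_0_pi) auto
        thus ?thesis by (simp add: cos_diff)
      qed
      hence "\<not> norm z * cos \<beta> < Re z" unfolding nz rz using s(2) by simp
      hence "ml_growth \<rho> z = 0" by (simp add: ml_growth_def \<beta>_def)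
      thus ?thesis using s(6) False by (simp add: nz)
    qed
  next
    assume eq: "ln (norm z) + 1/\<rho> = ml_growth \<rho> z"
    show "z \<in> szego_curve \<rho>"
    proof (cases "norm z * cos \<beta> < Re z")
      case True
      have Ar: "\<bar>Arg z\<bar> < \<beta>" using inside_sector_iff_Arg[of z \<beta>] z0 \<beta> True by auto
      have "ln (norm z) + 1/\<rho> = norm z powr \<rho> * cos (\<rho> * Arg z) / \<rho>"
        using True eq by (simp add: ml_growth_def \<beta>_def)
      hence eq': "norm z powr \<rho> * cos (Arg z * \<rho>) - 1 - \<rho> * ln (norm z) = 0"
        using \<rho> by (simp add: field_simps)
      have "z = of_real (norm z) * cis (Arg z)" using rcis_cmod_Arg[of z] by (simp add: rcis_def)
      thus ?thesis unfolding szego_curve_def \<beta>_def[symmetric]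
        by (intro CollectI exI[of _ "norm z"] exI[of _ "Arg z"] conjI) (use Ar \<beta> z0 eq' in auto)
    next
      case False
      hence A2: "\<beta> < Arg2pi z" "Arg2pi z < 2 * pi - \<beta>"
        using outside_sector_iff_Arg2pi[of z \<beta>] z0 \<beta> re by auto
      have "ln (norm z) = - 1 / \<rho>" using eq False by (simp add: ml_growth_def \<beta>_def)
      hence nz: "norm z = exp (- 1 / \<rho>)" using z0 by (metis exp_ln zero_less_norm_iff)
      have "z = of_real (norm z) * cis (Arg2pi z)" using rcis_Arg2pi[of z] by (simp add: rcis_def)
      thus ?thesis unfolding szego_curve_def \<beta>_def[symmetric]
        by (intro CollectI exI[of _ "norm z"] exI[of _ "Arg2pi z"] conjI) (use A2 \<beta> z0 nz in auto)
    qed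
  qed
qed

section \<open>Limits of roots\<close>

lemma ml_section_plus_tail:
  assumes "\<rho> \<ge> 1"
  shows "ml_section \<rho> n w + ml_tail \<rho> (n + 1) w = mittag_leffler \<rho> w"
proof -
  have sm: "summable (\<lambda>k. of_real (ml_coeff \<rho> k) * w ^ k)"
    by (rule summable_norm_cancel[OF summable_norm_ml[OF assms]])
  show ?thesis
    unfolding ml_section_def ml_tail_def mittag_leffler_def suminf_split_initial_segment[OF sm, of "n + 1"]
    by (simp add: add_ac lessThan_Suc_atMost del: lessThan_Suc sum.lessThan_Suc)
qed

lemma holomorphic_mittag_leffler:
  assumes "\<rho> \<ge> 1"
  shows "mittag_leffler \<rho> holomorphic_on A"
proof -
  have "mittag_leffler \<rho> holomorphic_on ball 0 r" if "r > 0" for r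
  proof (rule power_series_holomorphic)
    fix w assume "w \<in> ball (0::complex) r"
    show "(\<lambda>n. of_real (ml_coeff \<rho> n) * (w - 0) ^ n) sums mittag_leffler \<rho> w"
      using sums_mittag_leffler[OF assms] by simp
  qed
  hence "mittag_leffler \<rho> field_differentiable at z" for z
    by (rule holomorphic_on_imp_differentiable_at[of _ "ball 0 (norm z + 1)"]) (auto intro: add_nonneg_pos)
  thus ?thesis unfolding holomorphic_on_def by (blast intro: field_differentiable_at_within)
qed

lemma ml_section_holomorphic: "(\<lambda>z. ml_section \<rho> n (of_real c * z)) holomorphic_on A"
  unfolding ml_section_def by (intro holomorphic_intros)

lemma ml_tail_holomorphic:
  assumes "\<rho> \<ge> 1"
  shows "(\<lambda>z. ml_tail \<rho> (n + 1) (of_real c * z)) holomorphic_on A"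
proof -
  have eq: "(\<lambda>z. ml_tail \<rho> (n + 1) (of_real c * z)) =
     (\<lambda>z. (mittag_leffler \<rho> \<circ> (\<lambda>z. of_real c * z)) z - ml_section \<rho> n (of_real c * z))"
    using ml_section_plus_tail[OF assms, of n] by (auto simp: fun_eq_iff algebra_simps)
  show ?thesis unfolding eq
    by (intro holomorphic_intros ml_section_holomorphic holomorphic_on_compose holomorphic_mittag_leffler assms)
qed

lemma ml_roots_iff:
  assumes "\<rho> \<ge> 1"
  shows "z \<in> ml_roots \<rho> lam n \<longleftrightarrow>
    ml_part \<rho> n z = (if norm z \<le> 1 then 1 - lam else lam) * mittag_leffler \<rho> (of_real (ml_radius \<rho> n) * z)"
  unfolding ml_roots_def ml_part_def ml_section_plus_tail[OF assms, of n, symmetric]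
  by (auto simp: algebra_simps)

text \<open>For fixed n the roots are the zeros of an entire function with value 1 - lam at 0, hence
  isolated. Finitely many n may therefore be discarded when accumulation points of the union are
  studied.\<close>

lemma not_islimpt_ml_roots:
  assumes \<rho>: "\<rho> \<ge> 1" and lam: "lam \<noteq> 1"
  shows "\<not> z0 islimpt ml_roots \<rho> lam n"
proof
  assume lim: "z0 islimpt ml_roots \<rho> lam n"
  define f where "f = (\<lambda>z. (1 - lam) * ml_section \<rho> n (of_real (ml_radius \<rho> n) * z)
         - lam * ml_tail \<rho> (n + 1) (of_real (ml_radius \<rho> n) * z))"
  have "f holomorphic_on UNIV"
    unfolding f_def by (intro holomorphic_intros ml_section_holomorphic ml_tail_holomorphic \<rho>)
  hence "f 0 = 0"
    by (rule analytic_continuation[where U = "ml_roots \<rho> lam n" and \<xi> = z0])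
       (use lim in \<open>auto simp: f_def ml_roots_def\<close>)
  moreover have "f 0 = 1 - lam"
  proof -
    have "ml_section \<rho> n 0 = 1"
      unfolding ml_section_def by (simp add: sum.atMost_shift ml_coeff_def)
    moreover have "ml_tail \<rho> (n + 1) 0 = 0" by (simp add: ml_tail_def)
    ultimately show ?thesis by (simp add: f_def)
  qed
  ultimately show False using lam by simp
qed

lemma ml_growth_limit:
  assumes \<rho>: "\<rho> > 1" and z0: "z0 \<notin> critical_rays \<rho>"
  defines "F \<equiv> sequentially \<times>\<^sub>F nhds z0"
  shows "((\<lambda>p. ln (norm (mittag_leffler \<rho> (of_real (ml_radius \<rho> (fst p)) * snd p))) / real (fst p))
           \<longlongrightarrow> ml_growth \<rho> z0) F"
    and "\<forall>\<^sub>F p in F. mittag_leffler \<rho> (of_real (ml_radius \<rho> (fst p)) * snd p) \<noteq> 0"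
proof -
  have "Re z0 \<noteq> norm z0 * cos (pi / (2 * \<rho>))" using z0 critical_rays_iff[OF \<rho>] by simp
  hence "norm z0 * cos (pi / (2 * \<rho>)) < Re z0 \<or> Re z0 < norm z0 * cos (pi / (2 * \<rho>))" by linarith
  thus "((\<lambda>p. ln (norm (mittag_leffler \<rho> (of_real (ml_radius \<rho> (fst p)) * snd p))) / real (fst p))
           \<longlongrightarrow> ml_growth \<rho> z0) F"
    and "\<forall>\<^sub>F p in F. mittag_leffler \<rho> (of_real (ml_radius \<rho> (fst p)) * snd p) \<noteq> 0"
    using ml_growth_inside[OF \<rho>, of z0] ml_growth_outside[OF \<rho>, of z0] unfolding F_def by blast+
qed

lemma ln_ratio_limit:
  assumes \<rho>: "\<rho> > 1" and z0: "z0 \<notin> critical_rays \<rho>" "z0 \<noteq> 1"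
  defines "F \<equiv> sequentially \<times>\<^sub>F nhds z0"
  defines "h \<equiv> \<lambda>p. ml_part \<rho> (fst p) (snd p) / mittag_leffler \<rho> (of_real (ml_radius \<rho> (fst p)) * snd p)"
  shows "((\<lambda>p. ln (norm (h p)) / real (fst p)) \<longlongrightarrow> ln (norm z0) + 1/\<rho> - ml_growth \<rho> z0) F"
    and "\<forall>\<^sub>F p in F. ml_part \<rho> (fst p) (snd p) \<noteq> 0 \<and> mittag_leffler \<rho> (of_real (ml_radius \<rho> (fst p)) * snd p) \<noteq> 0"
proof -
  have nz: "z0 \<noteq> 0" using z0 critical_rays_iff[OF \<rho>, of z0] by auto
  note T = ml_part_growth[OF less_imp_le[OF \<rho>] nz z0(2), folded F_def]
  note E = ml_growth_limit[OF \<rho> z0(1), folded F_def]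
  show ev: "\<forall>\<^sub>F p in F. ml_part \<rho> (fst p) (snd p) \<noteq> 0 \<and> mittag_leffler \<rho> (of_real (ml_radius \<rho> (fst p)) * snd p) \<noteq> 0"
    using T(2) E(2) by eventually_elim simp
  show "((\<lambda>p. ln (norm (h p)) / real (fst p)) \<longlongrightarrow> ln (norm z0) + 1/\<rho> - ml_growth \<rho> z0) F"
  proof (rule Lim_transform_eventually[OF tendsto_diff[OF T(1) E(1)]])
    show "\<forall>\<^sub>F p in F. ln (norm (ml_part \<rho> (fst p) (snd p))) / real (fst p) -
        ln (norm (mittag_leffler \<rho> (of_real (ml_radius \<rho> (fst p)) * snd p))) / real (fst p) = ln (norm (h p)) / real (fst p)"
      using ev by eventually_elim (simp add: h_def norm_divide ln_divide_pos diff_divide_distrib)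
  qed
qed

lemma filterlim_Pair_nhds: "filterlim (\<lambda>n. (n, w)) (sequentially \<times>\<^sub>F nhds w) sequentially"
  by (intro filterlim_Pair filterlim_ident tendsto_const)

text \<open>Off the curve |ln |h|| grows linearly in n, uniformly near z0, whereas a root fixes h to
  be 1 - lam or lam, both nonzero. So a neighbourhood of z0 is free of roots for all large
  n.\<close>

lemma root_limit_imp_on_curve:
  assumes \<rho>: "\<rho> > 1" and lam: "lam \<noteq> 0" "lam \<noteq> 1"
    and z0: "z0 \<notin> critical_rays \<rho>" "z0 \<in> ml_root_limits \<rho> lam"
  shows "z0 \<in> szego_curve \<rho>"
proof (rule ccontr)
  assume notin: "z0 \<notin> szego_curve \<rho>"
  have \<beta>: "0 < pi / (2 * \<rho>)" "pi / (2 * \<rho>) < pi / 2" using half_angle_bounds[OF \<rho>] by auto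
  define d where "d = ln (norm z0) + 1/\<rho> - ml_growth \<rho> z0"
  have d: "d \<noteq> 0" using szego_curve_iff[OF \<rho> z0(1)] notin by (simp add: d_def)
  have ne1: "z0 \<noteq> 1"
  proof
    assume "z0 = 1"
    moreover have "cos (pi / (2 * \<rho>)) < cos 0" using \<beta> by (intro cos_monotone_0_pi) auto
    ultimately have "d = 0" by (simp add: d_def ml_growth_def)
    with d show False by simp
  qed
  define F where "F = sequentially \<times>\<^sub>F nhds z0"
  define h where "h = (\<lambda>p. ml_part \<rho> (fst p) (snd p) / mittag_leffler \<rho> (of_real (ml_radius \<rho> (fst p)) * snd p))"
  have L: "((\<lambda>p. ln (norm (h p)) / real (fst p)) \<longlongrightarrow> d) F"
    "\<forall>\<^sub>F p in F. ml_part \<rho> (fst p) (snd p) \<noteq> 0 \<and> mittag_leffler \<rho> (of_real (ml_radius \<rho> (fst p)) * snd p) \<noteq> 0"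
    unfolding h_def d_def F_def by (rule ln_ratio_limit[OF \<rho> z0(1) ne1])+
  define M where "M = \<bar>ln (norm (1 - lam))\<bar> + \<bar>ln (norm lam)\<bar>"
  have ntop: "filterlim (\<lambda>p. real (fst p)) at_top F"
    unfolding F_def by (intro filterlim_fst_snd_seq filterlim_real_sequentially)
  have "((\<lambda>p. \<bar>ln (norm (h p)) / real (fst p)\<bar> - M / real (fst p)) \<longlongrightarrow> \<bar>d\<bar> - 0) F"
    by (intro tendsto_diff tendsto_rabs L(1) real_tendsto_divide_at_top[OF tendsto_const ntop])
  hence "\<forall>\<^sub>F p in F. \<bar>ln (norm (h p)) / real (fst p)\<bar> - M / real (fst p) > 0"
    by (rule order_tendstoD) (use d in simp)
  hence "\<forall>\<^sub>F p in F. snd p \<notin> ml_roots \<rho> lam (fst p)"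
    using L(2)
  proof eventually_elim
    case (elim p)
    show ?case
    proof
      assume "snd p \<in> ml_roots \<rho> lam (fst p)"
      hence "h p = (if norm (snd p) \<le> 1 then 1 - lam else lam)"
        using elim \<rho> by (subst (asm) ml_roots_iff) (auto simp: h_def)
      hence "\<bar>ln (norm (h p))\<bar> \<le> M" by (auto simp: M_def)
      hence "\<bar>ln (norm (h p)) / real (fst p)\<bar> \<le> M / real (fst p)"
        by (simp add: abs_divide divide_right_mono)
      with elim show False by simp
    qed
  qed
  then obtain P Q where P: "eventually P sequentially" and Q: "eventually Q (nhds z0)"
    and PQ: "\<And>n z. P n \<Longrightarrow> Q z \<Longrightarrow> z \<notin> ml_roots \<rho> lam n"
    unfolding F_def eventually_prod_filter fst_conv snd_conv by blast
  obtain N where N: "\<And>n. n \<ge> N \<Longrightarrow> P n" using P by (auto simp: eventually_sequentially)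
  obtain U where U: "open U" "z0 \<in> U" "\<And>z. z \<in> U \<Longrightarrow> Q z" using Q by (auto simp: eventually_nhds)
  have "(\<Union>n\<in>{1..}. ml_roots \<rho> lam n) \<subseteq> (\<Union>n\<in>{..<N}. ml_roots \<rho> lam n) \<union> - U"
  proof
    fix z assume "z \<in> (\<Union>n\<in>{1..}. ml_roots \<rho> lam n)"
    then obtain n where n: "z \<in> ml_roots \<rho> lam n" by blast
    show "z \<in> (\<Union>n\<in>{..<N}. ml_roots \<rho> lam n) \<union> - U"
    proof (cases "n < N")
      case True
      thus ?thesis using n by blast
    next
      case False
      hence "z \<notin> U" using PQ[OF N U(3), of n z] n by (auto simp: not_less)
      thus ?thesis by blast
    qed
  qed
  moreover have "z0 islimpt (\<Union>n\<in>{1..}. ml_roots \<rho> lam n)" using z0(2) by (simp add: ml_root_limits_def)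
  ultimately have "z0 islimpt ((\<Union>n\<in>{..<N}. ml_roots \<rho> lam n) \<union> - U)"
    by (rule islimpt_subset[rotated])
  hence "z0 islimpt (\<Union>n\<in>{..<N}. ml_roots \<rho> lam n) \<or> z0 islimpt (- U)" by (simp add: islimpt_Un)
  moreover have "\<not> z0 islimpt (- U)" using U(1,2) unfolding islimpt_def by blast
  moreover have "\<not> z0 islimpt (\<Union>n\<in>{..<k}. ml_roots \<rho> lam n)" for k
    by (induction k) (use not_islimpt_ml_roots[of \<rho> lam] \<rho> lam in \<open>auto simp: lessThan_Suc islimpt_Un\<close>)
  ultimately show False by blast
qed

text \<open>Along the ray through \<open>z0\<close> the difference of the two growth rates has radial derivative \<open>- \<rho> * ln (norm z0)\<close>
  at \<open>z0\<close>.\<close>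

lemma sign_change_across_curve:
  assumes \<rho>: "\<rho> > 1" and z0: "z0 \<noteq> 0" "norm z0 \<noteq> 1"
    and eq: "ln (norm z0) + 1/\<rho> = ml_growth \<rho> z0" and e: "e > 0"
  obtains w w' where "dist w z0 < e" "w \<noteq> z0" "ln (norm w) + 1/\<rho> < ml_growth \<rho> w"
    "dist w' z0 < e" "w' \<noteq> z0" "ln (norm w') + 1/\<rho> > ml_growth \<rho> w'"
proof -
  define D where "D = (\<lambda>s. ln (norm (of_real s * z0)) + 1/\<rho> - ml_growth \<rho> (of_real s * z0))"
  define q where "q = ml_growth \<rho> z0"
  \<comment> \<open>Homogeneity reduces the question to the explicit function g of the scaling
    factor s alone.\<close>
  have hom: "ml_growth \<rho> (of_real s * z0) = s powr \<rho> * q" if "s > 0" for s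
    using that by (auto simp: ml_growth_def q_def norm_mult powr_mult mult.assoc)
  have D: "D s = ln s + q - s powr \<rho> * q" if "s > 0" for s
    using that z0 eq by (simp add: D_def hom norm_mult ln_mult_pos q_def)
  define g where "g = (\<lambda>s. ln s + q - s powr \<rho> * q)"
  have "(g has_real_derivative (1 - \<rho> * q)) (at 1)"
    unfolding g_def by (auto intro!: derivative_eq_intros)
  moreover have "1 - \<rho> * q = - \<rho> * ln (norm z0)"
    using eq \<rho> by (simp add: q_def[symmetric] field_simps)
  ultimately have der: "(g has_real_derivative (- \<rho> * ln (norm z0))) (at 1)" by simp
  have g1: "g 1 = 0" by (simp add: g_def)
  have ln0: "ln (norm z0) \<noteq> 0" using z0 by simp
  have "\<exists>\<delta>>0. \<forall>t>0. t < \<delta> \<longrightarrow> (g (1 + t) < 0 \<and> g (1 - t) > 0) \<or> (g (1 + t) > 0 \<and> g (1 - t) < 0)"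
  proof (cases "- \<rho> * ln (norm z0) > 0")
    case True
    obtain d1 where d1: "d1 > 0" "\<And>t. t > 0 \<Longrightarrow> t < d1 \<Longrightarrow> g 1 < g (1 + t)"
      using DERIV_pos_inc_right[OF der True] by blast
    obtain d2 where d2: "d2 > 0" "\<And>t. t > 0 \<Longrightarrow> t < d2 \<Longrightarrow> g (1 - t) < g 1"
      using DERIV_pos_inc_left[OF der True] by blast
    show ?thesis using d1 d2 g1 by (intro exI[of _ "min d1 d2"]) auto
  next
    case False
    moreover have "- \<rho> * ln (norm z0) \<noteq> 0" using ln0 \<rho> by simp
    ultimately have neg: "- \<rho> * ln (norm z0) < 0" by linarith
    obtain d1 where d1: "d1 > 0" "\<And>t. t > 0 \<Longrightarrow> t < d1 \<Longrightarrow> g 1 > g (1 + t)"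
      using DERIV_neg_dec_right[OF der neg] by blast
    obtain d2 where d2: "d2 > 0" "\<And>t. t > 0 \<Longrightarrow> t < d2 \<Longrightarrow> g (1 - t) > g 1"
      using DERIV_neg_dec_left[OF der neg] by blast
    show ?thesis using d1 d2 g1 by (intro exI[of _ "min d1 d2"]) auto
  qed
  then obtain \<delta> where \<delta>: "\<delta> > 0"
    "\<And>t. t > 0 \<Longrightarrow> t < \<delta> \<Longrightarrow> (g (1 + t) < 0 \<and> g (1 - t) > 0) \<or> (g (1 + t) > 0 \<and> g (1 - t) < 0)" by blast
  define t where "t = min (\<delta> / 2) (min (1/2) (e / (2 * norm z0)))"
  have t: "t > 0" "t < \<delta>" "t < 1" "t * norm z0 < e"
  proof -
    show "t > 0" "t < \<delta>" "t < 1" using \<delta>(1) e z0 by (auto simp: t_def)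
    have "t * norm z0 \<le> e / (2 * norm z0) * norm z0" by (intro mult_right_mono) (auto simp: t_def)
    also have "\<dots> < e" using e z0 by simp
    finally show "t * norm z0 < e" .
  qed
  have dist: "dist (of_real (1 + s) * z0) z0 < e" "of_real (1 + s) * z0 \<noteq> z0" if "\<bar>s\<bar> = t" for s
  proof -
    have "of_real (1 + s) * z0 - z0 = of_real s * z0" by (simp add: algebra_simps)
    hence "dist (of_real (1 + s) * z0) z0 = t * norm z0"
      unfolding dist_norm by (simp only: norm_mult norm_of_real that)
    thus "dist (of_real (1 + s) * z0) z0 < e" using t by simp
    show "of_real (1 + s) * z0 \<noteq> z0" using that t z0 by auto
  qed
  have gD: "g (1 + s) = D (1 + s)" if "\<bar>s\<bar> = t" for s
    using D[of "1 + s"] that t by (auto simp: g_def)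
  have "\<exists>s s'. \<bar>s\<bar> = t \<and> \<bar>s'\<bar> = t \<and> g (1 + s) < 0 \<and> g (1 + s') > 0"
    using \<delta>(2)[OF t(1,2)]
  proof
    assume "g (1 + t) < 0 \<and> 0 < g (1 - t)"
    thus ?thesis using t by (intro exI[of _ t] exI[of _ "- t"]) auto
  next
    assume "0 < g (1 + t) \<and> g (1 - t) < 0"
    thus ?thesis using t by (intro exI[of _ "- t"] exI[of _ t]) auto
  qed
  then obtain s s' where s: "\<bar>s\<bar> = t" "\<bar>s'\<bar> = t" "g (1 + s) < 0" "g (1 + s') > 0" by blast
  show ?thesis
    by (rule that[of "of_real (1 + s) * z0" "of_real (1 + s') * z0"])
       (use s gD[of s] gD[of s'] dist[of s] dist[of s'] in \<open>auto simp: D_def\<close>)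
qed

text \<open>With |z| = 1 the equation becomes cos (\<rho> Arg z) = 1 inside the sector and 1/\<rho>
  = 0 outside. The conclusion serves twice: the radial derivative of the rate difference is nonzero,
  and \<open>ml_part\<close> keeps one form near z0.\<close>

lemma curve_point_norm_ne_1:
  assumes \<rho>: "\<rho> > 1" and z0: "z0 \<notin> critical_rays \<rho>" "z0 \<in> szego_curve \<rho>" "z0 \<noteq> 1"
  shows "norm z0 \<noteq> 1"
proof
  assume n1: "norm z0 = 1"
  define \<beta> where "\<beta> = pi / (2 * \<rho>)"
  have \<beta>: "0 < \<beta>" "\<beta> < pi / 2" using half_angle_bounds[OF \<rho>] by (auto simp: \<beta>_def)
  have eq: "1 / \<rho> = ml_growth \<rho> z0" using szego_curve_iff[OF \<rho> z0(1)] z0(2) n1 by simp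
  have ins: "norm z0 * cos \<beta> < Re z0"
  proof (rule ccontr)
    assume "\<not> norm z0 * cos \<beta> < Re z0"
    hence "ml_growth \<rho> z0 = 0" unfolding ml_growth_def \<beta>_def by (rule if_not_P)
    thus False using eq \<rho> by simp
  qed
  have nz: "z0 \<noteq> 0" using n1 by auto
  have "\<beta> < pi" using \<beta> pi_gt_zero by linarith
  hence Ar: "\<bar>Arg z0\<bar> < \<beta>" using inside_sector_iff_Arg[OF nz \<beta>(1)] ins by blast
  have "ml_growth \<rho> z0 = cos (\<rho> * Arg z0) / \<rho>"
    using ins unfolding ml_growth_def \<beta>_def[symmetric] by (simp add: n1)
  hence "cos (\<rho> * Arg z0) = 1" using eq \<rho> by simp
  hence c0: "cos \<bar>\<rho> * Arg z0\<bar> = cos 0" by (simp add: abs_if)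
  have "\<bar>\<rho> * Arg z0\<bar> < pi / 2"
  proof -
    have "\<rho> * \<bar>Arg z0\<bar> < \<rho> * \<beta>" using Ar \<rho> by simp
    also have "\<rho> * \<beta> = pi / 2" using \<rho> by (simp add: \<beta>_def)
    finally show ?thesis using \<rho> by (simp add: abs_mult)
  qed
  hence "\<bar>\<rho> * Arg z0\<bar> \<le> pi" using pi_gt_zero by linarith
  hence "\<bar>\<rho> * Arg z0\<bar> = 0" by (rule cos_inj_pi[OF abs_ge_zero _ order_refl pi_ge_zero c0])
  hence "Arg z0 = 0" using \<rho> by simp
  hence "rcis (norm z0) (Arg z0) = 1" using n1 by (simp add: rcis_def)
  hence "z0 = 1" by (simp only: rcis_cmod_Arg)
  with z0 show False by simp
qed

text \<open>The quotients \<open>h\<close> omit the values 0 and 1 on a punctured disc without roots, tend to 0 at \<open>w\<close> and to infinity at \<open>w'\<close>;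
  this contradicts Schottky's theorem.\<close>

lemma on_curve_imp_root_limit:
  assumes \<rho>: "\<rho> > 1" and lam: "lam \<noteq> 0" "lam \<noteq> 1"
    and z0: "z0 \<notin> critical_rays \<rho>" "z0 \<in> szego_curve \<rho>" "z0 \<noteq> 1"
  shows "z0 \<in> ml_root_limits \<rho> lam"
proof (rule ccontr)
  assume notin: "z0 \<notin> ml_root_limits \<rho> lam"
  have nn: "norm z0 \<noteq> 1" by (rule curve_point_norm_ne_1[OF \<rho> z0])
  have nz: "z0 \<noteq> 0" using z0 critical_rays_iff[OF \<rho>, of z0] by auto
  define EE where "EE = (\<lambda>n z. mittag_leffler \<rho> (of_real (ml_radius \<rho> n) * z))"
  define c where "c = (if norm z0 \<le> 1 then 1 - lam else lam)"
  have c0: "c \<noteq> 0" using lam by (simp add: c_def)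
  obtain T where T: "open T" "z0 \<in> T" "\<And>n z. n \<ge> 1 \<Longrightarrow> z \<in> ml_roots \<rho> lam n \<Longrightarrow> z \<in> T \<Longrightarrow> z = z0"
    using notin unfolding ml_root_limits_def islimpt_def by fastforce
  obtain P Q where P: "eventually P sequentially" and Q: "eventually Q (nhds z0)"
    and PQ: "\<And>n z. P n \<Longrightarrow> Q z \<Longrightarrow> ml_part \<rho> n z \<noteq> 0 \<and> EE n z \<noteq> 0"
    using ln_ratio_limit(2)[OF \<rho> z0(1,3)] unfolding eventually_prod_filter EE_def fst_conv snd_conv by blast
  obtain N where N: "\<And>n. n \<ge> N \<Longrightarrow> P n" using P by (auto simp: eventually_sequentially)
  obtain U where U: "open U" "z0 \<in> U" "\<And>z. z \<in> U \<Longrightarrow> Q z" using Q by (auto simp: eventually_nhds)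
  \<comment> \<open>On W the rate limits apply, \<open>ml_part\<close> is a single holomorphic
    function, and the constant in the root equation is always c.\<close>
  define W where "W = {z. Re z \<noteq> norm z * cos (pi / (2 * \<rho>))} \<inter> {z. z \<noteq> 1} \<inter>
     (if norm z0 \<le> 1 then {z. norm z < 1} else {z. norm z > 1})"
  have oW: "open W" unfolding W_def
    by (intro open_Int open_Collect_neq) (auto intro!: continuous_intros open_Collect_less)
  have W0: "z0 \<in> W" using z0 nn critical_rays_iff[OF \<rho>, of z0] by (auto simp: W_def)
  have "open (T \<inter> U \<inter> W)" "z0 \<in> T \<inter> U \<inter> W" using T U oW W0 by auto
  then obtain e where e: "e > 0" "ball z0 e \<subseteq> T \<inter> U \<inter> W" by (meson open_contains_ball)
  \<comment> \<open>The centre is removed since it may itself be a root for many n without being an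
    accumulation point. The punctured disc is still connected.\<close>
  define V where "V = ball z0 e - {z0}"
  have VW: "V \<subseteq> T \<inter> U \<inter> W" using e by (auto simp: V_def)
  have Vc: "z \<in> V \<Longrightarrow> (if norm z \<le> 1 then 1 - lam else lam) = c" for z
    using VW by (auto simp: c_def W_def split: if_splits)
  obtain w w' where w: "dist w z0 < e" "w \<noteq> z0" "ln (norm w) + 1/\<rho> < ml_growth \<rho> w"
    and w': "dist w' z0 < e" "w' \<noteq> z0" "ln (norm w') + 1/\<rho> > ml_growth \<rho> w'"
    using sign_change_across_curve[OF \<rho> nz nn _ e(1)] szego_curve_iff[OF \<rho> z0(1)] z0(2) by blast
  have wV: "w \<in> V" "w' \<in> V" using w w' by (auto simp: V_def dist_commute)
  \<comment> \<open>Dividing by c as well makes the roots in V exactly the points where h takes the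
    value 1.\<close>
  define h where "h = (\<lambda>n z. ml_part \<rho> n z / (c * EE n z))"
  have conv: "(\<lambda>n. ln (norm (c * h n u)) / real n) \<longlonglongrightarrow> ln (norm u) + 1/\<rho> - ml_growth \<rho> u" if "u \<in> V" for u
  proof -
    have "u \<notin> critical_rays \<rho>" "u \<noteq> 1" using that VW critical_rays_iff[OF \<rho>] by (auto simp: W_def)
    from filterlim_compose[OF ln_ratio_limit(1)[OF \<rho> this] filterlim_Pair_nhds]
    show ?thesis using c0 by (simp add: h_def EE_def)
  qed
  have nzh: "h n u \<noteq> 0" if "u \<in> V" "n \<ge> N" for n u
    using PQ[OF N[OF that(2)] U(3)[of u]] that(1) VW c0 by (auto simp: h_def)
  have lowlim: "\<forall>\<^sub>F n in sequentially. norm (h n w) \<le> 1"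
  proof -
    define d where "d = ml_growth \<rho> w - (ln (norm w) + 1/\<rho>)"
    have d: "d > 0" using w by (simp add: d_def)
    have "\<forall>\<^sub>F n in sequentially. ln (norm (c * h n w)) / real n < - (d / 2)"
      by (rule order_tendstoD(2)[OF conv[OF wV(1)]]) (use d d_def in linarith)
    moreover have "\<forall>\<^sub>F n in sequentially. real n > 2 / d * \<bar>ln (norm c)\<bar>"
      using filterlim_real_sequentially unfolding filterlim_at_top_dense by blast
    ultimately show ?thesis using eventually_ge_at_top[of N] eventually_gt_at_top[of 0]
    proof eventually_elim
      case (elim n)
      have hp: "norm (h n w) > 0" using nzh[OF wV(1)] elim by simp
      have "ln (norm (c * h n w)) < - (d / 2) * real n" using elim by (simp add: field_simps)
      moreover have "ln (norm (c * h n w)) = ln (norm c) + ln (norm (h n w))"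
        using hp c0 by (simp add: norm_mult ln_mult_pos)
      moreover have "\<bar>ln (norm c)\<bar> < d / 2 * real n" using elim d by (simp add: field_simps)
      ultimately have "ln (norm (h n w)) < 0" by linarith
      thus ?case using hp by simp
    qed
  qed
  have hightop: "filterlim (\<lambda>n. norm (h n w')) at_top sequentially"
  proof -
    define d where "d = ln (norm w') + 1/\<rho> - ml_growth \<rho> w'"
    have d: "d > 0" using w' by (simp add: d_def)
    have "filterlim (\<lambda>n. ln (norm (c * h n w')) / real n * real n) at_top sequentially"
      by (rule filterlim_tendsto_pos_mult_at_top[OF conv[OF wV(2)]])
         (use d filterlim_real_sequentially in \<open>auto simp: d_def\<close>)
    hence "filterlim (\<lambda>n. exp (ln (norm (c * h n w')) / real n * real n)) at_top sequentially"
      by (rule filterlim_compose[OF exp_at_top])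
    moreover have "\<forall>\<^sub>F n in sequentially. exp (ln (norm (c * h n w')) / real n * real n) = norm c * norm (h n w')"
      using eventually_ge_at_top[of N] eventually_gt_at_top[of 0]
      by eventually_elim (use nzh[OF wV(2)] c0 in \<open>simp add: norm_mult\<close>)
    ultimately have "filterlim (\<lambda>n. norm c * norm (h n w')) at_top sequentially"
      using filterlim_cong[OF refl refl] by fast
    thus ?thesis
      by (subst (asm) filterlim_tendsto_pos_mult_at_top_iff[OF tendsto_const]) (use c0 in auto)
  qed
  obtain N' where N': "\<And>n. n \<ge> N' \<Longrightarrow> norm (h n w) \<le> 1"
    using lowlim by (auto simp: eventually_sequentially)
  define K where "K = Suc (max N N')"
  define Y where "Y = h ` {K..}"
  \<comment> \<open>\<open>GPicard3\<close> is the consequence of Schottky's theorem for families: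
    omitting 0 and 1 and being bounded by 1 at w, they are uniformly bounded on the compact set
    consisting of w'.\<close>
  obtain B where B: "\<And>g z. \<lbrakk>g \<in> Y; z \<in> {w'}\<rbrakk> \<Longrightarrow> norm (g z) \<le> B"
  proof (rule GPicard3[of V w Y Y "{w'}"])
    show "open V" by (simp add: V_def open_delete)
    show "connected V" unfolding V_def by (rule connected_open_delete) auto
    show "g holomorphic_on V" if g: "g \<in> Y" for g
    proof -
      obtain n where n: "g = h n" "n \<ge> K" using g by (auto simp: Y_def)
      have E: "EE n holomorphic_on V"
        using holomorphic_on_compose[OF _ holomorphic_mittag_leffler, of "\<lambda>z. of_real (ml_radius \<rho> n) * z" V \<rho>] \<rho>
        unfolding EE_def o_def by (auto intro!: holomorphic_intros)
      have part: "ml_part \<rho> n holomorphic_on V"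
      proof (cases "norm z0 \<le> 1")
        case True
        have "norm z \<le> 1" if "z \<in> V" for z using that VW True by (auto simp: W_def)
        thus ?thesis
          using \<rho> by (intro holomorphic_transform[OF ml_tail_holomorphic[of \<rho> n "ml_radius \<rho> n"]]) (auto simp: ml_part_def)
      next
        case False
        have "norm z > 1" if "z \<in> V" for z using that VW False by (auto simp: W_def)
        thus ?thesis
          by (intro holomorphic_transform[OF ml_section_holomorphic[of \<rho> n "ml_radius \<rho> n"]]) (force simp: ml_part_def)
      qed
      have nzE: "c * EE n z \<noteq> 0" if "z \<in> V" for z
        using PQ[OF N U(3)[of z]] that VW c0 n by (auto simp: K_def)
      show ?thesis unfolding n h_def
        by (intro holomorphic_on_divide part holomorphic_on_mult holomorphic_on_const E nzE)
    qed
    show "g z \<noteq> 0 \<and> g z \<noteq> 1" if g: "g \<in> Y" and z: "z \<in> V" for g z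
    proof -
      obtain n where n: "g = h n" "n \<ge> K" using g by (auto simp: Y_def)
      have "z \<notin> ml_roots \<rho> lam n" using T(3)[of n z] z VW n by (auto simp: V_def K_def)
      hence "ml_part \<rho> n z \<noteq> c * EE n z"
        using ml_roots_iff[of \<rho> z lam n] \<rho> Vc[OF z] by (simp add: EE_def)
      moreover have "EE n z \<noteq> 0" using PQ[OF N U(3)[of z]] z VW n by (auto simp: K_def)
      ultimately have "h n z \<noteq> 1" using c0 by (simp add: h_def)
      thus ?thesis using nzh[OF z] n by (simp add: K_def)
    qed
    show "norm (g w) \<le> 1" if "g \<in> Y" for g using that N' by (auto simp: Y_def K_def)
  qed (use wV in auto)
  have "\<forall>\<^sub>F n in sequentially. norm (h n w') > B"
    using hightop unfolding filterlim_at_top_dense by blast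
  moreover have "\<forall>\<^sub>F n in sequentially. n \<ge> K" by (rule eventually_ge_at_top)
  ultimately have "\<forall>\<^sub>F n::nat in sequentially. False"
    by eventually_elim (use B in \<open>force simp: Y_def\<close>)
  thus False by simp
qed

text \<open>The point 1 is a double point of the curve, where neither form of the root equation is under control; it is
  reached as a limit of other points of the curve.\<close>

lemma curve_accumulates_at_one:
  assumes \<rho>: "\<rho> > 1" and e: "e > 0"
  obtains z where "z \<in> szego_curve \<rho>" "z \<notin> critical_rays \<rho>" "z \<noteq> 1" "dist z 1 < e"
proof -
  define \<beta> where "\<beta> = pi / (2 * \<rho>)"
  have \<beta>: "0 < \<beta>" "\<beta> < pi / 2" using half_angle_bounds[OF \<rho>] by (auto simp: \<beta>_def)
  \<comment> \<open>For a small angle \<phi> > 0 a solution \<sigma> in [1, 1 + \<delta>] comes from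
    a sign change: at \<sigma> = 1 the value is cos (\<phi> \<rho>) - 1 \<le> 0, and at 1 + \<delta>
    it is positive for \<phi> = 0 because ln t < t - 1, hence for small \<phi> by continuity. With
    \<open>\<delta> = e / 4\<close> the distance to 1 is at most (\<sigma> - 1) + \<phi> < 2
    \<delta>.\<close>
  define g where "g = (\<lambda>\<sigma> \<phi>. \<sigma> powr \<rho> * cos (\<phi> * \<rho>) - 1 - \<rho> * ln \<sigma>)"
  define \<delta> where "\<delta> = e / 4"
  have \<delta>: "\<delta> > 0" using e by (simp add: \<delta>_def)
  define t where "t = (1 + \<delta>) powr \<rho>"
  have t: "t > 1" unfolding t_def using \<delta> \<rho> by simp
  have "ln t < t - 1" using t ln_le_minus_one[of t] ln_eq_minus_one[of t] by fastforce
  hence g0: "g (1 + \<delta>) 0 > 0" using \<delta> by (simp add: g_def t_def ln_powr)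
  have "isCont (g (1 + \<delta>)) 0" unfolding g_def by (intro continuous_intros)
  hence "(g (1 + \<delta>) \<longlongrightarrow> g (1 + \<delta>) 0) (at_right 0)"
    unfolding isCont_def by (rule tendsto_within_subset) simp
  hence "\<forall>\<^sub>F \<phi> in at_right 0. g (1 + \<delta>) \<phi> > 0" using g0 by (rule order_tendstoD)
  moreover have "\<forall>\<^sub>F \<phi> in at_right 0. \<phi> \<in> {0<..<min \<delta> \<beta>}"
    using \<delta> \<beta> by (intro eventually_at_right_real) auto
  ultimately have "\<forall>\<^sub>F \<phi> in at_right 0. g (1 + \<delta>) \<phi> > 0 \<and> \<phi> \<in> {0<..<min \<delta> \<beta>}"
    by (rule eventually_conj)
  then obtain \<phi> where ph: "g (1 + \<delta>) \<phi> > 0" "0 < \<phi>" "\<phi> < \<delta>" "\<phi> < \<beta>"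
    using eventually_happens' trivial_limit_at_right_real by fastforce
  have "\<phi> * \<rho> < \<beta> * \<rho>" using ph \<rho> by simp
  hence "\<phi> * \<rho> < pi / 2" using \<rho> by (simp add: \<beta>_def)
  hence "\<phi> * \<rho> \<le> pi" using pi_gt_zero by linarith
  hence "cos (\<phi> * \<rho>) < cos 0" using ph \<rho> by (intro cos_monotone_0_pi) auto
  hence g1: "g 1 \<phi> \<le> 0" by (simp add: g_def)
  have "\<exists>\<sigma>\<ge>1. \<sigma> \<le> 1 + \<delta> \<and> g \<sigma> \<phi> = 0"
    using g1 ph \<delta> by (intro IVT') (auto simp: g_def intro!: continuous_intros)
  then obtain \<sigma> where s: "\<sigma> \<ge> 1" "\<sigma> \<le> 1 + \<delta>" "g \<sigma> \<phi> = 0" by blast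
  define z where "z = of_real \<sigma> * cis \<phi>"
  show ?thesis
  proof (rule that[of z])
    show "z \<in> szego_curve \<rho>" unfolding szego_curve_def z_def \<beta>_def[symmetric]
      using s ph \<beta> by (intro CollectI exI[of _ \<sigma>] exI[of _ \<phi>]) (auto simp: g_def)
    have "cos \<beta> < cos \<phi>" using ph \<beta> by (intro cos_monotone_0_pi) auto
    hence "\<sigma> * cos \<beta> < \<sigma> * cos \<phi>" using s by simp
    thus "z \<notin> critical_rays \<rho>" using s
      by (simp add: critical_rays_iff[OF \<rho>] z_def norm_mult \<beta>_def)
    have "sin \<phi> > 0" using ph \<beta> by (intro sin_gt_zero) auto
    hence "Im z \<noteq> 0" using s by (simp add: z_def)
    thus "z \<noteq> 1" by auto
    have "z - 1 = of_real (\<sigma> - 1) * cis \<phi> + (cis \<phi> - 1)" by (simp add: z_def algebra_simps)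
    also have "norm \<dots> \<le> norm (of_real (\<sigma> - 1) * cis \<phi>) + norm (cis \<phi> - 1)" by (rule norm_triangle_ineq)
    also have "norm (of_real (\<sigma> - 1) * cis \<phi>) = \<sigma> - 1" using s by (simp add: norm_mult del: of_real_diff)
    also have "norm (cis \<phi> - 1) = 2 * \<bar>sin (\<phi> / 2)\<bar>"
      using dist_exp_i_1[of \<phi>] by (simp add: cis_conv_exp)
    also have "\<dots> \<le> \<phi>" using abs_sin_x_le_abs_x[of "\<phi> / 2"] ph by simp
    finally have "dist z 1 \<le> (\<sigma> - 1) + \<phi>" by (simp add: dist_norm)
    also have "\<dots> < e" using s ph \<delta>_def \<delta> by simp
    finally show "dist z 1 < e" .
  qed
qed

theorem mainTheorem6:
  fixes \<rho> :: real and lam :: complex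
  assumes "\<rho> > 1" and "lam \<noteq> 0" and "lam \<noteq> 1"
  shows "ml_root_limits0 \<rho> lam = szego_curve \<rho> - critical_rays \<rho>"
proof (intro equalityI subsetI)
  fix z assume "z \<in> ml_root_limits0 \<rho> lam"
  thus "z \<in> szego_curve \<rho> - critical_rays \<rho>"
    using root_limit_imp_on_curve[OF assms] by (simp add: ml_root_limits0_def)
next
  fix z assume z: "z \<in> szego_curve \<rho> - critical_rays \<rho>"
  have "z \<in> ml_root_limits \<rho> lam"
  proof (cases "z = 1")
    case False
    thus ?thesis using on_curve_imp_root_limit[OF assms] z by blast
  next
    case True
    have "closed (ml_root_limits \<rho> lam)" unfolding ml_root_limits_def by (rule closed_limpts)
    moreover have "1 \<in> closure (ml_root_limits \<rho> lam)"
      unfolding closure_approachable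
    proof (intro allI impI)
      fix e :: real assume "e > 0"
      then obtain y where "y \<in> szego_curve \<rho>" "y \<notin> critical_rays \<rho>" "y \<noteq> 1" "dist y 1 < e"
        using curve_accumulates_at_one[OF assms(1)] by blast
      thus "\<exists>y\<in>ml_root_limits \<rho> lam. dist y 1 < e"
        using on_curve_imp_root_limit[OF assms] by blast
    qed
    ultimately show ?thesis using True by (simp add: closure_closed)
  qed
  thus "z \<in> ml_root_limits0 \<rho> lam" using z by (simp add: ml_root_limits0_def)
qed

end
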